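(* Let $X$ be a Banach space containing no isomorphic copy of $c_0$, and let $\Gamma:[0,1]\to cb(X)$. Then $\Gamma$ is McShane integrable in $cb(X)$ (resp. Birkhoff integrable in $cb(X)$) if and only if $\Gamma$ is Pettis integrable in $cb(X)$ and Henstock integrable in $cb(X)$ (resp. Pettis integrable in $cb(X)$ and $\mathcal{H}$-integrable in $cb(X)$).
   Context: $X$ is a (real) Banach space with dual $X^*$; $cb(X)$ is the family of all nonempty closed convex bounded subsets of $X$ with Hausdorff metric $d_H$. For $C\in cb(X)$, $s(x^*,C)=\sup\{\langle x^*,x\rangle: x\in C\}$. The interval $[0,1]$ carries Lebesgue measure $\lambda$ and $\mathcal{L}$ is the family of its Lebesgue measurable subsets. Sums of sets are Minkowski sums. Pettis: $\Gamma$ is Pettis integrable in $cb(X)$ if $s(x^*,\Gamma(\cdot))$ is Lebesgue integrable for every $x^*\in X^*$ and for each $A\in\mathcal{L}$ there is $M_\Gamma(A)\in cb(X)$ with $s(x^*,M_\Gamma(A))=\int_A s(x^*,\Gamma)\,d\lambda$ for all $x^*\in X^*$. Gauge integrals: a partition of $[0,1]$ is a finite collection $\{(I_1,t_1),\dots,(I_p,t_p)\}$ with $I_i$ nonoverlapping closed subintervals of $[0,1]$ whose union is $[0,1]$ and $t_i\in[0,1]$; it is a Perron partition if $t_i\in I_i$ for all $i$. A gauge is a positive function $\delta$ on $[0,1]$; a partition is $\delta$-fine if $I_i\subset(t_i-\delta(t_i),t_i+\delta(t_i))$ for all $i$. $\Gamma:[0,1]\to cb(X)$ is Henstock (resp.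 McShane) integrable in $cb(X)$ if there is $\Phi_\Gamma([0,1])\in cb(X)$ such that for every $\varepsilon>0$ there is a gauge $\delta$ such that for every $\delta$-fine Perron partition (resp. partition) of $[0,1]$, $d_H\big(\Phi_\Gamma([0,1]),\sum_{i=1}^p\Gamma(t_i)|I_i|\big)<\varepsilon$. $\Gamma$ is $\mathcal{H}$-integrable (resp. Birkhoff integrable) in $cb(X)$ if it satisfies the definition of Henstock (resp. McShane) integrability with the gauges $\delta$ required to be measurable. *)

theory Defs
  imports "HOL-Analysis.Analysis" "HOL-Library.Set_Algebras"
begin

section \<open>Isomorphic copies of the sequence space \<open>c\<^sub>0\<close>\<close>

text \<open>
  Since the topology on \<open>nat\<close> is discrete, \<open>nat \<Rightarrow>\<^sub>C real\<close> is the space of all bounded real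
  sequences with the supremum norm; \<open>c0\<close> is its subspace of null sequences.
\<close>

definition c0 :: "(nat \<Rightarrow>\<^sub>C real) set" where
  "c0 = {f. apply_bcontfun f \<longlonglongrightarrow> 0}"

text \<open>
  The values of the embedding \<open>T\<close> outside \<open>c0\<close> are irrelevant.
\<close>

definition contains_copy_of_c0 :: "'a::real_normed_vector itself \<Rightarrow> bool" where
  "contains_copy_of_c0 (X :: 'a itself) \<longleftrightarrow>
     (\<exists>(T :: (nat \<Rightarrow>\<^sub>C real) \<Rightarrow> 'a) a b.
        (\<forall>f\<in>c0. \<forall>g\<in>c0. T (f + g) = T f + T g) \<and>
        (\<forall>c. \<forall>f\<in>c0. T (c *\<^sub>R f) = c *\<^sub>R T f) \<and>
        0 < a \<and> (\<forall>f\<in>c0. a * norm f \<le> norm (T f) \<and> norm (T f) \<le> b * norm f))"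

section \<open>Closed convex bounded sets\<close>

definition cb :: "'a::real_normed_vector set set" where
  "cb = {C. C \<noteq> {} \<and> closed C \<and> convex C \<and> bounded C}"

definition support :: "('a::real_normed_vector \<Rightarrow>\<^sub>L real) \<Rightarrow> 'a set \<Rightarrow> real" where
  "support x' C = (SUP x\<in>C. blinfun_apply x' x)"

text \<open>
  The Hausdorff distance is meant for nonempty bounded sets, on which all suprema below are finite.
  A Minkowski sum of members of \<open>cb\<close> need not be closed; its distance to a member of \<open>cb\<close> is
  given by the same formula and coincides with that of its closure.
\<close>

definition hausdorff_dist :: "'a::metric_space set \<Rightarrow> 'a set \<Rightarrow> real" where
  "hausdorff_dist A B = max (SUP x\<in>A. infdist x B) (SUP y\<in>B. infdist y A)"

section \<open>Pettis integrability\<close>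

definition pettis_integrable_cb :: "(real \<Rightarrow> 'a::real_normed_vector set) \<Rightarrow> bool" where
  "pettis_integrable_cb \<Gamma> \<longleftrightarrow>
     (\<forall>x'. set_integrable lebesgue {0..1} (\<lambda>t. support x' (\<Gamma> t))) \<and>
     (\<forall>A. A \<in> sets lebesgue \<and> A \<subseteq> {0..1} \<longrightarrow>
        (\<exists>M\<in>cb. \<forall>x'. support x' M = (LINT t:A|lebesgue. support x' (\<Gamma> t))))"

section \<open>Partitions and gauge integrals\<close>

text \<open>
  The tags of a free partition may lie anywhere in \<open>[0,1]\<close>. As for \<open>tagged_division_of\<close>,
  one-point cells are permitted; they have length 0 and do not contribute to Riemann sums.
\<close>

definition free_partition :: "(real \<times> real set) set \<Rightarrow> bool" where
  "free_partition p \<longleftrightarrow>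
     finite p \<and>
     (\<forall>t K. (t, K) \<in> p \<longrightarrow> t \<in> {0..1} \<and> K \<subseteq> {0..1} \<and> (\<exists>a b. a \<le> b \<and> K = {a..b})) \<and>
     (\<forall>t1 K1 t2 K2. (t1, K1) \<in> p \<and> (t2, K2) \<in> p \<and> (t1, K1) \<noteq> (t2, K2) \<longrightarrow>
        interior K1 \<inter> interior K2 = {}) \<and>
     (\<Union>{K. \<exists>t. (t, K) \<in> p}) = {0..1}"

definition perron_partition :: "(real \<times> real set) set \<Rightarrow> bool" where
  "perron_partition p \<longleftrightarrow> free_partition p \<and> (\<forall>(t, K)\<in>p. t \<in> K)"

lemma perron_partition_iff_tagged_division:
  "perron_partition p \<longleftrightarrow> p tagged_division_of {0..1}"
proof
  assume p: "perron_partition p"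
  have "t \<in> K \<and> K \<subseteq> {0..1} \<and> (\<exists>a b. K = cbox a b)" if "(t, K) \<in> p" for t K
  proof -
    have "t \<in> K"
      using p that by (auto simp: perron_partition_def)
    moreover have "K \<subseteq> {0..1} \<and> (\<exists>a b. a \<le> b \<and> K = {a..b})"
      using p that by (simp add: perron_partition_def free_partition_def)
    ultimately show ?thesis
      by (metis cbox_interval)
  qed
  with p show "p tagged_division_of {0..1}"
    by (simp add: perron_partition_def free_partition_def tagged_division_of)
next
  assume p: "p tagged_division_of {0..1}"
  have K: "t \<in> K \<and> K \<subseteq> {0..1} \<and> (\<exists>a b. K = cbox a b)" if "(t, K) \<in> p" for t K
    using p that by (simp add: tagged_division_of)
  have "t \<in> {0..1} \<and> K \<subseteq> {0..1} \<and> (\<exists>a b. a \<le> b \<and> K = {a..b})" if tK: "(t, K) \<in> p" for t K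
  proof -
    obtain a b where ab: "K = {a..b}"
      using K[OF tK] by (metis cbox_interval)
    moreover have "a \<le> b"
      using K[OF tK] ab by auto
    ultimately show ?thesis
      using K[OF tK] by blast
  qed
  with p have "free_partition p"
    by (simp add: free_partition_def tagged_division_of)
  moreover have "\<forall>(t, K)\<in>p. t \<in> K"
    using K by blast
  ultimately show "perron_partition p"
    by (simp add: perron_partition_def)
qed

definition gauges :: "(real \<Rightarrow> real) set" where
  "gauges = {\<delta>. \<forall>t\<in>{0..1}. 0 < \<delta> t}"

definition measurable_gauges :: "(real \<Rightarrow> real) set" where
  "measurable_gauges = gauges \<inter> borel_measurable (lebesgue_on {0..1})"

text \<open>
  Sums of sets are the Minkowski sums of \<open>HOL-Library.Set_Algebras\<close>.
\<close>

definition riemann_sum ::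
  "(real \<Rightarrow> 'a::real_normed_vector set) \<Rightarrow> (real \<times> real set) set \<Rightarrow> 'a set" where
  "riemann_sum \<Gamma> p = (\<Sum>(t, K)\<in>p. (\<lambda>x. measure lebesgue K *\<^sub>R x) ` \<Gamma> t)"

text \<open>
  The four gauge integrals differ only in the admissible gauges \<open>G\<close> and partitions \<open>P\<close>.
\<close>

definition gauge_integrable_cb ::
  "(real \<Rightarrow> real) set \<Rightarrow> ((real \<times> real set) set \<Rightarrow> bool) \<Rightarrow>
   (real \<Rightarrow> 'a::real_normed_vector set) \<Rightarrow> bool" where
  "gauge_integrable_cb G P \<Gamma> \<longleftrightarrow>
     (\<exists>\<Phi>\<in>cb. \<forall>\<epsilon>>0. \<exists>\<delta>\<in>G. \<forall>p.
        P p \<and> (\<lambda>t. {t - \<delta> t<..<t + \<delta> t}) fine p \<longrightarrow>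
        hausdorff_dist \<Phi> (riemann_sum \<Gamma> p) < \<epsilon>)"

definition mcshane_integrable_cb :: "(real \<Rightarrow> 'a::real_normed_vector set) \<Rightarrow> bool" where
  "mcshane_integrable_cb = gauge_integrable_cb gauges free_partition"

definition henstock_integrable_cb :: "(real \<Rightarrow> 'a::real_normed_vector set) \<Rightarrow> bool" where
  "henstock_integrable_cb = gauge_integrable_cb gauges perron_partition"

definition birkhoff_integrable_cb :: "(real \<Rightarrow> 'a::real_normed_vector set) \<Rightarrow> bool" where
  "birkhoff_integrable_cb = gauge_integrable_cb measurable_gauges free_partition"

definition H_integrable_cb :: "(real \<Rightarrow> 'a::real_normed_vector set) \<Rightarrow> bool" where
  "H_integrable_cb = gauge_integrable_cb measurable_gauges perron_partition"

end

theory Submission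
  imports Defs
begin

text \<open>
  All integrals are read off from the support functions \<open>s(x', \<Gamma>(t))\<close>, uniformly over the unit ball of the dual,
  because \<open>d\<^sub>H(C, D) = sup {\<bar>s(x', C) - s(x', D)\<bar> : \<parallel>x'\<parallel> \<le> 1}\<close>.

  For the nontrivial direction, the absence of \<open>c\<^sub>0\<close> makes the indefinite Pettis integral absolutely continuous
  uniformly on the dual ball. If \<open>\<delta>\<close> is a gauge for Perron partitions, then the intervals between a tag \<open>t\<close> and
  a point \<open>x\<close> of its cell with \<open>\<delta>(x)\<close> not too small may be tagged by \<open>t\<close> as well as by \<open>x\<close>; by Vitali's covering
  lemma the set of \<open>x\<close> at which \<open>s(x', \<Gamma>(t))\<close> and \<open>s(x', \<Gamma>(x))\<close> differ noticeably is small. This bounds the error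
  of free partitions whose tags lie in a set on which \<open>\<Gamma>\<close> is bounded. The sets \<open>{\<delta> > 1/n}\<close> of one fixed gauge are
  of this kind and cover \<open>[0,1]\<close>, which keeps the new gauge measurable if the given ones are.

  Conversely, as tags of McShane partitions are free, cells of a common refinement of two partitions may be
  tagged by either of them; this yields absolute integrability of the support functions and, for every measurable
  \<open>A\<close>, Minkowski sums of the sets \<open>\<lambda>(A \<inter> K) \<Gamma>(t)\<close> that converge to the Pettis integral over \<open>A\<close>.
\<close>

section \<open>The Hahn-Banach theorem\<close>

text \<open>For one fixed functional the statement is classical. The difficulty is uniformity over
  the dual ball without separability: exceptional null sets depend on \<open>x'\<close>, and
  uncountably many of them cannot be united. Hence almost-everywhere arguments are made for a single
  \<open>x'\<close>, inside estimates whose constants and gauges do not depend on \<open>x'\<close>.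
  The tag sets \<open>{\<delta> > c}\<close> need not be measurable when a gauge is merely positive;
  they are replaced by measurable envelopes, which again do not depend on \<open>x'\<close>.

  The error caused by points of noticeable oscillation is multiplied by the bound of \<Gamma>, so
  this bound must be known before the gauge is chosen. This forces [0,1] to be divided into layers,
  each with its own gauge and its own share of the error.

  The space c_0 enters because points chosen from the Pettis integrals over disjoint sets only form
  a weakly unconditionally Cauchy series. In c_0 itself the unit vectors are such a series, with
  terms of norm one; without a copy of c_0 the terms of such a series tend to 0.\<close>

definition sublinear :: "('a::real_vector \<Rightarrow> real) \<Rightarrow> bool" where
  "sublinear q \<longleftrightarrow> (\<forall>x y. q (x + y) \<le> q x + q y) \<and> (\<forall>c x. 0 < c \<longrightarrow> q (c *\<^sub>R x) \<le> c * q x)"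

lemma sublinearI:
  assumes "\<And>x y. q (x + y) \<le> q x + q y" "\<And>c x. 0 < c \<Longrightarrow> q (c *\<^sub>R x) \<le> c * q x"
  shows "sublinear q"
  using assms by (simp add: sublinear_def)

lemma sublinear_add: "sublinear q \<Longrightarrow> q (x + y) \<le> q x + q y"
  by (simp add: sublinear_def)

lemma sublinear_scaleR:
  assumes "sublinear q" "0 < c"
  shows "q (c *\<^sub>R x) = c * q x"
proof (rule antisym)
  show "q (c *\<^sub>R x) \<le> c * q x"
    using assms by (simp add: sublinear_def)
  have "q ((1/c) *\<^sub>R (c *\<^sub>R x)) \<le> (1/c) * q (c *\<^sub>R x)"
    using assms(1)[unfolded sublinear_def] assms(2) zero_less_divide_1_iff by blast
  then show "c * q x \<le> q (c *\<^sub>R x)"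
    using assms by (simp add: field_simps)
qed

lemma sublinear_0:
  assumes "sublinear q"
  shows "q 0 = 0"
  using sublinear_scaleR[OF assms, of 2 0] by simp

lemma sublinear_minus:
  assumes "sublinear q"
  shows "- q (- x) \<le> q x"
  using sublinear_add[OF assms, of x "- x"] sublinear_0[OF assms] by simp

text \<open>Every \<open>q \<le> p\<close> satisfies
  \<open>- p (- x) \<le> - q (- x) \<le> q x\<close>, so the infimum is finite. An infimum of
  subadditive functions need not be subadditive; here the smaller one of \<open>q\<close> and
  \<open>r\<close> may replace both in \<open>q x + r y\<close>.\<close>

lemma sublinear_INF_chain:
  assumes "C \<noteq> {}" and C: "\<And>q. q \<in> C \<Longrightarrow> sublinear q \<and> q \<le> p"
    and chain: "\<And>q r. q \<in> C \<Longrightarrow> r \<in> C \<Longrightarrow> q \<le> r \<or> r \<le> q"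
  defines "Q \<equiv> \<lambda>x. INF q\<in>C. q x"
  shows "sublinear Q" and "\<And>q. q \<in> C \<Longrightarrow> Q \<le> q"
proof -
  have bdd: "bdd_below ((\<lambda>q. q x) ` C)" for x
  proof (rule bdd_belowI2)
    fix q assume "q \<in> C"
    then show "- p (- x) \<le> q x"
      using C[of q] sublinear_minus[of q x] by (metis le_fun_def neg_le_iff_le order_trans)
  qed
  have le: "Q x \<le> q x" if "q \<in> C" for q x
    unfolding Q_def using that bdd by (intro cINF_lower)
  then show "\<And>q. q \<in> C \<Longrightarrow> Q \<le> q"
    by (simp add: le_fun_def)
  show "sublinear Q"
  proof (rule sublinearI)
    fix x y
    have "Q (x + y) \<le> q x + r y" if q: "q \<in> C" and r: "r \<in> C" for q r
    proof -
      obtain s where s: "s \<in> C" "s \<le> q" "s \<le> r"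
        using chain[OF q r] q r by auto
      have "Q (x + y) \<le> s x + s y"
        using le[OF s(1)] sublinear_add[of s x y] C[OF s(1)] order_trans by blast
      also have "\<dots> \<le> q x + r y"
        using s by (intro add_mono) (auto simp: le_fun_def)
      finally show ?thesis .
    qed
    then have "Q (x + y) - r y \<le> Q x" if "r \<in> C" for r
      unfolding Q_def[of] using that \<open>C \<noteq> {}\<close> by (intro cINF_greatest) (auto simp: algebra_simps)
    then have "Q (x + y) - Q x \<le> Q y"
      unfolding Q_def[of] using \<open>C \<noteq> {}\<close> by (intro cINF_greatest) (auto simp: algebra_simps)
    then show "Q (x + y) \<le> Q x + Q y"
      by simp
  next
    fix c :: real and x assume "0 < c"
    have "Q (c *\<^sub>R x) / c \<le> q x" if "q \<in> C" for q
      using le[OF that, of "c *\<^sub>R x"] sublinear_scaleR[of q c x] C[OF that] \<open>0 < c\<close>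
      by (simp add: field_simps)
    then have "Q (c *\<^sub>R x) / c \<le> Q x"
      unfolding Q_def[of] using \<open>C \<noteq> {}\<close> by (intro cINF_greatest) auto
    then show "Q (c *\<^sub>R x) \<le> c * Q x"
      using \<open>0 < c\<close> by (simp add: field_simps)
  qed
qed

text \<open>Tilting \<open>q\<close> along the ray through \<open>y\<close>, as in \<open>r\<close>,
  gives a sublinear functional below \<open>q\<close>; minimality forces \<open>r = q\<close>, and
  the term \<open>t = 1\<close> of the infimum is the claim.\<close>

lemma minimal_sublinear_superadditive:
  assumes q: "sublinear q" and min: "\<And>r. sublinear r \<Longrightarrow> r \<le> q \<Longrightarrow> r = q"
  shows "q x + q y \<le> q (x + y)"
proof -
  define r where "r x = (INF t\<in>{0..}. q (x + t *\<^sub>R y) - t * q y)" for x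
  have qt: "q (t *\<^sub>R y) = t * q y" if "0 \<le> t" for t
    using that sublinear_scaleR[OF q, of t y] sublinear_0[OF q] by (cases "t = 0") auto
  have "bdd_below ((\<lambda>t. q (x + t *\<^sub>R y) - t * q y) ` {0..})" for x
  proof (rule bdd_belowI2)
    fix t :: real assume "t \<in> {0..}"
    then have "t * q y \<le> q (x + t *\<^sub>R y) + q (- x)"
      using sublinear_add[OF q, of "x + t *\<^sub>R y" "- x"] qt[of t] by simp
    then show "- q (- x) \<le> q (x + t *\<^sub>R y) - t * q y"
      by simp
  qed
  then have le: "r x \<le> q (x + t *\<^sub>R y) - t * q y" if "0 \<le> t" for t x
    unfolding r_def using that by (intro cINF_lower) auto
  have ge: "b \<le> r x" if "\<And>t. 0 \<le> t \<Longrightarrow> b \<le> q (x + t *\<^sub>R y) - t * q y" for b x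
    unfolding r_def using that by (intro cINF_greatest) auto
  have "sublinear r"
  proof (rule sublinearI)
    fix x z
    have *: "r (x + z) \<le> (q (x + s *\<^sub>R y) - s * q y) + (q (z + t *\<^sub>R y) - t * q y)" if "0 \<le> s" "0 \<le> t" for s t
    proof -
      have "r (x + z) \<le> q ((x + z) + (s + t) *\<^sub>R y) - (s + t) * q y"
        using that by (intro le) auto
      also have "(x + z) + (s + t) *\<^sub>R y = (x + s *\<^sub>R y) + (z + t *\<^sub>R y)"
        by (simp add: algebra_simps)
      also have "q \<dots> \<le> q (x + s *\<^sub>R y) + q (z + t *\<^sub>R y)"
        by (rule sublinear_add[OF q])
      finally show ?thesis
        by (simp add: algebra_simps)
    qed
    have "r (x + z) - (q (z + t *\<^sub>R y) - t * q y) \<le> r x" if "0 \<le> t" for t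
      using *[OF _ that] by (intro ge) (simp add: algebra_simps)
    then have "r (x + z) - r x \<le> r z"
      by (intro ge) (simp add: algebra_simps)
    then show "r (x + z) \<le> r x + r z"
      by simp
  next
    fix c :: real and x assume c: "0 < c"
    have "r (c *\<^sub>R x) / c \<le> q (x + t *\<^sub>R y) - t * q y" if "0 \<le> t" for t
    proof -
      have "r (c *\<^sub>R x) \<le> q (c *\<^sub>R x + (c * t) *\<^sub>R y) - (c * t) * q y"
        using that c by (intro le) auto
      also have "c *\<^sub>R x + (c * t) *\<^sub>R y = c *\<^sub>R (x + t *\<^sub>R y)"
        by (simp add: algebra_simps)
      finally have "r (c *\<^sub>R x) \<le> c * (q (x + t *\<^sub>R y) - t * q y)"
        using sublinear_scaleR[OF q c, of "x + t *\<^sub>R y"] by (simp add: right_diff_distrib)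
      then show ?thesis
        using c by (simp add: field_simps)
    qed
    then have "r (c *\<^sub>R x) / c \<le> r x"
      by (rule ge)
    then show "r (c *\<^sub>R x) \<le> c * r x"
      using c by (simp add: field_simps)
  qed
  moreover have "r \<le> q"
    using le[of 0] by (simp add: le_fun_def)
  ultimately have "r = q"
    by (rule min)
  then show ?thesis
    using le[of 1 x] by simp
qed

text \<open>Zorn's lemma is applied to whole sublinear functionals, in the reversed order, instead
  of to partial linear extensions: a minimal sublinear functional is additive, hence linear.\<close>

theorem Hahn_Banach_sublinear:
  assumes p: "sublinear p"
  obtains f where "linear f" "\<And>x. f x \<le> p x"
proof -
  define A where "A = {q. sublinear q \<and> q \<le> p}"
  have "\<exists>m\<in>A. \<forall>q\<in>A. m \<ge> q \<longrightarrow> q = m"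
  proof (rule predicate_Zorn)
    show "partial_order_on A (relation_of (\<ge>) A)"
      by (rule partial_order_on_relation_ofI) auto
    fix C assume C: "C \<in> Chains (relation_of (\<ge>) A)"
    then have CA: "q \<in> A" if "q \<in> C" for q
      using that by (auto simp: Chains_def relation_of_def)
    show "\<exists>u\<in>A. \<forall>q\<in>C. q \<ge> u"
    proof (cases "C = {}")
      case True
      then show ?thesis
        using p by (auto simp: A_def)
    next
      case False
      let ?Q = "\<lambda>x. INF q\<in>C. q x"
      have ch: "q \<le> r \<or> r \<le> q" if "q \<in> C" "r \<in> C" for q r
        using C that by (auto simp: Chains_def relation_of_def)
      have Cp: "sublinear q \<and> q \<le> p" if "q \<in> C" for q
        using CA[OF that] by (simp add: A_def)
      have "sublinear ?Q" and le: "\<And>q. q \<in> C \<Longrightarrow> ?Q \<le> q"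
        using sublinear_INF_chain[OF False Cp ch] by blast+
      moreover obtain q where "q \<in> C"
        using False by auto
      ultimately have "?Q \<in> A"
        using Cp le order_trans unfolding A_def by blast
      with le show ?thesis
        by blast
    qed
  qed
  then obtain m where m: "sublinear m" "m \<le> p" and min: "\<And>q. sublinear q \<Longrightarrow> q \<le> p \<Longrightarrow> q \<le> m \<Longrightarrow> q = m"
    by (auto simp: A_def)
  have add: "m (x + y) = m x + m y" for x y
    using minimal_sublinear_superadditive[OF m(1), of x y] sublinear_add[OF m(1), of x y] min m(2)
    by (meson antisym order_trans)
  have neg: "m (- x) = - m x" for x
    using add[of x "- x"] sublinear_0[OF m(1)] by simp
  have "m (c *\<^sub>R x) = c *\<^sub>R m x" for c x
  proof -
    consider "c > 0" | "c = 0" | "c < 0" by linarith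
    then show ?thesis
    proof cases
      case 3
      then have "m ((- c) *\<^sub>R x) = (- c) * m x"
        by (intro sublinear_scaleR[OF m(1)]) auto
      then show ?thesis
        using neg[of "c *\<^sub>R x"] by simp
    qed (use sublinear_scaleR[OF m(1)] sublinear_0[OF m(1)] in auto)
  qed
  then have "linear m"
    using add by (intro linearI) auto
  with m show ?thesis
    by (intro that) (auto simp: le_fun_def)
qed

text \<open>
  The sublinear functional is the infimum over the cone spanned by \<open>C\<close> of the norm, tilted so that
  a linear minorant is forced to be at least \<open>d\<close> on \<open>C\<close>.
\<close>

lemma Hahn_Banach_distance_from_0:
  fixes C :: "'a::real_normed_vector set"
  assumes "convex C" "C \<noteq> {}" and d: "\<And>c. c \<in> C \<Longrightarrow> d \<le> norm c"
  obtains f :: "'a \<Rightarrow>\<^sub>L real" where "norm f \<le> 1" "\<And>c. c \<in> C \<Longrightarrow> d \<le> f c"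
proof -
  define P where "P x = (INF (t, c)\<in>{0..} \<times> C. norm (x + t *\<^sub>R c) - t * d)" for x :: 'a
  have "bdd_below ((\<lambda>(t, c). norm (x + t *\<^sub>R c) - t * d) ` ({0..} \<times> C))" for x
  proof (rule bdd_belowI2)
    fix tc :: "real \<times> 'a" assume "tc \<in> {0..} \<times> C"
    then obtain t c where tc: "tc = (t, c)" "0 \<le> t" "c \<in> C"
      by auto
    then have "t * d \<le> norm (t *\<^sub>R c)"
      using d[of c] by (simp add: mult_left_mono)
    also have "\<dots> \<le> norm (x + t *\<^sub>R c) + norm x"
      by (metis add_diff_cancel_left' norm_triangle_ineq4)
    finally show "- norm x \<le> (case tc of (t, c) \<Rightarrow> norm (x + t *\<^sub>R c) - t * d)"
      by (simp add: tc)
  qed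
  then have le: "P x \<le> norm (x + t *\<^sub>R c) - t * d" if "0 \<le> t" "c \<in> C" for t c x
    unfolding P_def using that by (intro cINF_lower2[where x="(t, c)"]) auto
  have ge: "b \<le> P x" if "\<And>t c. 0 \<le> t \<Longrightarrow> c \<in> C \<Longrightarrow> b \<le> norm (x + t *\<^sub>R c) - t * d" for b x
    unfolding P_def using that \<open>C \<noteq> {}\<close> by (intro cINF_greatest) auto
  have "sublinear P"
  proof (rule sublinearI)
    fix x y
    have *: "P (x + y) \<le> (norm (x + s *\<^sub>R b) - s * d) + (norm (y + t *\<^sub>R c) - t * d)"
      if st: "0 \<le> s" "0 \<le> t" "b \<in> C" "c \<in> C" for s t b c
    proof -
      \<comment> \<open>Convexity merges two elements of the cone into a single multiple of a point
        of \<open>C\<close>; the weights \<open>s / (s + t)\<close> and \<open>t / (s + t)\<close>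
        make no sense at the apex.\<close>
      obtain e where e: "e \<in> C" "(s + t) *\<^sub>R e = s *\<^sub>R b + t *\<^sub>R c"
      proof (cases "s + t = 0")
        case True
        then have "s = 0" "t = 0"
          using st by auto
        then show ?thesis
          using st(3) by (intro that[of b]) auto
      next
        case False
        then have "(s / (s + t)) *\<^sub>R b + (t / (s + t)) *\<^sub>R c \<in> C"
          using st by (intro convexD[OF \<open>convex C\<close>]) (auto simp: add_divide_distrib[symmetric])
        moreover have "(s + t) *\<^sub>R ((s / (s + t)) *\<^sub>R b + (t / (s + t)) *\<^sub>R c) = s *\<^sub>R b + t *\<^sub>R c"
          using False by (simp add: scaleR_add_right)
        ultimately show ?thesis
          using that by blast
      qed
      have "P (x + y) \<le> norm ((x + y) + (s + t) *\<^sub>R e) - (s + t) * d"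
        using st e by (intro le) auto
      also have "(x + y) + (s + t) *\<^sub>R e = (x + s *\<^sub>R b) + (y + t *\<^sub>R c)"
        using e by simp
      also have "norm \<dots> \<le> norm (x + s *\<^sub>R b) + norm (y + t *\<^sub>R c)"
        by (rule norm_triangle_ineq)
      finally show ?thesis
        by (simp add: algebra_simps)
    qed
    have "P (x + y) - (norm (y + t *\<^sub>R c) - t * d) \<le> P x" if "0 \<le> t" "c \<in> C" for t c
      by (rule ge) (use *[OF _ that(1) _ that(2)] in \<open>simp add: algebra_simps\<close>)
    then have "P (x + y) - P x \<le> P y"
      by (intro ge) (simp add: algebra_simps)
    then show "P (x + y) \<le> P x + P y"
      by simp
  next
    fix k :: real and x assume k: "0 < k"
    have "P (k *\<^sub>R x) / k \<le> norm (x + t *\<^sub>R c) - t * d" if "0 \<le> t" "c \<in> C" for t c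
    proof -
      have "P (k *\<^sub>R x) \<le> norm (k *\<^sub>R x + (k * t) *\<^sub>R c) - (k * t) * d"
        using that k by (intro le) auto
      also have "k *\<^sub>R x + (k * t) *\<^sub>R c = k *\<^sub>R (x + t *\<^sub>R c)"
        by (simp add: algebra_simps)
      finally have "P (k *\<^sub>R x) \<le> k * (norm (x + t *\<^sub>R c) - t * d)"
        using k by (simp add: right_diff_distrib)
      then show ?thesis
        using k by (simp add: field_simps)
    qed
    then have "P (k *\<^sub>R x) / k \<le> P x"
      by (rule ge)
    then show "P (k *\<^sub>R x) \<le> k * P x"
      using k by (simp add: field_simps)
  qed
  then obtain f where f: "linear f" and fP: "\<And>x. f x \<le> P x"
    using Hahn_Banach_sublinear by blast
  have "f x \<le> norm x" for x
    using fP[of x] le[of 0 _ x] \<open>C \<noteq> {}\<close> by (fastforce intro: order_trans)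
  then have bound: "norm (f x) \<le> norm x * 1" for x
    using linear_neg[OF f, of x] by (metis abs_le_iff mult.right_neutral norm_minus_cancel real_norm_def)
  then have bl: "bounded_linear f"
    using f by (intro bounded_linear_intro[where K=1]) (auto simp: linear_add linear_scale)
  show ?thesis
  proof
    show "norm (Blinfun f) \<le> 1"
      using bound bl by (intro norm_blinfun_bound) (auto simp: bounded_linear_Blinfun_apply)
    fix c assume "c \<in> C"
    \<comment> \<open>The choice \<open>t = 1\<close> at the point \<open>- c\<close> makes the norm
      in the infimum vanish.\<close>
    then have "f (- c) \<le> - d"
      using fP[of "- c"] le[of 1 c "- c"] by simp
    then show "d \<le> Blinfun f c"
      using bl by (simp add: bounded_linear_Blinfun_apply linear_neg[OF f])
  qed
qed

text \<open>Quantitative separation: the distance of 0 from \<open>x - C\<close> is that of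
  \<open>x\<close> from \<open>C\<close>, and a functional of norm at most one realises the full
  distance as a gap. This is the source of the support function formula for the Hausdorff
  distance.\<close>

lemma Hahn_Banach_infdist:
  fixes C :: "'a::real_normed_vector set"
  assumes "convex C" "C \<noteq> {}"
  obtains f :: "'a \<Rightarrow>\<^sub>L real" where "norm f \<le> 1" "\<And>c. c \<in> C \<Longrightarrow> f c + infdist x C \<le> f x"
proof -
  have "infdist x C \<le> norm c" if "c \<in> (\<lambda>c. x - c) ` C" for c
    using that infdist_le[of _ C x] by (auto simp: dist_norm)
  moreover have "convex ((\<lambda>c. x - c) ` C)"
    using convex_translation[OF convex_negations[OF \<open>convex C\<close>], of x]
    by (simp add: image_image)
  ultimately obtain f :: "'a \<Rightarrow>\<^sub>L real" where "norm f \<le> 1" "\<And>c. c \<in> (\<lambda>c. x - c) ` C \<Longrightarrow> infdist x C \<le> f c"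
    using Hahn_Banach_distance_from_0[of "(\<lambda>c. x - c) ` C" "infdist x C"] \<open>C \<noteq> {}\<close> by blast
  then show ?thesis
    using that[of f] by (fastforce simp: blinfun.diff_right)
qed

lemma norming_functional:
  fixes x :: "'a::real_normed_vector"
  obtains f :: "'a \<Rightarrow>\<^sub>L real" where "norm f \<le> 1" "f x = norm x"
proof -
  obtain f :: "'a \<Rightarrow>\<^sub>L real" where f: "norm f \<le> 1" "f 0 + infdist x {0} \<le> f x"
    using Hahn_Banach_infdist[of "{0}" x] by auto
  moreover have "f x \<le> norm x"
    using norm_blinfun[of f x] f(1) by (smt (verit) mult_left_le_one_le norm_ge_zero real_norm_def)
  ultimately show ?thesis
    using that[of f] by (simp add: blinfun.zero_right)
qed

section \<open>Series in spaces without a copy of \<open>c\<^sub>0\<close>\<close>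

lemma geometric_convergence:
  fixes x :: "nat \<Rightarrow> 'a::banach"
  assumes q: "0 \<le> q" "q < 1" and x: "\<And>n. norm (x (Suc n) - x n) \<le> c * q ^ n"
  obtains l where "x \<longlonglongrightarrow> l" "\<And>n. norm (l - x n) \<le> c * q ^ n / (1 - q)"
proof -
  define d where "d n = x (Suc n) - x n" for n
  have geo: "summable (\<lambda>k. c * q ^ (k + n))" for n
    using q by (intro summable_mult summable_ignore_initial_segment summable_geometric) simp
  have "summable d"
    by (rule summable_comparison_test'[OF geo[of 0], of 0]) (simp add: d_def x)
  define l where "l = x 0 + suminf d"
  have part: "(\<Sum>k<n. d k) = x n - x 0" for n
    unfolding d_def by (rule sum_lessThan_telescope)
  show ?thesis
  proof
    have "(\<lambda>n. x n - x 0) \<longlonglongrightarrow> suminf d"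
      using summable_LIMSEQ[OF \<open>summable d\<close>] by (simp add: part)
    then show "x \<longlonglongrightarrow> l"
      using tendsto_add[OF tendsto_const[of "x 0"]] by (fastforce simp: l_def)
    fix n
    have "l - x n = (\<Sum>k. d (k + n))"
      using suminf_split_initial_segment[OF \<open>summable d\<close>, of n] by (simp add: l_def part)
    also have "norm \<dots> \<le> (\<Sum>k. c * q ^ (k + n))"
      by (rule norm_suminf_le[OF _ geo]) (simp add: d_def x)
    also have "\<dots> = c * q ^ n * (\<Sum>k. q ^ k)"
      using q suminf_mult[of "\<lambda>k. q ^ k" "c * q ^ n"] by (simp add: power_add mult_ac summable_geometric)
    also have "\<dots> = c * q ^ n / (1 - q)"
      using q by (simp add: suminf_geometric)
    finally show "norm (l - x n) \<le> c * q ^ n / (1 - q)" .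
  qed
qed

text \<open>For \<open>f\<close> norming \<open>x\<close>, the values of \<open>g + r f\<close> and
  \<open>g - r f\<close> at \<open>x\<close> differ by \<open>2 * r * norm x\<close>, so one of them
  is large.\<close>

lemma exists_functional_near_large:
  fixes g :: "'a::real_normed_vector \<Rightarrow>\<^sub>L real"
  assumes "0 < r"
  shows "\<exists>h. norm (h - g) \<le> r \<and> r * norm x \<le> \<bar>h x\<bar>"
proof -
  obtain f :: "'a \<Rightarrow>\<^sub>L real" where f: "norm f \<le> 1" "f x = norm x"
    using norming_functional by blast
  have "norm (r *\<^sub>R f) \<le> r"
    using f assms by simp
  then have n: "norm (g + r *\<^sub>R f - g) \<le> r" "norm (g - r *\<^sub>R f - g) \<le> r"
    by simp_all
  have e: "(g + r *\<^sub>R f) x = g x + r * norm x" "(g - r *\<^sub>R f) x = g x - r * norm x"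
    using f by (simp_all add: blinfun.add_left blinfun.diff_left blinfun.scaleR_left)
  have "r * norm x \<le> \<bar>g x + r * norm x\<bar> \<or> r * norm x \<le> \<bar>g x - r * norm x\<bar>"
    by linarith
  then show ?thesis
    using n unfolding e[symmetric] by blast
qed

text \<open>A gliding hump argument in the dual space, which is complete.\<close>

theorem weakly_bounded_imp_bounded:
  fixes S :: "'a::real_normed_vector set"
  assumes "\<And>f :: 'a \<Rightarrow>\<^sub>L real. \<exists>K. \<forall>x\<in>S. \<bar>f x\<bar> \<le> K"
  shows "bounded S"
proof (rule ccontr)
  assume "\<not> bounded S"
  then have "\<exists>x\<in>S. 4 ^ n < norm x" for n :: nat
    unfolding bounded_iff by (auto simp: not_le)
  then have "\<exists>x\<in>S. 4 ^ n \<le> norm x" for n :: nat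
    using less_imp_le by blast
  then obtain x where xS: "\<And>n. x n \<in> S" and x: "\<And>n. 4 ^ n \<le> norm (x n)"
    by metis
  have "\<exists>g :: nat \<Rightarrow> 'a \<Rightarrow>\<^sub>L real. \<forall>n. True \<and>
      (norm (g (Suc n) - g n) \<le> (1/3) ^ n \<and> (1/3) ^ n * norm (x n) \<le> \<bar>blinfun_apply (g (Suc n)) (x n)\<bar>)"
    by (rule dependent_nat_choice) (auto intro: exists_functional_near_large)
  then obtain g :: "nat \<Rightarrow> 'a \<Rightarrow>\<^sub>L real"
    where g: "\<And>n. norm (g (Suc n) - g n) \<le> (1/3) ^ n"
      and gx: "\<And>n. (1/3) ^ n * norm (x n) \<le> \<bar>g (Suc n) (x n)\<bar>"
    by blast
  obtain h where h: "\<And>n. norm (h - g n) \<le> 1 * (1/3) ^ n / (1 - 1/3)"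
    by (rule geometric_convergence[of "1/3" g 1]) (use g in auto)
  \<comment> \<open>The remaining corrections sum to \<open>(1/3) ^ Suc n / (1 - 1/3)\<close>, which
    is half of the factor guaranteed at stage \<open>n\<close>. So \<open>h\<close> keeps at least
    half of the value at \<open>x n\<close>, and the growth \<open>4 ^ n\<close> of the norms leaves
    \<open>(4/3) ^ n / 2\<close>.\<close>
  have near: "norm (h - g (Suc n)) \<le> (1/2) * (1/3) ^ n" for n
    using h[of "Suc n"] by simp
  obtain K where K: "\<And>y. y \<in> S \<Longrightarrow> \<bar>h y\<bar> \<le> K"
    using assms[of h] by blast
  have "(4/3) ^ n \<le> 2 * K" for n :: nat
  proof -
    define w where "w = (1/3) ^ n * norm (x n)"
    have "\<bar>h (x n) - g (Suc n) (x n)\<bar> \<le> w / 2"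
      using norm_blinfun[of "h - g (Suc n)" "x n"] mult_right_mono[OF near[of n], of "norm (x n)"]
      by (simp add: blinfun.diff_left w_def)
    moreover have "w \<le> \<bar>g (Suc n) (x n)\<bar>"
      using gx[of n] by (simp add: w_def)
    ultimately have "w / 2 \<le> \<bar>h (x n)\<bar>"
      by linarith
    moreover have "(1/3) ^ n * 4 ^ n \<le> w"
      unfolding w_def using x[of n] by (intro mult_left_mono) auto
    moreover have "(4/3) ^ n = (1/3) ^ n * (4 :: real) ^ n"
      by (simp add: power_divide)
    ultimately show ?thesis
      using K[OF xS[of n]] by linarith
  qed
  moreover obtain n where "2 * K < (4/3 :: real) ^ n"
    using real_arch_pow[of "4/3" "2 * K"] by auto
  ultimately show False
    by (meson not_le)
qed

text \<open>Finite combinations with coefficients in [-1,1] form a weakly bounded, hence bounded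
  set. The signs of \<open>f (x n)\<close> as coefficients turn the sum of absolute values into the
  value of \<open>f\<close> at one such combination.\<close>

lemma weakly_unconditionally_Cauchy_bound:
  fixes x :: "nat \<Rightarrow> 'a::real_normed_vector"
  assumes wuc: "\<And>f :: 'a \<Rightarrow>\<^sub>L real. \<exists>K. \<forall>F. finite F \<longrightarrow> (\<Sum>n\<in>F. \<bar>f (x n)\<bar>) \<le> K"
  obtains K where "0 \<le> K" "\<And>f :: 'a \<Rightarrow>\<^sub>L real. \<And>F. finite F \<Longrightarrow> norm f \<le> 1 \<Longrightarrow> (\<Sum>n\<in>F. \<bar>blinfun_apply f (x n)\<bar>) \<le> K"
proof -
  define S where "S = {\<Sum>n\<in>F. e n *\<^sub>R x n | F e. finite F \<and> (\<forall>n. \<bar>e n\<bar> \<le> 1)}"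
  have "bounded S"
  proof (rule weakly_bounded_imp_bounded)
    fix f :: "'a \<Rightarrow>\<^sub>L real"
    obtain K where K: "\<And>F. finite F \<Longrightarrow> (\<Sum>n\<in>F. \<bar>f (x n)\<bar>) \<le> K"
      using wuc by blast
    have "\<bar>f (\<Sum>n\<in>F. e n *\<^sub>R x n)\<bar> \<le> K" if "finite F" "\<forall>n. \<bar>e n\<bar> \<le> 1" for F e
    proof -
      have "\<bar>f (\<Sum>n\<in>F. e n *\<^sub>R x n)\<bar> \<le> (\<Sum>n\<in>F. \<bar>e n * f (x n)\<bar>)"
        by (simp add: blinfun.sum_right blinfun.scaleR_right sum_abs)
      also have "\<dots> \<le> (\<Sum>n\<in>F. \<bar>f (x n)\<bar>)"
        using that by (intro sum_mono) (simp add: abs_mult mult_left_le_one_le)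
      finally show ?thesis
        using K[OF that(1)] by linarith
    qed
    then show "\<exists>K. \<forall>s\<in>S. \<bar>f s\<bar> \<le> K"
      unfolding S_def by blast
  qed
  then obtain K where K: "0 < K" "\<And>s. s \<in> S \<Longrightarrow> norm s \<le> K"
    by (meson bounded_pos)
  have "(\<Sum>n\<in>F. \<bar>f (x n)\<bar>) \<le> K" if "finite F" "norm f \<le> 1" for f :: "'a \<Rightarrow>\<^sub>L real" and F
  proof -
    let ?s = "\<Sum>n\<in>F. sgn (f (x n)) *\<^sub>R x n"
    have "?s \<in> S"
      unfolding S_def using that by (auto simp: abs_sgn_eq intro!: exI[of _ F] exI[of _ "\<lambda>n. sgn (f (x n))"])
    have "(\<Sum>n\<in>F. \<bar>f (x n)\<bar>) = f ?s"
      by (simp add: blinfun.sum_right blinfun.scaleR_right abs_sgn mult.commute)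
    also have "\<dots> \<le> norm f * norm ?s"
      using norm_blinfun[of f ?s] by simp
    also have "\<dots> \<le> 1 * K"
      using that K(2)[OF \<open>?s \<in> S\<close>] by (intro mult_mono) auto
    finally show ?thesis
      by simp
  qed
  with K(1) show ?thesis
    by (intro that[of K]) auto
qed

text \<open>Induction on the number of portions \<open>e\<close> that a row may carry. Split
  \<open>S\<close> into infinitely many infinite pieces. If no piece works, each contains a row
  index \<open>n j\<close> with mass more than \<open>e\<close> on a finite subset of the same piece
  that avoids \<open>n j\<close>. On the set of all these indices that mass is lost, and the rows
  carry at most one portion less.\<close>

lemma Rosenthal_lemma:
  fixes a :: "nat \<Rightarrow> nat \<Rightarrow> real"
  assumes "infinite S" "0 < e" "\<And>n m. 0 \<le> a n m"
    and "\<And>n F. n \<in> S \<Longrightarrow> finite F \<Longrightarrow> F \<subseteq> S \<Longrightarrow> (\<Sum>m\<in>F. a n m) \<le> real k * e"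
  shows "\<exists>S'\<subseteq>S. infinite S' \<and> (\<forall>n\<in>S'. \<forall>F. finite F \<longrightarrow> F \<subseteq> S' - {n} \<longrightarrow> (\<Sum>m\<in>F. a n m) \<le> e)"
  using assms(1,4)
proof (induction k arbitrary: S)
  case 0
  show ?case
  proof (intro exI[of _ S] conjI ballI allI impI)
    fix n F assume "n \<in> S" "finite F" "F \<subseteq> S - {n}"
    then have "F \<subseteq> S"
      by blast
    then show "(\<Sum>m\<in>F. a n m) \<le> e"
      using "0.prems"(2)[OF \<open>n \<in> S\<close> \<open>finite F\<close>] \<open>0 < e\<close> by simp
  qed (use 0 in auto)
next
  case (Suc k)
  \<comment> \<open>The pairing function turns one enumeration of \<open>S\<close> into infinitely
    many disjoint infinite subsets.\<close>
  define N where "N j = (\<lambda>i. enumerate S (prod_encode (j, i))) ` UNIV" for j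
  have inj: "enumerate S u = enumerate S v \<longleftrightarrow> u = v" for u v
    using bij_enumerate[OF \<open>infinite S\<close>] by (auto simp: bij_betw_def inj_on_def)
  have N_inf: "infinite (N j)" for j
    unfolding N_def by (intro range_inj_infinite injI) (simp add: inj)
  have N_S: "N j \<subseteq> S" for j
    unfolding N_def using enumerate_in_set[OF \<open>infinite S\<close>] by auto
  have N_disj: "i = j" if "n \<in> N i" "n \<in> N j" for i j n
    using that by (auto simp: N_def inj)
  show ?case
  proof (cases "\<exists>j. \<forall>n\<in>N j. \<forall>F. finite F \<longrightarrow> F \<subseteq> N j - {n} \<longrightarrow> (\<Sum>m\<in>F. a n m) \<le> e")
    case True
    then show ?thesis
      using N_inf N_S by meson
  next
    case False
    then have "\<forall>j. \<exists>n F. n \<in> N j \<and> finite F \<and> F \<subseteq> N j - {n} \<and> e < (\<Sum>m\<in>F. a n m)"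
      by (meson not_le)
    then obtain n F where n: "\<And>j. n j \<in> N j" and F: "\<And>j. finite (F j)" "\<And>j. F j \<subseteq> N j - {n j}"
      and big: "\<And>j. e < (\<Sum>m\<in>F j. a (n j) m)"
      by metis
    have "inj n"
      using n N_disj by (metis injI)
    then have inf: "infinite (range n)"
      by (rule range_inj_infinite)
    have "(\<Sum>m\<in>G. a i m) \<le> real k * e" if i: "i \<in> range n" and G: "finite G" "G \<subseteq> range n" for i G
    proof -
      obtain j where j: "i = n j"
        using i by blast
      have disj: "G \<inter> F j = {}"
      proof (rule ccontr)
        assume "G \<inter> F j \<noteq> {}"
        then obtain l where l: "n l \<in> F j"
          using G(2) by blast
        then have "n l \<in> N j" "n l \<noteq> n j"
          using F(2)[of j] by auto
        then show False
          using N_disj[OF n[of l]] by auto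
      qed
      have "(\<Sum>m\<in>G. a i m) + (\<Sum>m\<in>F j. a i m) = (\<Sum>m\<in>G \<union> F j. a i m)"
        using G F disj by (simp add: sum.union_disjoint)
      also have "\<dots> \<le> real (Suc k) * e"
        using G F(1)[of j] F(2)[of j] n N_S i by (intro Suc.prems) blast+
      finally show ?thesis
        using big[of j] j by (simp add: algebra_simps)
    qed
    then obtain S' where "S' \<subseteq> range n" "infinite S'"
        "\<forall>n\<in>S'. \<forall>F. finite F \<longrightarrow> F \<subseteq> S' - {n} \<longrightarrow> (\<Sum>m\<in>F. a n m) \<le> e"
      using Suc.IH[OF inf] by blast
    moreover have "range n \<subseteq> S"
      using n N_S by blast
    ultimately show ?thesis
      by (intro exI[of _ S']) auto
  qed
qed

text \<open>
  Rosenthal's lemma, applied to norming functionals of the terms, takes the place of the selection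
  of a basic subsequence in the usual proof.
\<close>

theorem Bessaga_Pelczynski:
  fixes x :: "nat \<Rightarrow> 'a::banach"
  assumes wuc: "\<And>f :: 'a \<Rightarrow>\<^sub>L real. \<exists>K. \<forall>F. finite F \<longrightarrow> (\<Sum>n\<in>F. \<bar>f (x n)\<bar>) \<le> K"
    and "0 < a" and large: "\<And>n. a \<le> norm (x n)"
  shows "contains_copy_of_c0 TYPE('a)"
proof -
  obtain K where "0 \<le> K"
    and K: "\<And>f :: 'a \<Rightarrow>\<^sub>L real. \<And>F. finite F \<Longrightarrow> norm f \<le> 1 \<Longrightarrow> (\<Sum>n\<in>F. \<bar>blinfun_apply f (x n)\<bar>) \<le> K"
    using weakly_unconditionally_Cauchy_bound[OF wuc] by blast
  have "\<exists>f :: 'a \<Rightarrow>\<^sub>L real. norm f \<le> 1 \<and> blinfun_apply f (x n) = norm (x n)" for n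
    using norming_functional by metis
  then obtain f :: "nat \<Rightarrow> 'a \<Rightarrow>\<^sub>L real" where f: "\<And>n. norm (f n) \<le> 1" "\<And>n. f n (x n) = norm (x n)"
    by metis
  \<comment> \<open>With portions of size \<open>a/2\<close>, the off-diagonal mass left by
    Rosenthal's lemma is at most half of the diagonal values
    \<open>f n (x n) \<ge> a\<close>.\<close>
  obtain k :: nat where k: "K < real k * (a/2)"
    using reals_Archimedean3[of "a/2"] \<open>0 < a\<close> by auto
  obtain S where S: "infinite S"
    and off: "\<And>n F. n \<in> S \<Longrightarrow> finite F \<Longrightarrow> F \<subseteq> S - {n} \<Longrightarrow> (\<Sum>m\<in>F. \<bar>f n (x m)\<bar>) \<le> a/2"
  proof -
    have "(\<Sum>m\<in>F. \<bar>f n (x m)\<bar>) \<le> real k * (a/2)" if "finite F" for n F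
      using K[OF that f(1)] k by (meson less_imp_le order_trans)
    then show ?thesis
      using that Rosenthal_lemma[of UNIV "a/2" "\<lambda>n m. \<bar>f n (x m)\<bar>" k] \<open>0 < a\<close> by auto
  qed
  define \<sigma> where "\<sigma> = enumerate S"
  have \<sigma>_inj: "inj \<sigma>" and \<sigma>_S: "\<sigma> n \<in> S" for n
    using bij_enumerate[OF S] enumerate_in_set[OF S] by (auto simp: \<sigma>_def bij_betw_def)
  define y where "y n = x (\<sigma> n)" for n
  define g where "g n = f (\<sigma> n)" for n
  have g: "norm (g n) \<le> 1" "a \<le> g n (y n)" for n
    using f large by (auto simp: g_def y_def)
  have off_g: "(\<Sum>m\<in>F. \<bar>g n (y m)\<bar>) \<le> a/2" if "finite F" "n \<notin> F" for n F
  proof -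
    have "(\<Sum>m\<in>F. \<bar>g n (y m)\<bar>) = (\<Sum>m\<in>\<sigma> ` F. \<bar>g n (x m)\<bar>)"
      using \<sigma>_inj by (simp add: sum.reindex inj_on_subset y_def)
    also have "\<dots> \<le> a/2"
      unfolding g_def using that \<sigma>_S \<sigma>_inj by (intro off) (auto simp: inj_eq)
    finally show ?thesis .
  qed
  have upper: "norm (\<Sum>n\<in>F. c n *\<^sub>R y n) \<le> M * K"
    if F: "finite F" and M: "\<And>n. n \<in> F \<Longrightarrow> \<bar>c n\<bar> \<le> M" "0 \<le> M" for F c M
  proof -
    obtain h :: "'a \<Rightarrow>\<^sub>L real" where h: "norm h \<le> 1" "h (\<Sum>n\<in>F. c n *\<^sub>R y n) = norm (\<Sum>n\<in>F. c n *\<^sub>R y n)"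
      using norming_functional by blast
    have "norm (\<Sum>n\<in>F. c n *\<^sub>R y n) = (\<Sum>n\<in>F. c n * h (y n))"
      unfolding h(2)[symmetric] by (simp add: blinfun.sum_right blinfun.scaleR_right)
    also have "\<dots> \<le> (\<Sum>n\<in>F. M * \<bar>h (y n)\<bar>)"
    proof (rule sum_mono)
      fix n assume "n \<in> F"
      have "c n * h (y n) \<le> \<bar>c n\<bar> * \<bar>h (y n)\<bar>"
        by (simp add: abs_mult[symmetric])
      also have "\<dots> \<le> M * \<bar>h (y n)\<bar>"
        using M(1)[OF \<open>n \<in> F\<close>] by (intro mult_right_mono) auto
      finally show "c n * h (y n) \<le> M * \<bar>h (y n)\<bar>" .
    qed
    also have "\<dots> = M * (\<Sum>n\<in>\<sigma> ` F. \<bar>h (x n)\<bar>)"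
      using \<sigma>_inj by (simp add: sum.reindex inj_on_subset y_def sum_distrib_left)
    also have "\<dots> \<le> M * K"
      using F h(1) M(2) by (intro mult_left_mono K) auto
    finally show ?thesis .
  qed
  define T :: "(nat \<Rightarrow>\<^sub>C real) \<Rightarrow> 'a" where "T c = (\<Sum>n. c n *\<^sub>R y n)" for c
  have summ: "summable (\<lambda>n. c n *\<^sub>R y n)" if "c \<in> c0" for c
    unfolding summable_Cauchy
  proof (intro allI impI)
    fix e :: real assume "0 < e"
    \<comment> \<open>A tail of coefficients below \<open>M\<close> contributes at most
      \<open>M * K\<close>; the summand 1 covers \<open>K = 0\<close>.\<close>
    define M where "M = e / (2 * (K + 1))"
    have "0 < M"
      using \<open>0 < e\<close> \<open>0 \<le> K\<close> by (simp add: M_def)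
    moreover have "apply_bcontfun c \<longlonglongrightarrow> 0"
      using that by (simp add: c0_def)
    ultimately obtain N where N: "\<And>n. n \<ge> N \<Longrightarrow> \<bar>c n\<bar> < M"
      by (auto simp: LIMSEQ_iff)
    have "norm (\<Sum>k\<in>{m..<n}. c k *\<^sub>R y k) < e" if "m \<ge> N" for m n
    proof -
      have "norm (\<Sum>k\<in>{m..<n}. c k *\<^sub>R y k) \<le> M * K"
        using that N \<open>0 < M\<close> by (intro upper) (auto intro: less_imp_le)
      also have "\<dots> < e"
        using \<open>0 < e\<close> \<open>0 \<le> K\<close> by (simp add: M_def field_simps add_strict_increasing)
      finally show ?thesis .
    qed
    then show "\<exists>N. \<forall>m\<ge>N. \<forall>n. norm (\<Sum>k\<in>{m..<n}. c k *\<^sub>R y k) < e"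
      by blast
  qed
  have lim: "(\<lambda>n. norm (\<Sum>k<n. c k *\<^sub>R y k)) \<longlonglongrightarrow> norm (T c)" if "c \<in> c0" for c
    unfolding T_def using summable_LIMSEQ[OF summ[OF that]] by (rule tendsto_norm)
  have cn: "\<bar>c n\<bar> \<le> norm c" for c :: "nat \<Rightarrow>\<^sub>C real" and n
    using norm_bounded[of c n] by simp
  have T_upper: "norm (T c) \<le> K * norm c" if "c \<in> c0" for c
  proof (rule LIMSEQ_le_const2[OF lim[OF that]])
    show "\<exists>N. \<forall>n\<ge>N. norm (\<Sum>k<n. c k *\<^sub>R y k) \<le> K * norm c"
      using upper[of "{..<_}" c "norm c"] cn by (simp add: mult.commute)
  qed
  have T_lower: "a/4 * norm c \<le> norm (T c)" if "c \<in> c0" for c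
  proof (cases "norm c = 0")
    case False
    then have "0 < norm c"
      by simp
    \<comment> \<open>Any fraction above 1/2 would do: the functional \<open>g N\<close> yields
      \<open>3/4 * a\<close> from the diagonal and loses at most \<open>a/2\<close> off it, which
      leaves the constant \<open>a/4\<close>.\<close>
    have "\<exists>N. 3/4 * norm c \<le> \<bar>c N\<bar>"
    proof (rule ccontr)
      assume "\<not> ?thesis"
      then have "norm (c n) \<le> 3/4 * norm c" for n
        by (metis less_eq_real_def not_le real_norm_def)
      then have "norm c \<le> 3/4 * norm c"
        by (rule norm_bound)
      with \<open>0 < norm c\<close> show False
        by linarith
    qed
    then obtain N where N: "3/4 * norm c \<le> \<bar>c N\<bar>"
      by blast
    have "a/4 * norm c \<le> norm (\<Sum>k<n. c k *\<^sub>R y k)" if "n \<ge> Suc N" for n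
    proof -
      have "g N (\<Sum>k<n. c k *\<^sub>R y k) = (\<Sum>k<n. c k * g N (y k))"
        by (simp add: blinfun.sum_right blinfun.scaleR_right)
      also have "\<dots> = c N * g N (y N) + (\<Sum>k\<in>{..<n} - {N}. c k * g N (y k))"
        using that by (intro sum.remove) auto
      finally have "\<bar>c N * g N (y N)\<bar> \<le> \<bar>g N (\<Sum>k<n. c k *\<^sub>R y k)\<bar> + \<bar>\<Sum>k\<in>{..<n} - {N}. c k * g N (y k)\<bar>"
        by linarith
      moreover have "\<bar>g N (\<Sum>k<n. c k *\<^sub>R y k)\<bar> \<le> norm (\<Sum>k<n. c k *\<^sub>R y k)"
        using norm_blinfun[of "g N" "\<Sum>k<n. c k *\<^sub>R y k"] mult_right_mono[OF g(1)[of N], of "norm (\<Sum>k<n. c k *\<^sub>R y k)"]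
        by simp
      moreover have "\<bar>\<Sum>k\<in>{..<n} - {N}. c k * g N (y k)\<bar> \<le> norm c * (a/2)"
      proof -
        have "\<bar>\<Sum>k\<in>{..<n} - {N}. c k * g N (y k)\<bar> \<le> (\<Sum>k\<in>{..<n} - {N}. \<bar>c k\<bar> * \<bar>g N (y k)\<bar>)"
          using sum_abs[of "\<lambda>k. c k * g N (y k)"] by (simp add: abs_mult)
        also have "\<dots> \<le> (\<Sum>k\<in>{..<n} - {N}. norm c * \<bar>g N (y k)\<bar>)"
          using cn by (intro sum_mono mult_right_mono) auto
        also have "\<dots> = norm c * (\<Sum>k\<in>{..<n} - {N}. \<bar>g N (y k)\<bar>)"
          by (simp add: sum_distrib_left)
        also have "\<dots> \<le> norm c * (a/2)"
          by (intro mult_left_mono off_g) auto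
        finally show ?thesis .
      qed
      moreover have "(3/4 * norm c) * a \<le> \<bar>c N * g N (y N)\<bar>"
        unfolding abs_mult using N g(2)[of N] \<open>0 < a\<close> by (intro mult_mono) auto
      ultimately show ?thesis
        by (simp add: algebra_simps)
    qed
    then show ?thesis
      by (intro LIMSEQ_le_const[OF lim[OF that]]) blast
  qed simp
  show ?thesis
    unfolding contains_copy_of_c0_def
  proof (intro exI conjI ballI allI)
    show "0 < a/4"
      using \<open>0 < a\<close> by simp
    fix c d assume c: "c \<in> c0"
    show "a/4 * norm c \<le> norm (T c)" "norm (T c) \<le> K * norm c"
      using T_lower[OF c] T_upper[OF c] by auto
    show "T (r *\<^sub>R c) = r *\<^sub>R T c" for r
      unfolding T_def using suminf_scaleR_right[OF summ[OF c], of r] by simp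
    assume "d \<in> c0"
    then show "T (c + d) = T c + T d"
      unfolding T_def using suminf_add[OF summ[OF c] summ[of d]]
      by (simp add: plus_bcontfun.rep_eq scaleR_add_left)
  qed
qed

section \<open>Support functions and the Hausdorff distance\<close>

lemma blinfun_le_norm:
  fixes f :: "'a::real_normed_vector \<Rightarrow>\<^sub>L real"
  assumes "norm f \<le> 1"
  shows "f x \<le> norm x"
  using norm_blinfun[of f x] mult_right_mono[OF assms, of "norm x"] by simp

lemma support_upper:
  assumes "bounded C" "x \<in> C"
  shows "blinfun_apply x' x \<le> support x' C"
  unfolding support_def
proof (rule cSUP_upper[OF assms(2)])
  have "bounded (blinfun_apply x' ` C)"
    using assms(1) by (rule bounded_linear_image) (rule blinfun.bounded_linear_right)
  then show "bdd_above (blinfun_apply x' ` C)"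
    by (rule bounded_imp_bdd_above)
qed

lemma support_least:
  assumes "C \<noteq> {}" "\<And>x. x \<in> C \<Longrightarrow> blinfun_apply x' x \<le> m"
  shows "support x' C \<le> m"
  unfolding support_def using assms by (rule cSUP_least)

lemma support_approx:
  assumes "C \<noteq> {}" "m < support x' C"
  obtains x where "x \<in> C" "m < blinfun_apply x' x"
  using support_least[OF assms(1), of x' m] assms(2) by force

lemma abs_support_le:
  assumes "C \<noteq> {}" "\<And>x. x \<in> C \<Longrightarrow> norm x \<le> R"
  shows "\<bar>support x' C\<bar> \<le> norm x' * R"
proof -
  have le: "\<bar>blinfun_apply x' x\<bar> \<le> norm x' * R" if "x \<in> C" for x
    using norm_blinfun[of x' x] mult_left_mono[OF assms(2)[OF that], of "norm x'"] by simp
  obtain x where x: "x \<in> C"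
    using assms(1) by blast
  have "bounded C"
    using assms(2) by (auto simp: bounded_iff)
  then have "- (norm x' * R) \<le> support x' C"
    using le[OF x] support_upper[of C x x'] x by linarith
  moreover have "support x' C \<le> norm x' * R"
    using le by (intro support_least[OF assms(1)]) (auto dest: abs_le_D1)
  ultimately show ?thesis
    by linarith
qed

lemma bounded_abs_support:
  assumes "C \<noteq> {}" "bounded C"
  obtains R where "\<And>x'. norm x' \<le> 1 \<Longrightarrow> \<bar>support x' C\<bar> \<le> R"
proof -
  obtain R where R: "0 < R" "\<And>x. x \<in> C \<Longrightarrow> norm x \<le> R"
    using assms(2) by (meson bounded_pos)
  have "\<bar>support x' C\<bar> \<le> R" if "norm x' \<le> 1" for x'
    using abs_support_le[OF assms(1) R(2), of x'] mult_right_mono[OF that, of R] R(1) by linarith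
  then show ?thesis
    by (rule that)
qed

lemma support_scaleR_left:
  assumes "C \<noteq> {}" "bounded C" "0 \<le> c"
  shows "support (c *\<^sub>R x') C = c * support x' C"
proof (rule antisym)
  show "support (c *\<^sub>R x') C \<le> c * support x' C"
    using assms by (intro support_least) (auto simp: blinfun.scaleR_left intro!: mult_left_mono support_upper)
  show "c * support x' C \<le> support (c *\<^sub>R x') C"
  proof (cases "c = 0")
    case True
    then have "support (c *\<^sub>R x') C = 0"
      using abs_support_le[OF assms(1), of _ "c *\<^sub>R x'"] assms(2) by (auto simp: bounded_iff)
    then show ?thesis
      using True by simp
  next
    case False
    then have "support x' C \<le> support (c *\<^sub>R x') C / c"
      using assms support_upper[OF assms(2), of _ "c *\<^sub>R x'"]
      by (intro support_least) (auto simp: blinfun.scaleR_left field_simps)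
    then show ?thesis
      using False assms(3) by (simp add: field_simps)
  qed
qed

lemma support_scaleR_image:
  assumes "C \<noteq> {}" "bounded C" "0 \<le> c"
  shows "support x' ((\<lambda>x. c *\<^sub>R x) ` C) = c * support x' C"
proof -
  have "support x' ((\<lambda>x. c *\<^sub>R x) ` C) = support (c *\<^sub>R x') C"
    by (simp add: support_def image_image blinfun.scaleR_right blinfun.scaleR_left)
  then show ?thesis
    using support_scaleR_left[OF assms] by simp
qed

lemma bounded_set_plus:
  fixes A B :: "'a::real_normed_vector set"
  assumes "bounded A" "bounded B"
  shows "bounded (A + B)"
proof -
  obtain a b where "\<And>x. x \<in> A \<Longrightarrow> norm x \<le> a" "\<And>x. x \<in> B \<Longrightarrow> norm x \<le> b"
    using assms by (auto simp: bounded_iff)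
  then show ?thesis
    by (auto simp: bounded_iff set_plus_def intro!: exI[of _ "a + b"] norm_triangle_mono)
qed

lemma support_set_plus:
  assumes "A \<noteq> {}" "bounded A" "B \<noteq> {}" "bounded B"
  shows "support x' (A + B) = support x' A + support x' B"
proof (rule antisym)
  have ne: "A + B \<noteq> {}"
    using assms by (auto simp: set_plus_def)
  then show "support x' (A + B) \<le> support x' A + support x' B"
    using assms by (intro support_least)
      (auto simp: set_plus_def blinfun.add_right intro!: add_mono support_upper)
  have ab: "blinfun_apply x' a + blinfun_apply x' b \<le> support x' (A + B)" if "a \<in> A" "b \<in> B" for a b
    using support_upper[OF bounded_set_plus[OF assms(2,4)], of "a + b" x'] that
    by (simp add: blinfun.add_right set_plus_intro)
  have "blinfun_apply x' a \<le> support x' (A + B) - support x' B" if "a \<in> A" for a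
    using support_least[OF assms(3), of x' "support x' (A + B) - blinfun_apply x' a"] ab[OF that] by force
  then have "support x' A \<le> support x' (A + B) - support x' B"
    by (rule support_least[OF assms(1)])
  then show "support x' A + support x' B \<le> support x' (A + B)"
    by simp
qed

text \<open>A Minkowski sum of closed sets may fail to be closed, so membership in \<open>cb\<close>
  is replaced by the three properties that the Hausdorff estimates use.\<close>

lemma support_weighted_sum:
  fixes C :: "'i \<Rightarrow> 'a::real_normed_vector set"
  assumes "\<And>i. i \<in> I \<Longrightarrow> C i \<in> cb" "\<And>i. i \<in> I \<Longrightarrow> 0 \<le> w i"
  defines "S \<equiv> \<Sum>i\<in>I. (\<lambda>x. w i *\<^sub>R x) ` C i"
  shows "S \<noteq> {}" "bounded S" "convex S" "\<And>x'. support x' S = (\<Sum>i\<in>I. w i * support x' (C i))"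
proof -
  have "S \<noteq> {} \<and> bounded S \<and> convex S \<and> (\<forall>x'. support x' S = (\<Sum>i\<in>I. w i * support x' (C i)))"
    unfolding S_def using assms(1,2)
  proof (induction I rule: infinite_finite_induct)
    case (insert i I)
    then have i: "C i \<noteq> {}" "bounded (C i)" "convex (C i)" "0 \<le> w i"
      by (auto simp: cb_def)
    define D where "D = (\<lambda>x. w i *\<^sub>R x) ` C i"
    have D: "D \<noteq> {}" "bounded D" "convex D" "\<And>x'. support x' D = w i * support x' (C i)"
      unfolding D_def using i support_scaleR_image[OF i(1,2,4)]
      by (auto intro: bounded_scaling convex_scaling)
    define E where "E = (\<Sum>i\<in>I. (\<lambda>x. w i *\<^sub>R x) ` C i)"
    have E: "E \<noteq> {}" "bounded E" "convex E" "\<And>x'. support x' E = (\<Sum>i\<in>I. w i * support x' (C i))"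
      using insert.IH insert.prems unfolding E_def by auto
    have "D + E \<noteq> {}"
      using D(1) E(1) by (auto simp: set_plus_def)
    moreover have "(\<Sum>i\<in>insert i I. (\<lambda>x. w i *\<^sub>R x) ` C i) = D + E"
      using insert by (simp add: D_def E_def)
    ultimately show ?case
      using insert.hyps D E by (auto simp: bounded_set_plus convex_set_plus support_set_plus)
  qed (auto simp: support_def blinfun.zero_right)
  then show "S \<noteq> {}" "bounded S" "convex S" "\<And>x'. support x' S = (\<Sum>i\<in>I. w i * support x' (C i))"
    by auto
qed

text \<open>For the functional \<open>f\<close> separating \<open>x\<close> from \<open>B\<close>,
  the chain \<open>support f B + infdist x B \<le> f x \<le> support f A\<close> bounds the distance
  by a difference of support functions.\<close>

lemma infdist_le_support_diff:
  fixes B :: "'a::real_normed_vector set"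
  assumes "B \<noteq> {}" "convex B" "bounded A" "x \<in> A"
    and le: "\<And>x'. norm x' \<le> 1 \<Longrightarrow> support x' A \<le> support x' B + e"
  shows "infdist x B \<le> e"
proof -
  obtain f :: "'a \<Rightarrow>\<^sub>L real" where f: "norm f \<le> 1" "\<And>c. c \<in> B \<Longrightarrow> f c + infdist x B \<le> f x"
    using Hahn_Banach_infdist[OF assms(2,1)] by blast
  have "support f B \<le> f x - infdist x B"
    using f(2) by (intro support_least[OF assms(1)]) force
  moreover have "f x \<le> support f A"
    using assms by (intro support_upper)
  ultimately show ?thesis
    using le[OF f(1)] by linarith
qed

lemma hausdorff_dist_le:
  fixes A B :: "'a::real_normed_vector set"
  assumes "A \<noteq> {}" "convex A" "bounded A" "B \<noteq> {}" "convex B" "bounded B"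
    and "\<And>x'. norm x' \<le> 1 \<Longrightarrow> \<bar>support x' A - support x' B\<bar> \<le> e"
  shows "hausdorff_dist A B \<le> e"
proof -
  have "support x' A \<le> support x' B + e" "support x' B \<le> support x' A + e" if "norm x' \<le> 1" for x'
    using assms(7)[OF that] by linarith+
  then show ?thesis
    unfolding hausdorff_dist_def using assms
    by (intro max.boundedI cSUP_least infdist_le_support_diff[where A=A and B=B]
        infdist_le_support_diff[where A=B and B=A]) auto
qed

lemma bdd_above_infdist:
  assumes "bounded A" "B \<noteq> {}"
  shows "bdd_above ((\<lambda>x. infdist x B) ` A)"
proof -
  obtain b where b: "b \<in> B"
    using assms(2) by blast
  obtain e where "\<And>x. x \<in> A \<Longrightarrow> dist b x \<le> e"
    using assms(1) bounded_any_center[of A b] by auto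
  then show ?thesis
    using b by (intro bdd_aboveI2[where M=e]) (auto intro: infdist_le2 simp: dist_commute)
qed

lemma support_le_SUP_infdist:
  fixes A B :: "'a::real_normed_vector set"
  assumes "A \<noteq> {}" "bounded A" "B \<noteq> {}" "bounded B" "norm x' \<le> 1"
  shows "support x' A \<le> support x' B + (SUP x\<in>A. infdist x B)"
proof (rule support_least[OF assms(1)])
  fix x assume "x \<in> A"
  have "blinfun_apply x' x - support x' B \<le> dist x y" if "y \<in> B" for y
    using support_upper[OF assms(4) that, of x'] blinfun_le_norm[OF assms(5), of "x - y"]
    by (simp add: blinfun.diff_right dist_norm)
  then have "blinfun_apply x' x - support x' B \<le> infdist x B"
    using assms(3) by (simp add: infdist_notempty cINF_greatest)
  also have "\<dots> \<le> (SUP x\<in>A. infdist x B)"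
    using bdd_above_infdist[OF assms(2,3)] \<open>x \<in> A\<close> by (intro cSUP_upper) auto
  finally show "blinfun_apply x' x \<le> support x' B + (SUP x\<in>A. infdist x B)"
    by simp
qed

lemma support_diff_le_hausdorff_dist:
  fixes A B :: "'a::real_normed_vector set"
  assumes "A \<noteq> {}" "bounded A" "B \<noteq> {}" "bounded B" "norm x' \<le> 1"
  shows "\<bar>support x' A - support x' B\<bar> \<le> hausdorff_dist A B"
  using support_le_SUP_infdist[OF assms] support_le_SUP_infdist[OF assms(3,4,1,2,5)]
  unfolding hausdorff_dist_def by linarith

text \<open>Completeness of the space of closed convex bounded sets, expressed by support functions.
  The only candidate is the intersection of the half-spaces prescribed by \<open>g\<close>, which is
  closed and convex; the point is that it is large enough. Each point of \<open>C N\<close> starts a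
  Cauchy sequence through the later sets, whose limit lies in all half-spaces.\<close>

lemma support_limit_in_cb:
  fixes C :: "nat \<Rightarrow> 'a::banach set"
  assumes C: "\<And>n. C n \<noteq> {}" "\<And>n. bounded (C n)" "\<And>n. convex (C n)"
    and conv: "\<And>n x'. norm x' \<le> 1 \<Longrightarrow> \<bar>support x' (C n) - g x'\<bar> \<le> (1/2) ^ n"
  obtains M where "M \<in> cb" "\<And>x'. norm x' \<le> 1 \<Longrightarrow> support x' M = g x'"
proof -
  define M where "M = {x. \<forall>x'. norm x' \<le> 1 \<longrightarrow> blinfun_apply x' x \<le> g x'}"
  have M_eq: "M = (\<Inter>x'\<in>{x'. norm x' \<le> 1}. blinfun_apply x' -` {..g x'})"
    by (auto simp: M_def)
  have "closed M"
    unfolding M_eq by (intro closed_INT ballI closed_vimage) (auto intro: linear_continuous_on blinfun.bounded_linear_right)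
  have "convex M"
    unfolding M_eq by (intro convex_INT convex_linear_vimage) (auto intro: bounded_linear.linear[OF blinfun.bounded_linear_right])
  have near: "\<exists>z\<in>M. dist x z \<le> 6 * (1/2) ^ N" if "x \<in> C N" for N x
  proof -
    \<comment> \<open>Consecutive support functions differ by at most twice
      \<open>(1/2) ^ (N + k)\<close>. The factor 3 gives room for an infimum that is not attained,
      and the geometric series doubles it to the 6 in the claim.\<close>
    have "\<exists>w. \<forall>k. (w k \<in> C (N + k) \<and> (k = 0 \<longrightarrow> w k = x)) \<and> dist (w k) (w (Suc k)) \<le> 3 * (1/2) ^ (N + k)"
    proof (rule dependent_nat_choice)
      fix y k assume y: "y \<in> C (N + k) \<and> (k = 0 \<longrightarrow> y = x)"
      have "support x' (C (N + k)) \<le> support x' (C (N + Suc k)) + 2 * (1/2) ^ (N + k)" if "norm x' \<le> 1" for x'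
      proof -
        define v where "v = (1/2 :: real) ^ (N + k)"
        have "\<bar>support x' (C (N + k)) - g x'\<bar> \<le> v" "\<bar>support x' (C (N + Suc k)) - g x'\<bar> \<le> v / 2"
          using conv[OF that, of "N + k"] conv[OF that, of "N + Suc k"] by (simp_all add: v_def)
        then show ?thesis
          unfolding v_def[symmetric] by linarith
      qed
      then have "infdist y (C (N + Suc k)) \<le> 2 * (1/2) ^ (N + k)"
        using y C by (intro infdist_le_support_diff[of _ "C (N + k)"]) auto
      also have "\<dots> < 3 * (1/2) ^ (N + k)"
        by simp
      finally have "\<exists>z\<in>C (N + Suc k). dist y z < 3 * (1/2) ^ (N + k)"
        using C(1)[of "N + Suc k"] by (simp add: infdist_notempty cINF_less_iff)
      then show "\<exists>z. (z \<in> C (N + Suc k) \<and> (Suc k = 0 \<longrightarrow> z = x)) \<and> dist y z \<le> 3 * (1/2) ^ (N + k)"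
        by (auto intro: less_imp_le)
    qed (use that in auto)
    then obtain w where wC: "\<And>k. w k \<in> C (N + k)" and w0: "w 0 = x"
      and w: "\<And>k. dist (w k) (w (Suc k)) \<le> 3 * (1/2) ^ (N + k)"
      by blast
    have "norm (w (Suc k) - w k) \<le> (3 * (1/2) ^ N) * (1/2) ^ k" for k
      using w[of k] by (simp add: dist_norm norm_minus_commute power_add)
    then obtain z where z: "w \<longlonglongrightarrow> z" and dz: "\<And>k. norm (z - w k) \<le> (3 * (1/2) ^ N) * (1/2) ^ k / (1 - 1/2)"
      using geometric_convergence[of "1/2" w "3 * (1/2) ^ N"] by auto
    have "blinfun_apply x' z \<le> g x'" if "norm x' \<le> 1" for x'
    proof (rule LIMSEQ_le)
      show "(\<lambda>k. blinfun_apply x' (w k)) \<longlonglongrightarrow> blinfun_apply x' z"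
        using z by (intro tendsto_intros)
      have "(\<lambda>k. (1/2 :: real) ^ (k + N)) \<longlonglongrightarrow> 0"
        by (intro LIMSEQ_ignore_initial_segment LIMSEQ_power_zero) simp
      then show "(\<lambda>k. g x' + (1/2) ^ (N + k)) \<longlonglongrightarrow> g x'"
        using tendsto_add[OF tendsto_const[of "g x'"]] by (fastforce simp: add.commute)
      have "blinfun_apply x' (w k) \<le> g x' + (1/2) ^ (N + k)" for k
        using support_upper[OF C(2) wC[of k], of x'] conv[OF that, of "N + k"] by linarith
      then show "\<exists>N'. \<forall>k\<ge>N'. blinfun_apply x' (w k) \<le> g x' + (1/2) ^ (N + k)"
        by blast
    qed
    moreover have "dist x z \<le> 6 * (1/2) ^ N"
      using dz[of 0] w0 by (simp add: dist_norm norm_minus_commute)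
    ultimately show ?thesis
      by (auto simp: M_def)
  qed
  then have "M \<noteq> {}"
    using C(1) by fast
  have "bounded M"
  proof -
    obtain R where R: "\<And>x'. norm x' \<le> 1 \<Longrightarrow> \<bar>support x' (C 0)\<bar> \<le> R"
      using bounded_abs_support[OF C(1,2)] by blast
    have "norm x \<le> R + 1" if "x \<in> M" for x
    proof -
      obtain f :: "'a \<Rightarrow>\<^sub>L real" where f: "norm f \<le> 1" "f x = norm x"
        using norming_functional by blast
      then have "norm x \<le> g f"
        using that by (metis (mono_tags, lifting) M_def mem_Collect_eq)
      then show ?thesis
        using R[OF f(1)] conv[OF f(1), of 0] by simp
    qed
    then show ?thesis
      by (auto simp: bounded_iff)
  qed
  have "support x' M = g x'" if x': "norm x' \<le> 1" for x'
  proof (rule antisym)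
    show "support x' M \<le> g x'"
      using x' by (intro support_least[OF \<open>M \<noteq> {}\<close>]) (auto simp: M_def)
    \<comment> \<open>Six parts come from passing from \<open>C N\<close> to \<open>M\<close>, one
      from passing from \<open>g\<close> to \<open>C N\<close>.\<close>
    have "g x' \<le> support x' M + 7 * (1/2) ^ N" for N
    proof -
      have "support x' (C N) \<le> support x' M + 6 * (1/2) ^ N"
      proof (rule support_least[OF C(1)])
        fix x assume "x \<in> C N"
        then obtain z where z: "z \<in> M" "dist x z \<le> 6 * (1/2) ^ N"
          using near by blast
        then show "blinfun_apply x' x \<le> support x' M + 6 * (1/2) ^ N"
          using support_upper[OF \<open>bounded M\<close> z(1), of x'] blinfun_le_norm[OF x', of "x - z"]
          by (simp add: blinfun.diff_right dist_norm)
      qed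
      moreover define v where "v = (1/2 :: real) ^ N"
      moreover have "\<bar>support x' (C N) - g x'\<bar> \<le> v"
        using conv[OF x', of N] by (simp add: v_def)
      ultimately show ?thesis
        by linarith
    qed
    moreover have "(\<lambda>N. support x' M + 7 * (1/2) ^ N) \<longlonglongrightarrow> support x' M + 7 * 0"
      by (intro tendsto_intros LIMSEQ_power_zero) simp
    ultimately show "g x' \<le> support x' M"
      using LIMSEQ_le_const[of _ _ "g x'"] by force
  qed
  moreover have "M \<in> cb"
    using \<open>M \<noteq> {}\<close> \<open>closed M\<close> \<open>convex M\<close> \<open>bounded M\<close> by (simp add: cb_def)
  ultimately show ?thesis
    using that by blast
qed

section \<open>Absolute continuity of the Pettis integral\<close>

lemma set_integral_mono_set:
  fixes f :: "'b \<Rightarrow> real"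
  assumes f: "set_integrable M B f" and "\<And>x. x \<in> B \<Longrightarrow> 0 \<le> f x" "A \<in> sets M" "A \<subseteq> B"
  shows "(LINT x:A|M. f x) \<le> (LINT x:B|M. f x)"
  using set_integrable_subset[OF f assms(3,4)] assms
  unfolding set_integrable_def set_lebesgue_integral_def
  by (intro integral_mono) (auto split: split_indicator)

lemma set_integral_abs_le:
  fixes f :: "'b \<Rightarrow> real"
  assumes "set_integrable M A f"
  shows "\<bar>LINT x:A|M. f x\<bar> \<le> (LINT x:A|M. \<bar>f x\<bar>)"
  using set_integral_norm_bound[OF assms] by simp

text \<open>Truncation at a height \<open>n\<close>: by dominated convergence the excess above
  \<open>n\<close> has integral below \<open>e/2\<close>, and the rest contributes at most
  \<open>n\<close> times the measure of the set.\<close>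

lemma set_integral_absolutely_continuous:
  fixes f :: "'b \<Rightarrow> real"
  assumes f: "set_integrable M S f" and "0 < e"
  obtains \<eta> where "0 < \<eta>" "\<And>A. A \<in> fmeasurable M \<Longrightarrow> A \<subseteq> S \<Longrightarrow> measure M A < \<eta> \<Longrightarrow> (LINT x:A|M. \<bar>f x\<bar>) < e"
proof -
  define h where "h x = indicator S x *\<^sub>R \<bar>f x\<bar>" for x
  have h: "integrable M h"
    using set_integrable_abs[OF f] by (simp add: h_def[abs_def] set_integrable_def)
  then have [measurable]: "h \<in> borel_measurable M"
    by (rule borel_measurable_integrable)
  have h0: "0 \<le> h x" for x
    by (simp add: h_def)
  define g where "g n x = max 0 (h x - real n)" for n x
  have g: "integrable M (g n)" for n
    by (rule Bochner_Integration.integrable_bound[OF h]) (use h0 in \<open>auto simp: g_def[abs_def] max_def\<close>)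
  have "(\<lambda>n. \<integral>x. g n x \<partial>M) \<longlonglongrightarrow> (\<integral>x. 0 \<partial>M)"
  proof (rule integral_dominated_convergence[where w=h])
    show "AE x in M. (\<lambda>n. g n x) \<longlonglongrightarrow> 0"
    proof (intro AE_I2)
      fix x
      obtain N where "h x \<le> real N"
        using real_arch_simple by blast
      then have "g n x = 0" if "n \<ge> N" for n
        using that by (simp add: g_def max_def)
      then show "(\<lambda>n. g n x) \<longlonglongrightarrow> 0"
        by (intro tendsto_eventually eventually_sequentiallyI)
    qed
  qed (use h h0 in \<open>auto simp: g_def[abs_def] max_def\<close>)
  then have "\<forall>\<^sub>F n in sequentially. (\<integral>x. g n x \<partial>M) < e/2"
    using \<open>0 < e\<close> by (intro order_tendstoD) auto
  then obtain n where n: "(\<integral>x. g n x \<partial>M) < e/2"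
    using eventually_happens by fastforce
  show ?thesis
  proof
    show "0 < e / (2 * (real n + 1))"
      using \<open>0 < e\<close> by simp
    fix A assume A: "A \<in> fmeasurable M" "A \<subseteq> S" "measure M A < e / (2 * (real n + 1))"
    have indA: "integrable M (\<lambda>x. real n * indicator A x)"
      using A by (intro integrable_mult_right integrable_real_indicator) (auto simp: fmeasurable_def)
    have "(LINT x:A|M. \<bar>f x\<bar>) \<le> (\<integral>x. g n x + real n * indicator A x \<partial>M)"
      unfolding set_lebesgue_integral_def
    proof (rule integral_mono)
      show "integrable M (\<lambda>x. indicator A x *\<^sub>R \<bar>f x\<bar>)"
        using set_integrable_subset[OF set_integrable_abs[OF f], of A] A
        by (auto simp: set_integrable_def)
      show "integrable M (\<lambda>x. g n x + real n * indicator A x)"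
        using g indA by simp
      fix x
      show "indicator A x *\<^sub>R \<bar>f x\<bar> \<le> g n x + real n * indicator A x"
        using A(2) by (auto simp: g_def h_def split: split_indicator)
    qed
    also have "\<dots> = (\<integral>x. g n x \<partial>M) + real n * measure M A"
      using g indA A by simp
    also have "real n * measure M A \<le> e/2"
    proof -
      have "real n * measure M A \<le> (real n + 1) * measure M A"
        by (simp add: mult_right_mono)
      also have "\<dots> \<le> e/2"
        using A(3) by (simp add: field_simps)
      finally show ?thesis .
    qed
    finally show "(LINT x:A|M. \<bar>f x\<bar>) < e"
      using n by linarith
  qed
qed

lemma lmeasurable_subset_unit: "A \<in> sets lebesgue \<Longrightarrow> A \<subseteq> {0..1::real} \<Longrightarrow> A \<in> lmeasurable"
  using fmeasurableI2[of "{0..1}" lebesgue A] by (metis cbox_interval lmeasurable_cbox)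

lemma measure_countable_Union_geometric:
  assumes "\<And>k. A k \<in> fmeasurable M" "\<And>k. measure M (A k) \<le> c * (1/2) ^ k" "0 \<le> c"
  shows "measure M (\<Union>k. A k) \<le> 2 * c"
proof (rule measure_countable_Union_le[OF assms(1)])
  fix n
  have "measure M (\<Union>k\<le>n. A k) \<le> (\<Sum>k\<le>n. measure M (A k))"
    using assms(1) by (intro measure_UNION_le) (auto dest: fmeasurableD)
  also have "\<dots> \<le> (\<Sum>k\<le>n. c * (1/2) ^ k)"
    using assms(2) by (rule sum_mono)
  also have "\<dots> = c * (\<Sum>k\<le>n. (1/2) ^ k)"
    by (simp add: sum_distrib_left)
  also have "\<dots> \<le> c * 2"
    using \<open>0 \<le> c\<close> sum_gp_basic[of "1/2 :: real" n] by (intro mult_left_mono) auto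
  finally show "measure M (\<Union>k\<le>n. A k) \<le> 2 * c"
    by simp
qed

text \<open>
  Otherwise there are disjoint sets \<open>D n\<close> whose indefinite Pettis integrals contain points
  \<open>x n\<close> bounded away from \<open>0\<close>, and \<open>\<Sum>\<bar>f (x n)\<bar>\<close> is at most the integral of
  \<open>\<bar>s(f, \<Gamma>)\<bar> + \<bar>s(-f, \<Gamma>)\<bar>\<close>.
\<close>

theorem pettis_uniformly_absolutely_continuous:
  fixes \<Gamma> :: "real \<Rightarrow> 'a::banach set"
  assumes no_c0: "\<not> contains_copy_of_c0 TYPE('a)" and pettis: "pettis_integrable_cb \<Gamma>" and "0 < e"
  shows "\<exists>\<eta>>0. \<forall>x' A. norm x' \<le> 1 \<longrightarrow> A \<in> sets lebesgue \<longrightarrow> A \<subseteq> {0..1} \<longrightarrow> measure lebesgue A < \<eta> \<longrightarrow>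
    \<bar>LINT t:A|lebesgue. support x' (\<Gamma> t)\<bar> \<le> e"
proof (rule ccontr)
  let ?I = "\<lambda>A x'. LINT t:A|lebesgue. support x' (\<Gamma> t)"
  assume "\<not> ?thesis"
  then have bad: "\<exists>A x'. norm x' \<le> 1 \<and> A \<in> sets lebesgue \<and> A \<subseteq> {0..1} \<and> measure lebesgue A < \<eta> \<and> e < \<bar>?I A x'\<bar>"
    if "0 < \<eta>" for \<eta>
    using that by (meson not_le)
  have int: "set_integrable lebesgue A (\<lambda>t. support x' (\<Gamma> t))" if "A \<in> sets lebesgue" "A \<subseteq> {0..1}" for A x'
    using pettis that unfolding pettis_integrable_cb_def by (meson set_integrable_subset)
  have "\<exists>\<eta>>0. \<forall>A. A \<in> sets lebesgue \<longrightarrow> A \<subseteq> {0..1} \<longrightarrow> measure lebesgue A < \<eta> \<longrightarrow>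
      (LINT t:A|lebesgue. \<bar>support x' (\<Gamma> t)\<bar>) < e/2" for x'
    using set_integral_absolutely_continuous[OF int[of "{0..1}" x'], of "e/2"] \<open>0 < e\<close>
      lmeasurable_subset_unit by (metis half_gt_zero_iff lmeasurable_cbox cbox_interval fmeasurableD order_refl)
  then have "\<exists>ac. \<forall>x'. 0 < ac x' \<and> (\<forall>A. A \<in> sets lebesgue \<longrightarrow> A \<subseteq> {0..1} \<longrightarrow> measure lebesgue A < ac x' \<longrightarrow>
      (LINT t:A|lebesgue. \<bar>support x' (\<Gamma> t)\<bar>) < e/2)"
    by (intro choice allI)
  then obtain ac where ac0: "\<And>x'. 0 < ac x'"
    and ac: "\<And>x' A. A \<in> sets lebesgue \<Longrightarrow> A \<subseteq> {0..1} \<Longrightarrow> measure lebesgue A < ac x' \<Longrightarrow>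
      (LINT t:A|lebesgue. \<bar>support x' (\<Gamma> t)\<bar>) < e/2"
    by blast
  define P where "P = (\<lambda>(\<eta>, A, x'). 0 < \<eta> \<and> norm x' \<le> 1 \<and> A \<in> sets lebesgue \<and> A \<subseteq> {0..1} \<and>
    measure lebesgue A \<le> \<eta> \<and> e < \<bar>?I A x'\<bar>)"
  \<comment> \<open>\<open>ac x'\<close> is a modulus of absolute continuity of the single function
    \<open>support x' (\<Gamma> t)\<close>. As the budgets at least halve, all later sets together
    have measure at most twice the next budget, which \<open>Q\<close> keeps below the modulus of
    the current functional.\<close>
  define Q where "Q = (\<lambda>(\<eta> :: real, A :: real set, x') (\<zeta>, B :: real set, y' :: 'a \<Rightarrow>\<^sub>L real). \<zeta> \<le> \<eta> / 2 \<and> 2 * \<zeta> < ac x')"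
  have "\<exists>s. \<forall>n. P (s n) \<and> Q (s n) (s (Suc n))"
  proof (rule dependent_nat_choice)
    show "\<exists>s. P s"
    proof -
      obtain A x' where "norm x' \<le> 1" "A \<in> sets lebesgue" "A \<subseteq> {0..1}" "measure lebesgue A < 1" "e < \<bar>?I A x'\<bar>"
        using bad[of 1] by auto
      then have "P (1, A, x')"
        by (simp add: P_def)
      then show ?thesis
        by blast
    qed
    fix s n assume "P s"
    obtain \<eta> A x' where s: "s = (\<eta>, A, x')"
      by (cases s)
    define \<zeta> where "\<zeta> = min (\<eta> / 2) (ac x' / 3)"
    have "0 < \<zeta>"
      using \<open>P s\<close> ac0[of x'] by (simp add: \<zeta>_def P_def s)
    then obtain B y' where "norm y' \<le> 1" "B \<in> sets lebesgue" "B \<subseteq> {0..1}" "measure lebesgue B < \<zeta>" "e < \<bar>?I B y'\<bar>"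
      using bad by blast
    then have "P (\<zeta>, B, y') \<and> Q s (\<zeta>, B, y')"
      using \<open>0 < \<zeta>\<close> ac0[of x'] by (auto simp: P_def Q_def s \<zeta>_def min_def)
    then show "\<exists>s'. P s' \<and> Q s s'"
      by blast
  qed
  then obtain s where s: "\<And>n. P (s n)" "\<And>n. Q (s n) (s (Suc n))"
    by blast
  define \<eta> A f where "\<eta> n = fst (s n)" and "A n = fst (snd (s n))" and "f n = snd (snd (s n))" for n
  have s_eq: "s n = (\<eta> n, A n, f n)" for n
    by (simp add: \<eta>_def A_def f_def)
  have \<eta>0: "0 < \<eta> n" and f: "norm (f n) \<le> 1" and A: "A n \<in> sets lebesgue" "A n \<subseteq> {0..1}"
    and A\<eta>: "measure lebesgue (A n) \<le> \<eta> n" and big: "e < \<bar>?I (A n) (f n)\<bar>" for n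
    using s(1)[of n] by (auto simp: P_def s_eq)
  have \<eta>_half: "\<eta> (Suc n) \<le> \<eta> n / 2" and \<eta>_ac: "2 * \<eta> (Suc n) < ac (f n)" for n
    using s(2)[of n] by (auto simp: Q_def s_eq)
  have \<eta>_geo: "\<eta> (n + k) \<le> \<eta> n * (1/2) ^ k" for n k
  proof (induction k)
    case (Suc k)
    then show ?case
      using \<eta>_half[of "n + k"] by simp
  qed simp
  define U where "U n = (\<Union>k. A (Suc n + k))" for n
  have U: "U n \<in> sets lebesgue" "U n \<subseteq> {0..1}" for n
    using A by (auto simp: U_def)
  have mU: "measure lebesgue (U n) < ac (f n)" for n
  proof -
    have "measure lebesgue (U n) \<le> 2 * \<eta> (Suc n)"
      unfolding U_def using A A\<eta> \<eta>_geo \<eta>0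
      by (intro measure_countable_Union_geometric lmeasurable_subset_unit) (blast intro: order_trans less_imp_le)+
    then show ?thesis
      using \<eta>_ac[of n] by linarith
  qed
  \<comment> \<open>Removing all later sets makes the family disjoint and changes the integral of
    the functional \<open>f n\<close> by less than \<open>e/2\<close>.\<close>
  define D where "D n = A n - U n" for n
  have D: "D n \<in> sets lebesgue" "D n \<subseteq> {0..1}" for n
    using A U by (auto simp: D_def)
  have D_disj: "disjoint_family D"
    unfolding disjoint_family_on_def
  proof (intro ballI impI)
    have "D m \<inter> D n = {}" if "m < n" for m n
    proof -
      have "A n \<subseteq> U m"
        using that unfolding U_def by (metis SUP_upper UNIV_I add_Suc less_iff_Suc_add)
      then show ?thesis
        by (auto simp: D_def)
    qed
    then show "D m \<inter> D n = {}" if "m \<noteq> n" for m n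
      using that by (metis inf_commute linorder_neqE_nat)
  qed
  have D_big: "e/2 < \<bar>?I (D n) (f n)\<bar>" for n
  proof -
    have AU: "A n \<inter> U n \<in> sets lebesgue" "A n \<inter> U n \<subseteq> {0..1}"
      using A U by auto
    have "measure lebesgue (A n \<inter> U n) < ac (f n)"
      using mU[of n] measure_mono_fmeasurable[of "A n \<inter> U n" "U n" lebesgue] AU U lmeasurable_subset_unit
      by (metis inf_le2 le_less_trans)
    then have "\<bar>?I (A n \<inter> U n) (f n)\<bar> < e/2"
      using ac[OF AU] set_integral_abs_le[OF int[OF AU]] le_less_trans by blast
    moreover have "?I (D n \<union> (A n \<inter> U n)) (f n) = ?I (D n) (f n) + ?I (A n \<inter> U n) (f n)"
      using D AU by (intro set_integral_Un int) (auto simp: D_def)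
    moreover have "D n \<union> (A n \<inter> U n) = A n"
      by (auto simp: D_def)
    ultimately show ?thesis
      using big[of n] by simp
  qed
  have "\<exists>M\<in>cb. \<forall>x'. support x' M = ?I (D n) x'" for n
    using pettis D unfolding pettis_integrable_cb_def by blast
  then obtain M where M: "\<And>n. M n \<in> cb" and supp_M: "\<And>n x'. support x' (M n) = ?I (D n) x'"
    by metis
  have Mcb: "M n \<noteq> {}" "bounded (M n)" for n
    using M by (auto simp: cb_def)
  \<comment> \<open>A large positive support value is nearly attained by some point. A large
    negative one forces every point of \<open>M n\<close> to have a large norm, so any point will
    do.\<close>
  have "\<exists>x\<in>M n. e/2 \<le> norm x" for n
  proof (cases "e/2 < ?I (D n) (f n)")
    case True
    then have "e/2 < support (f n) (M n)"
      by (simp add: supp_M)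
    then obtain x where x: "x \<in> M n" "e/2 < f n x"
      using support_approx[OF Mcb(1)] by blast
    then show ?thesis
      using blinfun_le_norm[OF f, of n x] by force
  next
    case False
    then have neg: "support (f n) (M n) < - (e/2)"
      using D_big[of n] by (simp add: supp_M)
    obtain x where x: "x \<in> M n"
      using Mcb(1) by blast
    then have "e/2 < f n (- x)"
      using neg support_upper[OF Mcb(2) x, of "f n"] by (simp add: blinfun.minus_right)
    then show ?thesis
      using blinfun_le_norm[OF f, of n "- x"] x by force
  qed
  then obtain x where x: "\<And>n. x n \<in> M n" and large: "\<And>n. e/2 \<le> norm (x n)"
    by metis
  have "contains_copy_of_c0 TYPE('a)"
  proof (rule Bessaga_Pelczynski[OF _ _ large])
    show "0 < e/2"
      using \<open>0 < e\<close> by simp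
    fix h :: "'a \<Rightarrow>\<^sub>L real"
    define \<psi> where "\<psi> t = \<bar>support h (\<Gamma> t)\<bar> + \<bar>support (- h) (\<Gamma> t)\<bar>" for t
    have \<psi>: "set_integrable lebesgue A \<psi>" if "A \<in> sets lebesgue" "A \<subseteq> {0..1}" for A
      unfolding \<psi>_def using that by (intro set_integral_add set_integrable_abs int)
    have \<psi>0: "0 \<le> \<psi> t" for t
      by (simp add: \<psi>_def)
    have hx: "\<bar>h (x n)\<bar> \<le> (LINT t:D n|lebesgue. \<psi> t)" for n
    proof -
      have "h (x n) \<le> support h (M n)" "- h (x n) \<le> support (- h) (M n)"
        using support_upper[OF Mcb(2) x, of h n] support_upper[OF Mcb(2) x, of "- h" n]
        by (simp_all add: blinfun.minus_left)
      then have "\<bar>h (x n)\<bar> \<le> \<bar>?I (D n) h\<bar> + \<bar>?I (D n) (- h)\<bar>"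
        by (simp add: supp_M)
      also have "\<dots> \<le> (LINT t:D n|lebesgue. \<bar>support h (\<Gamma> t)\<bar>) + (LINT t:D n|lebesgue. \<bar>support (- h) (\<Gamma> t)\<bar>)"
        using D by (intro add_mono set_integral_abs_le int)
      also have "\<dots> = (LINT t:D n|lebesgue. \<psi> t)"
        unfolding \<psi>_def using D by (intro set_integral_add(2)[symmetric] set_integrable_abs int)
      finally show ?thesis .
    qed
    have "(\<Sum>n\<in>F. \<bar>h (x n)\<bar>) \<le> (LINT t:{0..1}|lebesgue. \<psi> t)" if "finite F" for F
    proof -
      have "(\<Sum>n\<in>F. \<bar>h (x n)\<bar>) \<le> (\<Sum>n\<in>F. LINT t:D n|lebesgue. \<psi> t)"
        using hx by (rule sum_mono)
      also have "\<dots> = (LINT t:(\<Union>n\<in>F. D n)|lebesgue. \<psi> t)"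
        using that D \<psi> D_disj by (intro set_integral_finite_Union[symmetric]) (auto simp: disjoint_family_on_def)
      also have "\<dots> \<le> (LINT t:{0..1}|lebesgue. \<psi> t)"
        using that D \<psi>[of "{0..1}"] \<psi>0 by (intro set_integral_mono_set) auto
      finally show ?thesis .
    qed
    then show "\<exists>K. \<forall>F. finite F \<longrightarrow> (\<Sum>n\<in>F. \<bar>h (x n)\<bar>) \<le> K"
      by blast
  qed
  with no_c0 show False ..
qed

section \<open>Partitions\<close>

text \<open>The covering condition is dropped so that the cells whose tags lie in a prescribed set
  can be estimated on their own.\<close>

definition partial_free_partition :: "(real \<times> real set) set \<Rightarrow> bool" where
  "partial_free_partition p \<longleftrightarrow>
     finite p \<and>
     (\<forall>t K. (t, K) \<in> p \<longrightarrow> t \<in> {0..1} \<and> K \<subseteq> {0..1} \<and> (\<exists>a b. a \<le> b \<and> K = {a..b})) \<and>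
     (\<forall>t1 K1 t2 K2. (t1, K1) \<in> p \<and> (t2, K2) \<in> p \<and> (t1, K1) \<noteq> (t2, K2) \<longrightarrow>
        interior K1 \<inter> interior K2 = {})"

abbreviation tag_fine :: "(real \<Rightarrow> real) \<Rightarrow> (real \<times> real set) set \<Rightarrow> bool" where
  "tag_fine \<delta> p \<equiv> (\<lambda>t. {t - \<delta> t<..<t + \<delta> t}) fine p"

lemma Union_cells: "\<Union>{K. \<exists>t. (t, K) \<in> p} = (\<Union>i\<in>p. snd i)"
proof -
  have "{K. \<exists>t. (t, K) \<in> p} = snd ` p"
    by (auto intro: rev_image_eqI)
  then show ?thesis
    by simp
qed

lemma free_partition_Union:
  assumes "free_partition p"
  shows "(\<Union>i\<in>p. snd i) = {0..1}"
  using assms unfolding free_partition_def Union_cells by simp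

lemma perron_imp_free: "perron_partition p \<Longrightarrow> free_partition p"
  by (simp add: perron_partition_def)

lemma free_imp_partial_free: "free_partition p \<Longrightarrow> partial_free_partition p"
  by (simp add: free_partition_def partial_free_partition_def)

lemma partial_free_subset: "partial_free_partition p \<Longrightarrow> q \<subseteq> p \<Longrightarrow> partial_free_partition q"
  unfolding partial_free_partition_def by (meson finite_subset subset_iff)

lemma partial_free_interval:
  assumes "partial_free_partition p" "i \<in> p"
  obtains a b where "a \<le> b" "snd i = {a..b}" "snd i \<subseteq> {0..1}"
  using assms unfolding partial_free_partition_def by (metis prod.collapse)

lemma partial_free_tag:
  assumes "partial_free_partition p" "i \<in> p"
  shows "fst i \<in> {0..1}"
  using assms unfolding partial_free_partition_def by (metis prod.collapse)

lemma partial_free_interior_disjoint: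
  assumes "partial_free_partition p" "i \<in> p" "j \<in> p" "i \<noteq> j"
  shows "interior (snd i) \<inter> interior (snd j) = {}"
  using assms unfolding partial_free_partition_def by (metis prod.collapse)

text \<open>A one-point cell may lie inside another cell, so a common point need not be an end point
  of both cells; it is always an end point of one of them.\<close>

lemma partial_free_Int_null:
  assumes p: "partial_free_partition p" and "i \<in> p" "j \<in> p" "i \<noteq> j"
  shows "finite (snd i \<inter> snd j)"
proof -
  obtain a b where i: "snd i = {a..b}"
    using p \<open>i \<in> p\<close> by (rule partial_free_interval)
  obtain c d where j: "snd j = {c..d}"
    using p \<open>j \<in> p\<close> by (rule partial_free_interval)
  have "interior (snd i) \<inter> interior (snd j) = {}"
    using assms by (rule partial_free_interior_disjoint)
  then have "snd i \<inter> snd j \<subseteq> {a, b, c, d}"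
    unfolding i j by (force simp: interior_atLeastAtMost_real)
  then show ?thesis
    by (rule finite_subset) simp
qed

lemma measure_partial_free_Union:
  assumes p: "partial_free_partition p"
    and S: "\<And>i. i \<in> p \<Longrightarrow> S i \<in> sets lebesgue" "\<And>i. i \<in> p \<Longrightarrow> S i \<subseteq> snd i"
  shows "measure lebesgue (\<Union>i\<in>p. S i) = (\<Sum>i\<in>p. measure lebesgue (S i))"
proof (rule measure_negligible_finite_Union_image)
  show "finite p"
    using p by (simp add: partial_free_partition_def)
  show "S i \<in> lmeasurable" if "i \<in> p" for i
    using S[OF that] partial_free_interval[OF p that] by (meson lmeasurable_subset_unit order_trans)
  show "pairwise (\<lambda>i j. negligible (S i \<inter> S j)) p"
  proof (rule pairwiseI)
    fix i j assume "i \<in> p" "j \<in> p" "i \<noteq> j"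
    then have "finite (S i \<inter> S j)"
      using partial_free_Int_null[OF p] S(2) by (meson Int_mono finite_subset)
    then show "negligible (S i \<inter> S j)"
      by (rule negligible_finite)
  qed
qed

lemma integral_partial_free_Union:
  fixes f :: "real \<Rightarrow> real"
  assumes p: "partial_free_partition p" and f: "set_integrable lebesgue {0..1} f"
    and S: "\<And>i. i \<in> p \<Longrightarrow> S i \<in> sets lebesgue" "\<And>i. i \<in> p \<Longrightarrow> S i \<subseteq> snd i"
  shows "(LINT x:(\<Union>i\<in>p. S i)|lebesgue. f x) = (\<Sum>i\<in>p. LINT x:S i|lebesgue. f x)"
proof (rule set_integral_finite_UN_AE)
  show "finite p"
    using p by (simp add: partial_free_partition_def)
  show "set_integrable lebesgue (S i) f" if "i \<in> p" for i
    using S[OF that] partial_free_interval[OF p that] set_integrable_subset[OF f] by (meson order_trans)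
  show "AE x in lebesgue. x \<in> S i \<and> x \<in> S j \<longrightarrow> i = j" if "i \<in> p" "j \<in> p" for i j
  proof (cases "i = j")
    case False
    then have "finite (S i \<inter> S j)"
      using partial_free_Int_null[OF p that] S(2) that by (meson Int_mono finite_subset)
    then have "S i \<inter> S j \<in> null_sets lebesgue"
      using negligible_finite negligible_iff_null_sets by blast
    then show ?thesis
      by (rule AE_I') auto
  qed simp
qed (use S in auto)

text \<open>\<open>gauges\<close> restricts \<delta> on [0,1] only, whereas \<open>gauge\<close>
  demands an open neighbourhood of every real number. The tags of a division of [0,1] never see the
  value \<open>UNIV\<close>.\<close>

definition tag_gauge :: "(real \<Rightarrow> real) \<Rightarrow> real \<Rightarrow> real set" where
  "tag_gauge \<delta> t = (if t \<in> {0..1} then {t - \<delta> t<..<t + \<delta> t} else UNIV)"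

lemma gauge_tag_gauge: "\<delta> \<in> gauges \<Longrightarrow> gauge (tag_gauge \<delta>)"
  by (auto simp: gauge_def tag_gauge_def gauges_def)

lemma tag_gauge_fine:
  assumes "p tagged_division_of {0..1}" "tag_gauge \<delta> fine p"
  shows "free_partition p" "perron_partition p" "tag_fine \<delta> p"
proof -
  show p: "perron_partition p"
    using assms(1) by (simp add: perron_partition_iff_tagged_division)
  then show "free_partition p"
    by (rule perron_imp_free)
  show "tag_fine \<delta> p"
  proof (rule fineI)
    fix t K assume tK: "(t, K) \<in> p"
    then have "t \<in> {0..1}"
      using tagged_division_ofD(2,3)[OF assms(1) tK] by auto
    then show "K \<subseteq> {t - \<delta> t<..<t + \<delta> t}"
      using fineD[OF assms(2) tK] by (simp add: tag_gauge_def)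
  qed
qed

section \<open>Partial Perron sums and a covering estimate\<close>

lemma sum_lborel_eq_lebesgue:
  assumes "p tagged_division_of {0..1}"
  shows "(\<Sum>(t, K)\<in>p. measure lborel K *\<^sub>R g t) = (\<Sum>(t, K)\<in>p. measure lebesgue K * g t)"
proof (intro sum.cong refl)
  fix u assume "u \<in> p"
  then obtain t K a b where "u = (t, K)" "K = cbox a b"
    using tagged_division_ofD(4)[OF assms] by (metis prod.collapse)
  then show "(case u of (t, K) \<Rightarrow> measure lborel K *\<^sub>R g t) = (case u of (t, K) \<Rightarrow> measure lebesgue K * g t)"
    by simp
qed

text \<open>The gauge is given beforehand and the error survives unchanged, so one gauge serves
  every function of a family for which it is good.\<close>

lemma perron_Saks_Henstock:
  fixes f :: "real \<Rightarrow> real"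
  assumes \<delta>: "\<delta> \<in> gauges" and f: "f integrable_on {0..1}" and "0 < e"
    and less: "\<And>p. perron_partition p \<Longrightarrow> tag_fine \<delta> p \<Longrightarrow>
      \<bar>(\<Sum>(t, K)\<in>p. measure lebesgue K * f t) - integral {0..1} f\<bar> < e"
    and q: "q tagged_partial_division_of {0..1}" "tag_fine \<delta> q"
  shows "\<bar>\<Sum>(t, K)\<in>q. measure lebesgue K * f t - integral K f\<bar> \<le> e"
proof -
  have eq: "measure lborel K = measure lebesgue K" if "\<exists>a b. K = cbox a b" for K :: "real set"
    using that by auto
  have "norm (\<Sum>(t, K)\<in>q. measure lborel K *\<^sub>R f t - integral K f) \<le> e"
  proof (rule Henstock_lemma_part1[OF _ \<open>0 < e\<close> gauge_tag_gauge[OF \<delta>]])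
    show "f integrable_on cbox 0 1"
      using f by simp
    show "q tagged_partial_division_of cbox 0 1"
      using q by simp
    show "tag_gauge \<delta> fine q"
      using fineD[OF q(2)] by (intro fineI) (auto simp: tag_gauge_def)
    fix p assume "p tagged_division_of cbox 0 (1::real)" "tag_gauge \<delta> fine p"
    then have p: "p tagged_division_of {0..1}" "tag_gauge \<delta> fine p"
      by auto
    show "norm ((\<Sum>(t, K)\<in>p. measure lborel K *\<^sub>R f t) - integral (cbox 0 1) f) < e"
      using less[OF tag_gauge_fine(2,3)[OF p]] by (simp add: sum_lborel_eq_lebesgue[OF p(1)] del: real_scaleR_def)
  qed
  also have "(\<Sum>(t, K)\<in>q. measure lborel K *\<^sub>R f t - integral K f) = (\<Sum>(t, K)\<in>q. measure lebesgue K * f t - integral K f)"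
    using tagged_partial_division_ofD(4)[OF q(1)] by (intro sum.cong) (auto simp: eq)
  finally show ?thesis
    by simp
qed

text \<open>The tag function \<open>s\<close> is left open because the same disjoint intervals are
  to be tagged in two ways, by \<open>x\<close> and by \<open>T x\<close>.\<close>

lemma disjoint_intervals_tagged_partial:
  fixes U :: "'i \<Rightarrow> real set"
  assumes "finite D" "disjoint_family_on U D"
    and U: "\<And>x. x \<in> D \<Longrightarrow> U x \<subseteq> {0..1} \<and> (\<exists>a b. U x = {a..b}) \<and> s x \<in> U x"
    and fine: "\<And>x. x \<in> D \<Longrightarrow> U x \<subseteq> {s x - \<delta> (s x)<..<s x + \<delta> (s x)}"
  defines "q \<equiv> (\<lambda>x. (s x, U x)) ` D"
  shows "q tagged_partial_division_of {0..1}" "tag_fine \<delta> q"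
    "(\<Sum>(t, K)\<in>q. g t K) = (\<Sum>x\<in>D. g (s x) (U x))"
proof -
  have disj: "U x \<inter> U y = {}" if "x \<in> D" "y \<in> D" "x \<noteq> y" for x y
    using assms(2) that by (auto simp: disjoint_family_on_def)
  show "q tagged_partial_division_of {0..1}"
    unfolding tagged_partial_division_of_def
  proof (intro conjI allI impI)
    show "finite q"
      using assms(1) by (simp add: q_def)
    fix t K assume "(t, K) \<in> q"
    then obtain x where x: "x \<in> D" "t = s x" "K = U x"
      by (auto simp: q_def)
    then show "t \<in> K" "K \<subseteq> {0..1}" "\<exists>a b. K = cbox a b"
      using U[OF x(1)] by auto
  next
    fix t1 K1 t2 K2 assume "(t1, K1) \<in> q \<and> (t2, K2) \<in> q \<and> (t1, K1) \<noteq> (t2, K2)"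
    then obtain x y where "x \<in> D" "y \<in> D" "x \<noteq> y" "K1 = U x" "K2 = U y"
      by (auto simp: q_def)
    then show "interior K1 \<inter> interior K2 = {}"
      using disj interior_subset by blast
  qed
  show "tag_fine \<delta> q"
    using fine by (auto simp: fine_def q_def)
  have "inj_on (\<lambda>x. (s x, U x)) D"
    using disj U by (fastforce intro: inj_onI)
  then show "(\<Sum>(t, K)\<in>q. g t K) = (\<Sum>x\<in>D. g (s x) (U x))"
    by (simp add: q_def sum.reindex)
qed

text \<open>
  A Vitali covering by the intervals between \<open>x\<close> and \<open>T x\<close>: each of them may be tagged by either
  end point, and the difference of the two Riemann sums is at least \<open>\<kappa>\<close> times the total length.
\<close>

lemma oscillation_set_small:
  fixes f :: "real \<Rightarrow> real"
  assumes SH: "\<And>q. q tagged_partial_division_of {0..1} \<Longrightarrow> tag_fine \<delta> q \<Longrightarrow>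
      \<bar>\<Sum>(t, K)\<in>q. measure lebesgue K * f t - integral K f\<bar> \<le> e"
    and "0 < \<kappa>" "0 \<le> e"
    and S: "\<And>x. x \<in> S \<Longrightarrow> x \<in> {0..1} \<and> T x \<in> {0..1} \<and> \<bar>T x - x\<bar> < \<delta> x \<and> \<bar>T x - x\<bar> < \<delta> (T x) \<and>
      \<kappa> < \<bar>f (T x) - f x\<bar>"
  obtains V where "V \<in> lmeasurable" "S \<subseteq> V" "measure lebesgue V \<le> 20 * e / \<kappa>"
proof -
  \<comment> \<open>The interval between \<open>x\<close> and \<open>T x\<close> is written as a
    ball, the form in which Vitali's covering lemma applies.\<close>
  define a where "a x = (x + T x) / 2" for x
  define r where "r x = \<bar>T x - x\<bar> / 2" for x
  define U where "U x = cball (a x) (r x)" for x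
  have U_eq: "U x = {a x - r x..a x + r x}" for x
    by (simp add: U_def cball_eq_atLeastAtMost)
  have U_mM: "U x = {min x (T x)..max x (T x)}" for x
    unfolding U_eq a_def r_def by (auto simp: min_def max_def field_simps abs_if split: if_splits)
  have r: "0 < r x \<and> r x \<le> 1" if "x \<in> S" for x
  proof -
    have "T x \<noteq> x"
      using S[OF that] \<open>0 < \<kappa>\<close> by auto
    then show ?thesis
      using S[OF that] by (auto simp: r_def abs_if)
  qed
  have "S \<subseteq> (\<Union>x\<in>S. cball (a x) (r x))"
    unfolding U_def[symmetric] U_mM by auto
  then obtain C where C: "countable C" "C \<subseteq> S"
    and disj: "pairwise (\<lambda>x y. disjnt (cball (a x) (r x)) (cball (a y) (r y))) C"
    and cover: "S \<subseteq> (\<Union>x\<in>C. cball (a x) (5 * r x))"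
    using Vitali_covering_lemma_cballs[of S a r S 1] r by blast
  \<comment> \<open>With a fixed sign \<sigma> the differences cannot cancel. Both taggings have
    error at most \<open>e\<close> against the same integrals, which drop out on
    subtraction.\<close>
  have half: "(\<Sum>x\<in>D. 2 * r x) * \<kappa> \<le> 2 * e"
    if D: "finite D" "D \<subseteq> C" and sgn: "\<sigma> = 1 \<or> \<sigma> = -1" "\<And>x. x \<in> D \<Longrightarrow> \<kappa> < \<sigma> * (f (T x) - f x)" for D \<sigma>
  proof -
    have DS: "x \<in> S" if "x \<in> D" for x
      using that D C by blast
    have df: "disjoint_family_on U D"
      using disj D unfolding disjoint_family_on_def pairwise_def disjnt_def U_def by blast
    have len: "measure lebesgue (U x) = 2 * r x" if "x \<in> S" for x
      using r[OF that] by (simp add: U_eq)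
    have U1: "U x \<subseteq> {0..1}" "\<exists>a b. U x = {a..b}" "x \<in> U x" "T x \<in> U x" if "x \<in> D" for x
      using S[OF DS[OF that]] by (auto simp: U_mM)
    have fine: "U x \<subseteq> {x - \<delta> x<..<x + \<delta> x}" "U x \<subseteq> {T x - \<delta> (T x)<..<T x + \<delta> (T x)}" if "x \<in> D" for x
      using S[OF DS[OF that]] by (auto simp: U_mM abs_if min_def max_def split: if_splits)
    have "\<bar>\<Sum>x\<in>D. measure lebesgue (U x) * f x - integral (U x) f\<bar> \<le> e"
    proof -
      note q = disjoint_intervals_tagged_partial[OF D(1) df, of "\<lambda>x. x" \<delta>]
      have "(\<lambda>x. (x, U x)) ` D tagged_partial_division_of {0..1}" "tag_fine \<delta> ((\<lambda>x. (x, U x)) ` D)"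
        using q(1,2) U1 fine by auto
      from SH[OF this] show ?thesis
        using q(3)[of "\<lambda>t K. measure lebesgue K * f t - integral K f"] U1 fine by simp
    qed
    moreover have "\<bar>\<Sum>x\<in>D. measure lebesgue (U x) * f (T x) - integral (U x) f\<bar> \<le> e"
    proof -
      note q = disjoint_intervals_tagged_partial[OF D(1) df, of "T" \<delta>]
      have "(\<lambda>x. (T x, U x)) ` D tagged_partial_division_of {0..1}" "tag_fine \<delta> ((\<lambda>x. (T x, U x)) ` D)"
        using q(1,2) U1 fine by auto
      from SH[OF this] show ?thesis
        using q(3)[of "\<lambda>t K. measure lebesgue K * f t - integral K f"] U1 fine by simp
    qed
    moreover have "(\<Sum>x\<in>D. measure lebesgue (U x) * f (T x) - integral (U x) f) -
        (\<Sum>x\<in>D. measure lebesgue (U x) * f x - integral (U x) f) = (\<Sum>x\<in>D. 2 * r x * (f (T x) - f x))"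
      unfolding sum_subtractf[symmetric] using len DS by (intro sum.cong) (auto simp: algebra_simps)
    ultimately have "\<bar>\<Sum>x\<in>D. 2 * r x * (f (T x) - f x)\<bar> \<le> 2 * e"
      by linarith
    then have "\<sigma> * (\<Sum>x\<in>D. 2 * r x * (f (T x) - f x)) \<le> 2 * e"
      using sgn(1) by auto
    then have "(\<Sum>x\<in>D. 2 * r x * (\<sigma> * (f (T x) - f x))) \<le> 2 * e"
      by (simp add: sum_distrib_left mult_ac)
    moreover have "(\<Sum>x\<in>D. 2 * r x * \<kappa>) \<le> (\<Sum>x\<in>D. 2 * r x * (\<sigma> * (f (T x) - f x)))"
      using sgn(2) r DS by (intro sum_mono mult_left_mono) (auto intro: less_imp_le)
    ultimately show ?thesis
      by (simp add: sum_distrib_right)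
  qed
  define V where "V = (\<Union>x\<in>C. cball (a x) (5 * r x))"
  have fm: "cball (a x) (5 * r x) \<in> lmeasurable" for x
    by (simp add: lmeasurable_cball)
  \<comment> \<open>Each of the two signs contributes length at most
    \<open>2 * e / \<kappa>\<close>, and Vitali's enlargement multiplies the total by 5.\<close>
  have bound: "measure lebesgue (\<Union>x\<in>D. cball (a x) (5 * r x)) \<le> 20 * e / \<kappa>" if D: "D \<subseteq> C" "finite D" for D
  proof -
    define Dp where "Dp = {x\<in>D. \<kappa> < 1 * (f (T x) - f x)}"
    define Dm where "Dm = {x\<in>D. \<kappa> < - 1 * (f (T x) - f x)}"
    have "D = Dp \<union> Dm" "Dp \<inter> Dm = {}"
      using D C(2) S \<open>0 < \<kappa>\<close> by (fastforce simp: Dp_def Dm_def abs_if split: if_splits)+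
    then have "(\<Sum>x\<in>D. 2 * r x) = (\<Sum>x\<in>Dp. 2 * r x) + (\<Sum>x\<in>Dm. 2 * r x)"
      using D(2) by (metis finite_Un sum.union_disjoint)
    moreover have "(\<Sum>x\<in>Dp. 2 * r x) * \<kappa> \<le> 2 * e"
      by (rule half[where \<sigma>=1]) (use D in \<open>auto simp: Dp_def\<close>)
    moreover have "(\<Sum>x\<in>Dm. 2 * r x) * \<kappa> \<le> 2 * e"
      by (rule half[where \<sigma>="-1"]) (use D in \<open>auto simp: Dm_def\<close>)
    ultimately have "(\<Sum>x\<in>D. 2 * r x) * \<kappa> \<le> 4 * e"
      by (simp add: distrib_right)
    then have sum_le: "(\<Sum>x\<in>D. 2 * r x) \<le> 4 * e / \<kappa>"
      using \<open>0 < \<kappa>\<close> by (simp add: pos_le_divide_eq)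
    have "measure lebesgue (\<Union>x\<in>D. cball (a x) (5 * r x)) \<le> (\<Sum>x\<in>D. measure lebesgue (cball (a x) (5 * r x)))"
      using D fm by (intro measure_UNION_le) (auto dest: fmeasurableD)
    also have "\<dots> = (\<Sum>x\<in>D. 5 * (2 * r x))"
    proof (rule sum.cong)
      fix x assume "x \<in> D"
      then have "0 < r x"
        using D C r by blast
      then show "measure lebesgue (cball (a x) (5 * r x)) = 5 * (2 * r x)"
        by (simp add: cball_eq_atLeastAtMost)
    qed simp
    also have "\<dots> = 5 * (\<Sum>x\<in>D. 2 * r x)"
      by (simp add: sum_distrib_left)
    also have "\<dots> \<le> 20 * e / \<kappa>"
      using sum_le by simp
    finally show ?thesis .
  qed
  show ?thesis
  proof
    show "V \<in> lmeasurable"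
      unfolding V_def by (rule fmeasurable_UN_bound[OF C(1) fm bound])
    show "measure lebesgue V \<le> 20 * e / \<kappa>"
      unfolding V_def by (rule measure_UN_bound[OF C(1) fm bound])
    show "S \<subseteq> V"
      using cover by (simp add: V_def)
  qed
qed

section \<open>From Perron partitions to free partitions\<close>

lemma gauge_class_min:
  assumes "G = gauges \<or> G = measurable_gauges" "\<delta> \<in> G" "\<rho> \<in> G"
  shows "(\<lambda>t. min (\<delta> t) (\<rho> t)) \<in> G"
  using assms by (auto simp: gauges_def measurable_gauges_def)

lemma gauge_class_const:
  assumes "G = gauges \<or> G = measurable_gauges" "0 < c"
  shows "(\<lambda>t. c) \<in> G"
  using assms by (auto simp: gauges_def measurable_gauges_def)

text \<open>For \<open>t\<close> outside \<open>C\<close>, the ball of this radius around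
  \<open>t\<close> misses \<open>C\<close>. Thus cells can be forced into an open set by a gauge
  that is measurable; the value 1 on \<open>C\<close> only provides positivity.\<close>

lemma gauge_class_infdist:
  assumes "G = gauges \<or> G = measurable_gauges" "closed C" "C \<noteq> {}"
  shows "(\<lambda>t. if t \<in> C then 1 else infdist t C) \<in> G"
proof -
  have C: "C \<inter> {0..1} \<in> sets (lebesgue_on {0..1})"
    using borel_closed[OF \<open>closed C\<close>] by (simp add: sets_restrict_space_iff)
  have "(\<lambda>t. infdist t C) \<in> borel_measurable (lebesgue_on {0..1})"
    by (intro continuous_imp_measurable_on_sets_lebesgue continuous_intros) auto
  then have "(\<lambda>t. if t \<in> C then 1 else infdist t C) \<in> borel_measurable (lebesgue_on {0..1})"
    using C by (intro measurable_If_set) (auto simp: space_restrict_space)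
  moreover have "0 < infdist t C" if "t \<notin> C" for t
    using assms(2,3) that infdist_pos_not_in_closed by blast
  ultimately show ?thesis
    using assms(1) by (auto simp: gauges_def measurable_gauges_def)
qed

text \<open>The index takes countably many values and depends measurably on \<open>t\<close>
  whenever \<rho> is measurable, so choosing among countably many gauges stays inside the
  class.\<close>

lemma gauge_class_glue:
  assumes G: "G = gauges \<or> G = measurable_gauges" and "\<rho> \<in> G" "\<And>n. \<delta> n \<in> G"
  shows "(\<lambda>t. \<delta> (nat \<lfloor>1 / \<rho> t\<rfloor>) t) \<in> G"
  using G
proof
  assume G: "G = measurable_gauges"
  then have [measurable]: "\<rho> \<in> borel_measurable (lebesgue_on {0..1})"
      "\<delta> n \<in> borel_measurable (lebesgue_on {0..1})" for n
    using assms(2,3) by (auto simp: measurable_gauges_def)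
  have "(\<lambda>t. \<delta> (nat \<lfloor>1 / \<rho> t\<rfloor>) t) \<in> borel_measurable (lebesgue_on {0..1})"
    by (rule measurable_compose_countable) measurable
  then show ?thesis
    using assms(3) G by (auto simp: measurable_gauges_def gauges_def)
qed (use assms in \<open>auto simp: gauges_def\<close>)

text \<open>Outer measure is continuous along increasing sequences even of nonmeasurable sets, so
  some \<open>E m\<close> has almost the outer measure of the union. One half of \<theta> is spent
  on the open superset, the other on the choice of \<open>m\<close>.\<close>

lemma open_and_envelope_approximation:
  fixes E :: "nat \<Rightarrow> real set"
  assumes "incseq E" and sub: "\<And>n. E n \<subseteq> {0..1}" and "0 < \<theta>"
  obtains m W H where "open W" "(\<Union>n. E n) \<subseteq> W" "W \<in> lmeasurable" "H \<subseteq> W"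
    "measurable_envelope lebesgue (E m) H" "measure lebesgue (W - H) < \<theta>"
proof -
  let ?F = "\<Union>n. E n"
  let ?o = "outer_measure_of lebesgue"
  have Fsub: "?F \<subseteq> {0..1}"
    using sub by blast
  obtain A0 where A0: "A0 \<in> sets lebesgue" "?F \<subseteq> A0" "?o ?F = emeasure lebesgue A0"
    using outer_measure_of_attain[of ?F lebesgue] by auto
  define A where "A = A0 \<inter> {0..1}"
  have A: "A \<in> lmeasurable" "?F \<subseteq> A"
    using A0 Fsub by (auto simp: A_def intro!: lmeasurable_subset_unit)
  have oF: "?o ?F = ennreal (measure lebesgue A)"
  proof (rule antisym)
    have "?o ?F \<le> ?o A"
      using A(2) by (rule outer_measure_of_mono)
    then show "?o ?F \<le> ennreal (measure lebesgue A)"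
      using A(1) by (simp add: emeasure_eq_measure2 fmeasurableD)
    show "ennreal (measure lebesgue A) \<le> ?o ?F"
      unfolding A0(3) emeasure_eq_measure2[OF A(1), symmetric] using A0 by (intro emeasure_mono) (auto simp: A_def)
  qed
  obtain W where W: "open W" "A \<subseteq> W" "W - A \<in> lmeasurable" "emeasure lebesgue (W - A) < ennreal (\<theta>/2)"
    using sets_lebesgue_outer_open[of A "\<theta>/2"] A \<open>0 < \<theta>\<close> by (auto dest: fmeasurableD)
  have "W = (W - A) \<union> A"
    using W(2) by blast
  then have Wm: "W \<in> lmeasurable"
    using W(3) A(1) by (metis fmeasurable.Un)
  have "measure lebesgue (W - A) < \<theta>/2"
    using W(3,4) by (simp add: emeasure_eq_measure2 ennreal_less_iff)
  then have mW: "measure lebesgue W < measure lebesgue A + \<theta>/2"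
    using measurable_measure_Diff[OF Wm, of A] A W(2) by (auto dest: fmeasurableD)
  \<comment> \<open>A negative threshold is treated separately because \<open>ennreal\<close> sends
    negative numbers to 0.\<close>
  have "\<exists>m. measure lebesgue A - \<theta>/2 < enn2real (?o (E m))"
  proof (cases "measure lebesgue A - \<theta>/2 < 0")
    case True
    then show ?thesis
      using enn2real_nonneg less_le_trans by blast
  next
    case False
    then have "ennreal (measure lebesgue A - \<theta>/2) < ennreal (measure lebesgue A)"
      using \<open>0 < \<theta>\<close> by (intro ennreal_lessI) auto
    also have "\<dots> = (SUP n. ?o (E n))"
      using SUP_outer_measure_of_incseq[OF _ \<open>incseq E\<close>, of lebesgue] oF by simp
    finally obtain m where m: "ennreal (measure lebesgue A - \<theta>/2) < ?o (E m)"
      by (auto simp: less_SUP_iff)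
    have "?o (E m) \<le> ?o ?F"
      by (rule outer_measure_of_mono) auto
    then have "?o (E m) < top"
      using oF by (simp add: le_less_trans)
    then show ?thesis
      using m False by (intro exI[of _ m]) (metis enn2real_ennreal enn2real_less_iff ennreal_enn2real linorder_not_less ennreal_less_iff)
  qed
  then obtain m where m: "measure lebesgue A - \<theta>/2 < enn2real (?o (E m))"
    by blast
  obtain H0 where H0: "H0 \<in> sets lebesgue" "E m \<subseteq> H0" "?o (E m) = emeasure lebesgue H0"
    using outer_measure_of_attain[of "E m" lebesgue] by auto
  define H where "H = H0 \<inter> W"
  have H: "H \<in> lmeasurable" "E m \<subseteq> H" "H \<subseteq> W"
    using H0 A(2) W(2) Wm by (auto simp: H_def intro: fmeasurableI2[OF Wm] fmeasurableD)
  have oE: "?o (E m) = emeasure lebesgue H"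
  proof (rule antisym)
    show "?o (E m) \<le> emeasure lebesgue H"
      using outer_measure_of_mono[OF H(2), of lebesgue] H(1) by (simp add: fmeasurableD)
    show "emeasure lebesgue H \<le> ?o (E m)"
      unfolding H0(3) using H0 by (intro emeasure_mono) (auto simp: H_def)
  qed
  show ?thesis
  proof
    show "open W" "W \<in> lmeasurable" "H \<subseteq> W"
      by fact+
    show "?F \<subseteq> W"
      using A(2) W(2) by blast
    show "measurable_envelope lebesgue (E m) H"
      using H oE by (subst measurable_envelope_eq2) (auto simp: fmeasurable_def)
    have "measure lebesgue A - \<theta>/2 < measure lebesgue H"
      using m oE by (simp add: measure_def)
    then show "measure lebesgue (W - H) < \<theta>"
      using mW measurable_measure_Diff[OF Wm, of H] H by (auto dest: fmeasurableD)
  qed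
qed

text \<open>This turns pointwise facts on a nonmeasurable set into almost-everywhere facts on its
  envelope: the set of violations, once measurable, misses \<open>E\<close>.\<close>

lemma null_set_in_envelope:
  assumes "measurable_envelope lebesgue E H" "Z \<in> sets lebesgue" "Z \<subseteq> H" "Z \<inter> E = {}"
  shows "Z \<in> null_sets lebesgue"
  using measurable_envelopeD1[OF assms(1,2)] assms by (auto simp: null_sets_def)

text \<open>Off \<open>Q\<close> the tag value approximates \<open>f\<close> within \<kappa>; on
  \<open>Q\<close> only the crude bound \<open>2 * N\<close> is available, and the small measure of
  \<open>Q\<close> has to compensate.\<close>

lemma tagged_cell_oscillation_integral:
  fixes f :: "real \<Rightarrow> real"
  assumes f: "set_integrable lebesgue A f" and A: "A \<in> lmeasurable" and Q: "Q \<in> sets lebesgue" "Q \<subseteq> A"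
    and off: "\<And>x. x \<in> A - Q \<Longrightarrow> \<bar>c - f x\<bar> \<le> \<kappa>"
    and bd: "\<bar>c\<bar> \<le> N" "AE x in lebesgue. x \<in> A \<longrightarrow> \<bar>f x\<bar> \<le> N" and "0 \<le> \<kappa>"
  shows "\<bar>c * measure lebesgue A - (LINT x:A|lebesgue. f x)\<bar> \<le> \<kappa> * measure lebesgue A + 2 * N * measure lebesgue Q"
proof -
  have Qm: "Q \<in> lmeasurable"
    using fmeasurableI2[OF A Q(2,1)] .
  have cA: "set_integrable lebesgue A (\<lambda>x. a)" for a :: real
    unfolding set_integrable_def
    using A by (intro integrable_scaleR_left integrable_real_indicator) (auto simp: fmeasurable_def)
  have cI: "(LINT x:A|lebesgue. a) = a * measure lebesgue A" for a :: real
  proof -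
    have "A \<in> sets lebesgue" "emeasure lebesgue A \<noteq> \<infinity>"
      using A fmeasurableD2[OF A] by (auto dest: fmeasurableD)
    from set_integral_const[OF this, of a] show ?thesis
      by (simp add: mult.commute)
  qed
  have iQ: "set_integrable lebesgue A (\<lambda>x. 2 * N * indicator Q x)"
  proof -
    have "(\<lambda>x. indicator A x *\<^sub>R (2 * N * indicator Q x)) = (\<lambda>x. 2 * N * indicator Q x)"
      using Q(2) by (auto simp: fun_eq_iff split: split_indicator)
    moreover have "integrable lebesgue (\<lambda>x. 2 * N * indicator Q x)"
      using Qm by (intro integrable_mult_right integrable_real_indicator) (auto simp: fmeasurable_def)
    ultimately show ?thesis
      by (simp add: set_integrable_def)
  qed
  have diff: "set_integrable lebesgue A (\<lambda>x. c - f x)"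
    by (intro set_integral_diff cA f)
  have "c * measure lebesgue A - (LINT x:A|lebesgue. f x) = (LINT x:A|lebesgue. c - f x)"
    by (simp add: set_integral_diff(2)[OF cA f] cI)
  also have "\<bar>\<dots>\<bar> \<le> (LINT x:A|lebesgue. \<bar>c - f x\<bar>)"
    by (rule set_integral_abs_le[OF diff])
  also have "\<dots> \<le> (LINT x:A|lebesgue. \<kappa> + 2 * N * indicator Q x)"
  proof (rule set_integral_mono_AE)
    show "AE x\<in>A in lebesgue. \<bar>c - f x\<bar> \<le> \<kappa> + 2 * N * indicator Q x"
      using bd(2)
    proof (rule AE_mp, intro AE_I2 impI)
      fix x assume x: "x \<in> A \<longrightarrow> \<bar>f x\<bar> \<le> N" "x \<in> A"
      show "\<bar>c - f x\<bar> \<le> \<kappa> + 2 * N * indicator Q x"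
      proof (cases "x \<in> Q")
        case True
        then show ?thesis
          using x bd(1) \<open>0 \<le> \<kappa>\<close> by (simp add: abs_if split: if_splits)
      next
        case False
        then show ?thesis
          using x off[of x] by simp
      qed
    qed
  qed (use diff cA iQ in \<open>auto intro: set_integrable_abs\<close>)
  also have "\<dots> = \<kappa> * measure lebesgue A + (LINT x:A|lebesgue. 2 * N * indicator Q x)"
    by (simp only: set_integral_add(2)[OF cA iQ] cI)
  also have "(LINT x:A|lebesgue. 2 * N * indicator Q x) = 2 * N * measure lebesgue Q"
  proof -
    have "(LINT x:A|lebesgue. 2 * N * indicator Q x) = (\<integral>x. 2 * N * indicator Q x \<partial>lebesgue)"
      unfolding set_lebesgue_integral_def
      using Q(2) by (intro Bochner_Integration.integral_cong) (auto split: split_indicator)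
    then show ?thesis
      using Q(1) by simp
  qed
  finally show ?thesis .
qed

text \<open>
  \<open>H\<close> is a measurable envelope of the set \<open>E\<close> of those tags on which \<open>\<delta>\<close> exceeds the mesh \<open>c\<close>. Bounds
  holding on \<open>E\<close> hold almost everywhere on \<open>H\<close>, for every single \<open>f\<close>.
\<close>

lemma bounded_tags_estimate:
  fixes f :: "real \<Rightarrow> real"
  assumes f: "set_integrable lebesgue {0..1} f"
    and SH: "\<And>q. q tagged_partial_division_of {0..1} \<Longrightarrow> tag_fine \<delta> q \<Longrightarrow>
      \<bar>\<Sum>(t, K)\<in>q. measure lebesgue K * f t - integral K f\<bar> \<le> e"
    and "0 \<le> e" "0 < \<kappa>"
    and bd: "\<And>t. t \<in> F \<Longrightarrow> \<bar>f t\<bar> \<le> N" "0 \<le> N"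
    and env: "measurable_envelope lebesgue E H" "E \<subseteq> F" "E \<subseteq> {0..1}" "\<And>x. x \<in> E \<Longrightarrow> c < \<delta> x"
    and W: "W \<in> lmeasurable" "H \<subseteq> W" "measure lebesgue (W - H) \<le> \<theta>"
    and ac: "\<And>A. A \<in> sets lebesgue \<Longrightarrow> A \<subseteq> {0..1} \<Longrightarrow> measure lebesgue A \<le> \<theta> \<Longrightarrow>
      \<bar>LINT x:A|lebesgue. f x\<bar> \<le> \<eta>"
    and p: "partial_free_partition p"
    and tag: "\<And>t K. (t, K) \<in> p \<Longrightarrow> t \<in> F"
    and near: "\<And>t K x. (t, K) \<in> p \<Longrightarrow> x \<in> K \<Longrightarrow> x \<in> W \<and> \<bar>t - x\<bar> < \<delta> t \<and> \<bar>t - x\<bar> < c"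
  shows "\<bar>\<Sum>(t, K)\<in>p. measure lebesgue K * f t - (LINT x:K|lebesgue. f x)\<bar> \<le>
    \<kappa> + 2 * N * (20 * e / \<kappa>) + N * \<theta> + \<eta>"
proof -
  \<comment> \<open>Nothing is known about \<open>f\<close> outside [0,1]; the cut-off version is
    measurable on the whole line.\<close>
  define g where "g x = indicator {0..1} x *\<^sub>R f x" for x
  have g[measurable]: "g \<in> borel_measurable lebesgue"
    using f unfolding g_def[abs_def] set_integrable_def by (rule borel_measurable_integrable)
  have gf: "g x = f x" if "x \<in> {0..1}" for x
    using that by (simp add: g_def)
  note E = measurable_envelopeD(1,2)[OF env(1)]
  have H[measurable]: "H \<in> sets lebesgue"
    by (rule E(2))
  have fin: "finite p"
    using p by (simp add: partial_free_partition_def)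
  have K: "K \<in> sets lebesgue" "K \<subseteq> {0..1}" "t \<in> {0..1}" "K \<in> lmeasurable" if tK: "(t, K) \<in> p" for t K
  proof -
    obtain a b where ab: "K = {a..b}" and K01: "K \<subseteq> {0..1}"
      using partial_free_interval[OF p tK] by (metis snd_conv)
    then show "K \<in> sets lebesgue" "K \<subseteq> {0..1}"
      by auto
    then show "K \<in> lmeasurable"
      by (rule lmeasurable_subset_unit)
    show "t \<in> {0..1}"
      using p tK by (auto simp: partial_free_partition_def)
  qed
  define Q where "Q i = {x \<in> snd i \<inter> H. \<kappa> < \<bar>f (fst i) - g x\<bar>}" for i :: "real \<times> real set"
  have Qm: "Q i \<in> sets lebesgue" if "i \<in> p" for i
  proof -
    have [measurable]: "snd i \<in> sets lebesgue"
      using K(1)[of "fst i" "snd i"] that by simp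
    have "Q i = {x \<in> space lebesgue. x \<in> snd i \<and> x \<in> H \<and> \<kappa> < \<bar>f (fst i) - g x\<bar>}"
      by (auto simp: Q_def)
    also have "\<dots> \<in> sets lebesgue"
      by measurable
    finally show ?thesis .
  qed
  \<comment> \<open>Only points of \<open>E\<close> can serve as tags, since there \<delta> exceeds
    the distance \<open>c\<close> to the tag of the cell. The covering estimate therefore concerns
    \<open>S\<close>, and the rest of the bad set outside \<open>V\<close> is a measurable subset of
    \<open>H\<close> missing \<open>E\<close>, hence null.\<close>
  define S where "S = (\<Union>i\<in>p. Q i) \<inter> E"
  have "\<forall>x\<in>S. \<exists>i. i \<in> p \<and> x \<in> Q i"
    by (auto simp: S_def)
  then obtain i where i: "\<And>x. x \<in> S \<Longrightarrow> i x \<in> p \<and> x \<in> Q (i x)"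
    by metis
  define T where "T x = fst (i x)" for x
  have "x \<in> {0..1} \<and> T x \<in> {0..1} \<and> \<bar>T x - x\<bar> < \<delta> x \<and> \<bar>T x - x\<bar> < \<delta> (T x) \<and> \<kappa> < \<bar>f (T x) - f x\<bar>"
    if x: "x \<in> S" for x
  proof -
    have tK: "(T x, snd (i x)) \<in> p" and xK: "x \<in> snd (i x)"
      using i[OF x] by (auto simp: T_def Q_def)
    have "x \<in> {0..1}" "T x \<in> {0..1}"
      using K(2,3)[OF tK] xK by auto
    moreover have "\<kappa> < \<bar>f (T x) - f x\<bar>"
      using i[OF x] gf[OF \<open>x \<in> {0..1}\<close>] by (simp add: Q_def T_def)
    moreover have "c < \<delta> x"
      using x env(4) by (simp add: S_def)
    ultimately show ?thesis
      using near[OF tK xK] by auto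
  qed
  then obtain V where V: "V \<in> lmeasurable" "S \<subseteq> V" "measure lebesgue V \<le> 20 * e / \<kappa>"
    using oscillation_set_small[where S=S and T=T and f=f and \<delta>=\<delta> and e=e and \<kappa>=\<kappa>, OF SH \<open>0 < \<kappa>\<close> \<open>0 \<le> e\<close>]
    by blast
  have QU: "(\<Union>i\<in>p. Q i) \<in> sets lebesgue"
    using fin Qm by auto
  have sumQ: "(\<Sum>i\<in>p. measure lebesgue (Q i)) \<le> 20 * e / \<kappa>"
  proof -
    have nul: "(\<Union>i\<in>p. Q i) - V \<in> null_sets lebesgue"
      using V QU by (intro null_set_in_envelope[OF env(1)]) (auto simp: S_def Q_def dest: fmeasurableD)
    have "(\<Sum>i\<in>p. measure lebesgue (Q i)) = measure lebesgue (\<Union>i\<in>p. Q i)"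
      using Qm by (intro measure_partial_free_Union[OF p, symmetric]) (auto simp: Q_def)
    also have "\<dots> \<le> measure lebesgue (V \<union> ((\<Union>i\<in>p. Q i) - V))"
      using V(1) QU nul by (intro measure_mono_fmeasurable fmeasurable.Un) (auto simp: fmeasurable_def null_sets_def)
    also have "\<dots> = measure lebesgue V"
      by (rule measure_Un_null_set[OF fmeasurableD[OF V(1)] nul])
    finally show ?thesis
      using V(3) by linarith
  qed
  have aeN: "AE x in lebesgue. x \<in> H \<inter> {0..1} \<longrightarrow> \<bar>f x\<bar> \<le> N"
  proof -
    have "{x \<in> H. N < \<bar>g x\<bar>} \<in> null_sets lebesgue"
    proof (rule null_set_in_envelope[OF env(1)])
      have "{x \<in> space lebesgue. x \<in> H \<and> N < \<bar>g x\<bar>} \<in> sets lebesgue"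
        by measurable
      then show "{x \<in> H. N < \<bar>g x\<bar>} \<in> sets lebesgue"
        by simp
      show "{x \<in> H. N < \<bar>g x\<bar>} \<inter> E = {}"
      proof (intro equals0I)
        fix x assume x: "x \<in> {x \<in> H. N < \<bar>g x\<bar>} \<inter> E"
        then have "\<bar>f x\<bar> \<le> N" "g x = f x"
          using bd(1)[of x] env(2,3) gf[of x] by auto
        then show False
          using x by simp
      qed
    qed auto
    then show ?thesis
      by (rule AE_I') (auto simp: gf not_le)
  qed
  \<comment> \<open>Inside \<open>H\<close> the oscillation estimate applies. The parts outside
    \<open>H\<close> have total measure at most \<theta>; there the tag values are bounded by
    \<open>N\<close> and the integral is controlled by absolute continuity.\<close>
  let ?K1 = "\<lambda>i. snd i \<inter> H" and ?K2 = "\<lambda>i. snd i - H"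
  have K12: "?K1 i \<in> sets lebesgue" "?K2 i \<in> sets lebesgue" "?K1 i \<in> lmeasurable" "?K2 i \<in> lmeasurable"
      "?K1 i \<subseteq> {0..1}" "?K2 i \<subseteq> {0..1}" if "i \<in> p" for i
    using K(1,2,4)[of "fst i" "snd i"] that H by (auto intro: fmeasurableI2)
  have fA: "set_integrable lebesgue A f" if "A \<in> sets lebesgue" "A \<subseteq> {0..1}" for A
    using set_integrable_subset[OF f that] .
  have split: "measure lebesgue (snd i) * f (fst i) - (LINT x:snd i|lebesgue. f x) =
      (f (fst i) * measure lebesgue (?K1 i) - (LINT x:?K1 i|lebesgue. f x)) +
      f (fst i) * measure lebesgue (?K2 i) - (LINT x:?K2 i|lebesgue. f x)" if "i \<in> p" for i
  proof -
    have eq: "snd i = ?K1 i \<union> ?K2 i" "?K1 i \<inter> ?K2 i = {}"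
      by auto
    have "measure lebesgue (snd i) = measure lebesgue (?K1 i) + measure lebesgue (?K2 i)"
      using measure_Un3[OF K12(3,4)[OF that]] eq by (metis diff_zero measure_empty)
    moreover have "(LINT x:snd i|lebesgue. f x) = (LINT x:?K1 i|lebesgue. f x) + (LINT x:?K2 i|lebesgue. f x)"
      using set_integral_Un[OF eq(2) fA[OF K12(1,5)[OF that]] fA[OF K12(2,6)[OF that]]] eq(1) by metis
    ultimately show ?thesis
      by (simp add: algebra_simps)
  qed
  have sub2: "(\<Union>i\<in>p. ?K2 i) \<subseteq> W - H" "(\<Union>i\<in>p. ?K2 i) \<subseteq> {0..1}" "(\<Union>i\<in>p. ?K2 i) \<in> sets lebesgue"
  proof -
    show "(\<Union>i\<in>p. ?K2 i) \<subseteq> W - H"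
    proof
      fix x assume "x \<in> (\<Union>i\<in>p. ?K2 i)"
      then obtain t K where "(t, K) \<in> p" "x \<in> K" "x \<notin> H"
        by auto
      then show "x \<in> W - H"
        using near[of t K x] by simp
    qed
    show "(\<Union>i\<in>p. ?K2 i) \<subseteq> {0..1}"
      using K12(6) by (rule UN_least)
    show "(\<Union>i\<in>p. ?K2 i) \<in> sets lebesgue"
      using K12(2) fin by (intro sets.finite_UN) auto
  qed
  have small2: "measure lebesgue (\<Union>i\<in>p. ?K2 i) \<le> \<theta>"
  proof -
    have "W - H \<in> lmeasurable"
      using W(1) H by (rule fmeasurable_Diff)
    then show ?thesis
      using measure_mono_fmeasurable[OF sub2(1,3)] W(3) by linarith
  qed
  have "\<bar>\<Sum>i\<in>p. f (fst i) * measure lebesgue (?K1 i) - (LINT x:?K1 i|lebesgue. f x)\<bar> \<le> \<kappa> + 2 * N * (20 * e / \<kappa>)"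
  proof -
    have "\<bar>f (fst i) * measure lebesgue (?K1 i) - (LINT x:?K1 i|lebesgue. f x)\<bar> \<le>
        \<kappa> * measure lebesgue (?K1 i) + 2 * N * measure lebesgue (Q i)" if "i \<in> p" for i
    proof (rule tagged_cell_oscillation_integral)
      show "set_integrable lebesgue (?K1 i) f" "?K1 i \<in> lmeasurable" "Q i \<in> sets lebesgue" "Q i \<subseteq> ?K1 i"
        using fA K12 Qm that by (auto simp: Q_def)
      show "\<bar>f (fst i) - f x\<bar> \<le> \<kappa>" if "x \<in> ?K1 i - Q i" for x
        using that K12(5)[OF \<open>i \<in> p\<close>] gf[of x] by (auto simp: Q_def)
      show "\<bar>f (fst i)\<bar> \<le> N"
        using tag[of "fst i" "snd i"] that by (simp add: bd(1))
      show "AE x in lebesgue. x \<in> ?K1 i \<longrightarrow> \<bar>f x\<bar> \<le> N"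
        using aeN by (rule AE_mp) (use K12(5)[OF that] in \<open>auto intro!: AE_I2\<close>)
    qed (use \<open>0 < \<kappa>\<close> in auto)
    then have "\<bar>\<Sum>i\<in>p. f (fst i) * measure lebesgue (?K1 i) - (LINT x:?K1 i|lebesgue. f x)\<bar> \<le>
        (\<Sum>i\<in>p. \<kappa> * measure lebesgue (?K1 i) + 2 * N * measure lebesgue (Q i))"
      by (intro order_trans[OF sum_abs] sum_mono)
    also have "\<dots> = \<kappa> * measure lebesgue (\<Union>i\<in>p. ?K1 i) + 2 * N * (\<Sum>i\<in>p. measure lebesgue (Q i))"
      using measure_partial_free_Union[OF p, of ?K1] K12(1) by (simp add: sum.distrib sum_distrib_left)
    also have "\<dots> \<le> \<kappa> * 1 + 2 * N * (20 * e / \<kappa>)"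
    proof (intro add_mono mult_left_mono sumQ)
      have "(\<Union>i\<in>p. ?K1 i) \<subseteq> {0..1}"
        using K12(5) by (rule UN_least)
      moreover have "(\<Union>i\<in>p. ?K1 i) \<in> sets lebesgue"
        using K12(1) fin by (intro sets.finite_UN) auto
      ultimately show "measure lebesgue (\<Union>i\<in>p. ?K1 i) \<le> 1"
        using measure_mono_fmeasurable[of "\<Union>i\<in>p. ?K1 i" "{0..1}" lebesgue] by (simp add: lmeasurable_subset_unit)
    qed (use \<open>0 < \<kappa>\<close> \<open>0 \<le> N\<close> in auto)
    finally show ?thesis
      by simp
  qed
  moreover have "\<bar>\<Sum>i\<in>p. f (fst i) * measure lebesgue (?K2 i)\<bar> \<le> N * \<theta>"
  proof -
    have "\<bar>\<Sum>i\<in>p. f (fst i) * measure lebesgue (?K2 i)\<bar> \<le> (\<Sum>i\<in>p. N * measure lebesgue (?K2 i))"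
    proof (intro order_trans[OF sum_abs] sum_mono)
      fix i assume "i \<in> p"
      then have "\<bar>f (fst i)\<bar> \<le> N"
        using tag[of "fst i" "snd i"] by (simp add: bd(1))
      then show "\<bar>f (fst i) * measure lebesgue (?K2 i)\<bar> \<le> N * measure lebesgue (?K2 i)"
        by (simp add: abs_mult mult_right_mono)
    qed
    also have "\<dots> = N * measure lebesgue (\<Union>i\<in>p. ?K2 i)"
      using measure_partial_free_Union[OF p, of ?K2] K12(2) by (simp add: sum_distrib_left)
    also have "\<dots> \<le> N * \<theta>"
      using small2 bd(2) by (rule mult_left_mono)
    finally show ?thesis .
  qed
  moreover have "\<bar>\<Sum>i\<in>p. LINT x:?K2 i|lebesgue. f x\<bar> \<le> \<eta>"
    using ac[OF sub2(3,2) small2] integral_partial_free_Union[OF p f, of ?K2] K12(2) by simp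
  moreover have "(\<Sum>(t, K)\<in>p. measure lebesgue K * f t - (LINT x:K|lebesgue. f x)) =
      (\<Sum>i\<in>p. f (fst i) * measure lebesgue (?K1 i) - (LINT x:?K1 i|lebesgue. f x)) +
      (\<Sum>i\<in>p. f (fst i) * measure lebesgue (?K2 i)) - (\<Sum>i\<in>p. LINT x:?K2 i|lebesgue. f x)"
    unfolding sum.distrib[symmetric] sum_subtractf[symmetric] split_def
    using split by (intro sum.cong) auto
  ultimately show ?thesis
    by linarith
qed

section \<open>Families of functions with a common gauge\<close>

definition uniformly_absolutely_continuous :: "'b set \<Rightarrow> ('b \<Rightarrow> real \<Rightarrow> real) \<Rightarrow> bool" where
  "uniformly_absolutely_continuous B f \<longleftrightarrow>
     (\<forall>e>0. \<exists>\<eta>>0. \<forall>b\<in>B. \<forall>A. A \<in> sets lebesgue \<longrightarrow> A \<subseteq> {0..1} \<longrightarrow> measure lebesgue A < \<eta> \<longrightarrow>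
        \<bar>LINT x:A|lebesgue. f b x\<bar> \<le> e)"

definition uniformly_gauge_integrable ::
  "(real \<Rightarrow> real) set \<Rightarrow> ((real \<times> real set) set \<Rightarrow> bool) \<Rightarrow> 'b set \<Rightarrow> ('b \<Rightarrow> real \<Rightarrow> real) \<Rightarrow> ('b \<Rightarrow> real) \<Rightarrow> bool" where
  "uniformly_gauge_integrable G P B f I \<longleftrightarrow>
     (\<forall>e>0. \<exists>\<delta>\<in>G. \<forall>b\<in>B. \<forall>p. P p \<longrightarrow> tag_fine \<delta> p \<longrightarrow> \<bar>(\<Sum>(t, K)\<in>p. measure lebesgue K * f b t) - I b\<bar> < e)"

lemma uniform_Saks_Henstock:
  assumes G: "G = gauges \<or> G = measurable_gauges"
    and int: "\<And>b. b \<in> B \<Longrightarrow> set_integrable lebesgue {0..1} (f b)"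
    and hk: "uniformly_gauge_integrable G perron_partition B f (\<lambda>b. LINT x:{0..1}|lebesgue. f b x)"
    and "0 < e"
  obtains \<delta> where "\<delta> \<in> G" "\<And>b q. b \<in> B \<Longrightarrow> q tagged_partial_division_of {0..1} \<Longrightarrow> tag_fine \<delta> q \<Longrightarrow>
    \<bar>\<Sum>(t, K)\<in>q. measure lebesgue K * f b t - integral K (f b)\<bar> \<le> e"
proof -
  obtain \<delta> where \<delta>: "\<delta> \<in> G" and less: "\<And>b p. b \<in> B \<Longrightarrow> perron_partition p \<Longrightarrow> tag_fine \<delta> p \<Longrightarrow>
      \<bar>(\<Sum>(t, K)\<in>p. measure lebesgue K * f b t) - (LINT x:{0..1}|lebesgue. f b x)\<bar> < e"
    using hk \<open>0 < e\<close> unfolding uniformly_gauge_integrable_def by meson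
  have "\<delta> \<in> gauges"
    using \<delta> G by (auto simp: measurable_gauges_def)
  show ?thesis
  proof (rule that[OF \<delta>])
    fix b q assume b: "b \<in> B" and q: "q tagged_partial_division_of {0..1::real}" "tag_fine \<delta> q"
    note i = set_lebesgue_integral_eq_integral[OF int[OF b]]
    show "\<bar>\<Sum>(t, K)\<in>q. measure lebesgue K * f b t - integral K (f b)\<bar> \<le> e"
      using less[OF b] i(2) by (intro perron_Saks_Henstock[OF \<open>\<delta> \<in> gauges\<close> i(1) \<open>0 < e\<close> _ q]) simp
  qed
qed

text \<open>The points of \<open>F\<close> at which \<delta> exceeds \<open>1 / Suc m\<close>
  exhaust \<open>F\<close>, so for a suitable \<open>m\<close> they fill almost all of a
  neighbourhood \<open>W\<close> of \<open>F\<close> in outer measure. Cells shorter than that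
  threshold and contained in \<open>W\<close> then consist mostly of points that could be tags
  themselves.\<close>

lemma bounded_tags_gauge:
  assumes G: "G = gauges \<or> G = measurable_gauges"
    and int: "\<And>b. b \<in> B \<Longrightarrow> set_integrable lebesgue {0..1} (f b)"
    and ac: "uniformly_absolutely_continuous B f"
    and hk: "uniformly_gauge_integrable G perron_partition B f (\<lambda>b. LINT x:{0..1}|lebesgue. f b x)"
    and F: "F \<subseteq> {0..1}" and bd: "\<And>b t. b \<in> B \<Longrightarrow> t \<in> F \<Longrightarrow> \<bar>f b t\<bar> \<le> N" and "0 \<le> N" and "0 < e"
  shows "\<exists>\<delta>\<in>G. \<forall>b\<in>B. \<forall>p. partial_free_partition p \<longrightarrow> tag_fine \<delta> p \<longrightarrow> (\<forall>t K. (t, K) \<in> p \<longrightarrow> t \<in> F) \<longrightarrow>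
      \<bar>\<Sum>(t, K)\<in>p. measure lebesgue K * f b t - (LINT x:K|lebesgue. f b x)\<bar> \<le> e"
proof -
  \<comment> \<open>The constants make each of the four error terms \<open>\<kappa>\<close>,
    \<open>2 * N * (20 * e' / \<kappa>)\<close>, \<open>N * \<theta>\<close> and the one from
    absolute continuity at most \<open>e/4\<close>; \<open>N + 1\<close> avoids division by
    0.\<close>
  define \<kappa> where "\<kappa> = e / 4"
  define e' where "e' = e * \<kappa> / (160 * (N + 1))"
  have pos: "0 < \<kappa>" "0 < e'"
    using \<open>0 < e\<close> \<open>0 \<le> N\<close> by (auto simp: \<kappa>_def e'_def)
  obtain \<delta> where \<delta>: "\<delta> \<in> G" and SH: "\<And>b q. b \<in> B \<Longrightarrow> q tagged_partial_division_of {0..1} \<Longrightarrow> tag_fine \<delta> q \<Longrightarrow>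
      \<bar>\<Sum>(t, K)\<in>q. measure lebesgue K * f b t - integral K (f b)\<bar> \<le> e'"
    using uniform_Saks_Henstock[OF G int hk pos(2)] by blast
  have \<delta>_pos: "0 < \<delta> t" if "t \<in> {0..1}" for t
    using \<delta> G that by (auto simp: measurable_gauges_def gauges_def)
  obtain \<eta> where "0 < \<eta>" and \<eta>: "\<And>b A. b \<in> B \<Longrightarrow> A \<in> sets lebesgue \<Longrightarrow> A \<subseteq> {0..1} \<Longrightarrow> measure lebesgue A < \<eta> \<Longrightarrow>
      \<bar>LINT x:A|lebesgue. f b x\<bar> \<le> e/4"
    using ac[unfolded uniformly_absolutely_continuous_def, rule_format, of "e/4"] \<open>0 < e\<close> by auto
  define \<theta> where "\<theta> = min (\<eta>/2) (e / (4 * (N + 1)))"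
  have "0 < \<theta>" "\<theta> < \<eta>"
    using \<open>0 < \<eta>\<close> \<open>0 < e\<close> \<open>0 \<le> N\<close> by (auto simp: \<theta>_def)
  define E where "E m = {t \<in> F. 1 / real (Suc m) < \<delta> t}" for m
  have "incseq E"
  proof (rule monoI)
    fix m n :: nat assume "m \<le> n"
    then have "1 / real (Suc n) \<le> 1 / real (Suc m)"
      by (intro divide_left_mono) auto
    then show "E m \<subseteq> E n"
      by (auto simp: E_def)
  qed
  have "E m \<subseteq> {0..1}" for m
    using F by (auto simp: E_def)
  have UE: "(\<Union>m. E m) = F"
  proof
    show "F \<subseteq> (\<Union>m. E m)"
    proof
      fix t assume "t \<in> F"
      then have "0 < \<delta> t"
        using \<delta>_pos F by blast
      then obtain m where "inverse (real (Suc m)) < \<delta> t"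
        using reals_Archimedean by blast
      then show "t \<in> (\<Union>m. E m)"
        using \<open>t \<in> F\<close> by (auto simp: E_def inverse_eq_divide)
    qed
  qed (auto simp: E_def)
  obtain m W H where W: "open W" "(\<Union>n. E n) \<subseteq> W" "W \<in> lmeasurable" "H \<subseteq> W"
      and env: "measurable_envelope lebesgue (E m) H" and small: "measure lebesgue (W - H) < \<theta>"
    by (rule open_and_envelope_approximation[OF \<open>incseq E\<close> \<open>\<And>m. E m \<subseteq> {0..1}\<close> \<open>0 < \<theta>\<close>])
  \<comment> \<open>The point 2 ensures that \<open>C\<close> is nonempty, as the distance to the
    empty set is 0 by convention; lying outside [0,1], it is neither a tag nor a point of a
    cell.\<close>
  define C where "C = insert 2 (- W)"
  have C: "closed C" "C \<noteq> {}"
    using W(1) by (auto simp: C_def intro!: closed_insert)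
  \<comment> \<open>The three parts keep a point \<open>x\<close> of the cell within \<delta> of its
    tag, within the threshold that defines \<open>E m\<close>, and inside \<open>W\<close>.\<close>
  define \<rho> where "\<rho> t = min (min (\<delta> t) (1 / real (Suc m))) (if t \<in> C then 1 else infdist t C)" for t
  show ?thesis
  proof (intro bexI ballI allI impI)
    show "\<rho> \<in> G"
      unfolding \<rho>_def[abs_def]
      by (intro gauge_class_min[OF G] gauge_class_const[OF G] gauge_class_infdist[OF G C] \<delta>) simp
    fix b p assume b: "b \<in> B" and p: "partial_free_partition p" "tag_fine \<rho> p"
      and tag: "\<forall>t K. (t, K) \<in> p \<longrightarrow> t \<in> F"
    have "\<bar>\<Sum>(t, K)\<in>p. measure lebesgue K * f b t - (LINT x:K|lebesgue. f b x)\<bar> \<le>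
        \<kappa> + 2 * N * (20 * e' / \<kappa>) + N * \<theta> + e/4"
    proof (rule bounded_tags_estimate[where F=F and E="E m" and H=H and W=W and c="1 / real (Suc m)"
          and \<delta>=\<delta>, OF int[OF b] SH[OF b]])
      show "\<bar>LINT x:A|lebesgue. f b x\<bar> \<le> e/4"
        if "A \<in> sets lebesgue" "A \<subseteq> {0..1}" "measure lebesgue A \<le> \<theta>" for A
        using \<eta>[OF b that(1,2)] that(3) \<open>\<theta> < \<eta>\<close> by linarith
      fix t K x assume tK: "(t, K) \<in> p" and xK: "x \<in> K"
      have "x \<in> {t - \<rho> t<..<t + \<rho> t}"
        using fineD[OF p(2) tK] xK by blast
      then have tx: "\<bar>t - x\<bar> < \<rho> t"
        by auto
      have "t \<in> F"
        using tag tK by blast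
      then have "t \<notin> C"
        using W(2) F UE by (auto simp: C_def)
      have "x \<notin> C"
      proof
        assume "x \<in> C"
        then have "infdist t C \<le> \<bar>t - x\<bar>"
          using infdist_le[of x C t] by (simp add: dist_real_def)
        then show False
          using tx \<open>t \<notin> C\<close> by (simp add: \<rho>_def)
      qed
      then show "x \<in> W \<and> \<bar>t - x\<bar> < \<delta> t \<and> \<bar>t - x\<bar> < 1 / real (Suc m)"
        using tx by (simp add: \<rho>_def C_def)
    qed (use pos bd[OF b] \<open>0 \<le> N\<close> env W small p tag F in \<open>auto simp: E_def\<close>)
    also have "\<dots> \<le> e"
    proof -
      have "20 * e' / \<kappa> = e / (8 * (N + 1))"
        using pos \<open>0 \<le> N\<close> by (simp add: e'_def divide_simps)
      moreover have "2 * N * (e / (8 * (N + 1))) = (N / (N + 1)) * (e/4)"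
        using \<open>0 \<le> N\<close> by (simp add: divide_simps)
      ultimately have "2 * N * (20 * e' / \<kappa>) = (N / (N + 1)) * (e/4)"
        by (simp only:)
      also have "\<dots> \<le> 1 * (e/4)"
        using \<open>0 < e\<close> \<open>0 \<le> N\<close> by (intro mult_right_mono) auto
      finally have 1: "2 * N * (20 * e' / \<kappa>) \<le> e/4"
        by simp
      have "N * \<theta> \<le> (N + 1) * (e / (4 * (N + 1)))"
        using \<open>0 \<le> N\<close> \<open>0 < \<theta>\<close> by (intro mult_mono) (auto simp: \<theta>_def)
      also have "\<dots> = e/4"
        using \<open>0 \<le> N\<close> by (simp add: divide_simps)
      finally show ?thesis
        using 1 by (simp add: \<kappa>_def)
    qed
    finally show "\<bar>\<Sum>(t, K)\<in>p. measure lebesgue K * f b t - (LINT x:K|lebesgue. f b x)\<bar> \<le> e" .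
  qed
qed

text \<open>Where \<delta> is not too small, \<open>t\<close> may tag an interval of a length
  \<open>l\<close> independent of \<open>t\<close> and \<open>b\<close>. The Saks-Henstock error and
  the integral over that interval are at most 1 each, so
  \<open>\<bar>l * f b t\<bar> \<le> 2\<close>.\<close>

lemma bounded_where_gauge_large:
  assumes int: "\<And>b. b \<in> B \<Longrightarrow> set_integrable lebesgue {0..1} (f b)"
    and ac: "uniformly_absolutely_continuous B f"
    and SH: "\<And>b q. b \<in> B \<Longrightarrow> q tagged_partial_division_of {0..1} \<Longrightarrow> tag_fine \<delta> q \<Longrightarrow>
      \<bar>\<Sum>(t, K)\<in>q. measure lebesgue K * f b t - integral K (f b)\<bar> \<le> 1"
  obtains N where "0 \<le> N" "\<And>b t. b \<in> B \<Longrightarrow> t \<in> {0..1} \<Longrightarrow> 1 / real (Suc m) < \<delta> t \<Longrightarrow> \<bar>f b t\<bar> \<le> N"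
proof -
  obtain \<eta> where "0 < \<eta>" and \<eta>: "\<And>b A. b \<in> B \<Longrightarrow> A \<in> sets lebesgue \<Longrightarrow> A \<subseteq> {0..1} \<Longrightarrow> measure lebesgue A < \<eta> \<Longrightarrow>
      \<bar>LINT x:A|lebesgue. f b x\<bar> \<le> 1"
    using ac[unfolded uniformly_absolutely_continuous_def, rule_format, of 1] by auto
  define l where "l = min (1 / real (Suc m)) (\<eta>/2)"
  have l: "0 < l" "l \<le> 1" "l < \<eta>" "l \<le> 1 / real (Suc m)"
  proof -
    have "1 / real (Suc m) \<le> 1"
      by simp
    then show "l \<le> 1"
      unfolding l_def by linarith
  qed (use \<open>0 < \<eta>\<close> in \<open>auto simp: l_def\<close>)
  show ?thesis
  proof
    show "0 \<le> 2 / l"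
      using l by simp
    fix b t assume b: "b \<in> B" and t: "t \<in> {0..1}" "1 / real (Suc m) < \<delta> t"
    \<comment> \<open>The interval starts at \<open>t\<close> and is shifted to the left when it
      would pass the right end point 1.\<close>
    define a where "a = min t (1 - l)"
    define J where "J = {a..a + l}"
    have J: "J \<subseteq> {0..1}" "t \<in> J" "J \<subseteq> {t - \<delta> t<..<t + \<delta> t}" "J \<in> sets lebesgue" "measure lebesgue J = l"
      using l t by (auto simp: J_def a_def min_def)
    have "J = cbox a (a + l)"
      by (simp add: J_def)
    then have "{(t, J)} tagged_partial_division_of {0..1}"
      using J unfolding tagged_partial_division_of_def by auto
    moreover have "tag_fine \<delta> {(t, J)}"
      using J by (simp add: fine_def)
    ultimately have "\<bar>l * f b t - integral J (f b)\<bar> \<le> 1"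
      using SH[OF b, of "{(t, J)}"] J by simp
    moreover have "\<bar>integral J (f b)\<bar> \<le> 1"
      using \<eta>[OF b J(4,1)] J(5) l set_lebesgue_integral_eq_integral(2)[OF set_integrable_subset[OF int[OF b] J(4,1)]]
      by simp
    ultimately have "\<bar>l * f b t\<bar> \<le> 2"
      by linarith
    then show "\<bar>f b t\<bar> \<le> 2 / l"
      using l by (simp add: abs_mult field_simps)
  qed
qed

lemma integral_free_partition:
  fixes f :: "real \<Rightarrow> real"
  assumes "free_partition p" "set_integrable lebesgue {0..1} f"
  shows "(LINT x:{0..1}|lebesgue. f x) = (\<Sum>(t, K)\<in>p. LINT x:K|lebesgue. f x)"
proof -
  note p = free_imp_partial_free[OF assms(1)]
  have "snd i \<in> sets lebesgue" if "i \<in> p" for i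
    by (rule partial_free_interval[OF p that]) simp
  then show ?thesis
    using integral_partial_free_Union[OF p assms(2), of snd] free_partition_Union[OF assms(1)]
    by (simp add: split_def)
qed

text \<open>
  The sets on which the gauge for the error \<open>1\<close> exceeds \<open>1/(m + 1)\<close> cover \<open>[0,1]\<close>, and \<open>f\<close> is bounded
  on each of them; the gauges belonging to them are glued along a gauge of the same class, so no
  measurability is lost.
\<close>

theorem uniformly_henstock_imp_mcshane:
  assumes G: "G = gauges \<or> G = measurable_gauges"
    and int: "\<And>b. b \<in> B \<Longrightarrow> set_integrable lebesgue {0..1} (f b)"
    and ac: "uniformly_absolutely_continuous B f"
    and hk: "uniformly_gauge_integrable G perron_partition B f (\<lambda>b. LINT x:{0..1}|lebesgue. f b x)"
  shows "uniformly_gauge_integrable G free_partition B f (\<lambda>b. LINT x:{0..1}|lebesgue. f b x)"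
  unfolding uniformly_gauge_integrable_def
proof (intro allI impI)
  fix e :: real assume "0 < e"
  obtain \<rho> where \<rho>: "\<rho> \<in> G" and SH: "\<And>b q. b \<in> B \<Longrightarrow> q tagged_partial_division_of {0..1} \<Longrightarrow> tag_fine \<rho> q \<Longrightarrow>
      \<bar>\<Sum>(t, K)\<in>q. measure lebesgue K * f b t - integral K (f b)\<bar> \<le> 1"
    using uniform_Saks_Henstock[OF G int hk zero_less_one] by blast
  have \<rho>_pos: "0 < \<rho> t" if "t \<in> {0..1}" for t
    using \<rho> G that by (auto simp: measurable_gauges_def gauges_def)
  define F where "F m = {t \<in> {0..1}. 1 / real (Suc m) < \<rho> t}" for m
  \<comment> \<open>Rounding down gives \<open>1 / \<rho> t < k t + 1\<close>, which is membership
    in \<open>F (k t)\<close>; this rule is measurable in \<open>t\<close> if \<rho> is.\<close>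
  define k where "k t = nat \<lfloor>1 / \<rho> t\<rfloor>" for t
  have kF: "t \<in> F (k t)" if "t \<in> {0..1}" for t
  proof -
    have "1 / \<rho> t < real (Suc (k t))"
      unfolding k_def using \<rho>_pos[OF that] by linarith
    then show ?thesis
      using \<rho>_pos[OF that] that by (simp add: F_def field_simps)
  qed
  \<comment> \<open>The bound \<open>N\<close>, and with it the gauge, depends on the layer
    \<open>m\<close>. The layers share an error budget whose sum over all \<open>m\<close> is
    \<open>e/2\<close>.\<close>
  have "\<exists>\<delta>. \<delta> \<in> G \<and> (\<forall>b\<in>B. \<forall>p. partial_free_partition p \<longrightarrow> tag_fine \<delta> p \<longrightarrow> (\<forall>t K. (t, K) \<in> p \<longrightarrow> t \<in> F m) \<longrightarrow>
      \<bar>\<Sum>(t, K)\<in>p. measure lebesgue K * f b t - (LINT x:K|lebesgue. f b x)\<bar> \<le> (e/4) * (1/2) ^ m)" for m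
  proof -
    obtain N where N: "0 \<le> N" "\<And>b t. b \<in> B \<Longrightarrow> t \<in> F m \<Longrightarrow> \<bar>f b t\<bar> \<le> N"
      by (rule bounded_where_gauge_large[OF int ac SH, where m=m]) (auto simp: F_def)
    have Fm: "F m \<subseteq> {0..1}" and pos: "0 < (e/4) * (1/2) ^ m"
      using \<open>0 < e\<close> by (auto simp: F_def)
    show ?thesis
      using bounded_tags_gauge[OF G int ac hk Fm N(2,1) pos] by blast
  qed
  then have "\<exists>\<delta>. \<forall>m. \<delta> m \<in> G \<and> (\<forall>b\<in>B. \<forall>p. partial_free_partition p \<longrightarrow> tag_fine (\<delta> m) p \<longrightarrow> (\<forall>t K. (t, K) \<in> p \<longrightarrow> t \<in> F m) \<longrightarrow>
      \<bar>\<Sum>(t, K)\<in>p. measure lebesgue K * f b t - (LINT x:K|lebesgue. f b x)\<bar> \<le> (e/4) * (1/2) ^ m)"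
    by (intro choice allI)
  then obtain \<delta> where \<delta>: "\<And>m. \<delta> m \<in> G" and est: "\<And>m b p. b \<in> B \<Longrightarrow> partial_free_partition p \<Longrightarrow> tag_fine (\<delta> m) p \<Longrightarrow>
      (\<And>t K. (t, K) \<in> p \<Longrightarrow> t \<in> F m) \<Longrightarrow>
      \<bar>\<Sum>(t, K)\<in>p. measure lebesgue K * f b t - (LINT x:K|lebesgue. f b x)\<bar> \<le> (e/4) * (1/2) ^ m"
    by blast
  show "\<exists>\<delta>\<in>G. \<forall>b\<in>B. \<forall>p. free_partition p \<longrightarrow> tag_fine \<delta> p \<longrightarrow>
      \<bar>(\<Sum>(t, K)\<in>p. measure lebesgue K * f b t) - (LINT x:{0..1}|lebesgue. f b x)\<bar> < e"
  proof (intro bexI ballI allI impI)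
    show "(\<lambda>t. \<delta> (k t) t) \<in> G"
      unfolding k_def by (rule gauge_class_glue[OF G \<rho> \<delta>])
    fix b p assume b: "b \<in> B" and p: "free_partition p" "tag_fine (\<lambda>t. \<delta> (k t) t) p"
    note pp = free_imp_partial_free[OF p(1)]
    have fin: "finite p"
      using pp by (simp add: partial_free_partition_def)
    define \<Delta> where "\<Delta> i = measure lebesgue (snd i) * f b (fst i) - (LINT x:snd i|lebesgue. f b x)" for i
    define q where "q m = {i \<in> p. k (fst i) = m}" for m
    define M where "M = (\<lambda>i. k (fst i)) ` p"
    have "finite M"
      using fin by (simp add: M_def)
    have q_est: "\<bar>\<Sum>i\<in>q m. \<Delta> i\<bar> \<le> (e/4) * (1/2) ^ m" for m
    proof -
      have "tag_fine (\<delta> m) (q m)"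
      proof (rule fineI)
        fix t K assume "(t, K) \<in> q m"
        then show "K \<subseteq> {t - \<delta> m t<..<t + \<delta> m t}"
          using fineD[OF p(2), of t K] by (simp add: q_def)
      qed
      moreover have "t \<in> F m" if "(t, K) \<in> q m" for t K
        using that kF[of t] pp by (auto simp: q_def partial_free_partition_def)
      moreover have "partial_free_partition (q m)"
        using pp by (rule partial_free_subset) (auto simp: q_def)
      ultimately show ?thesis
        using est[OF b, of "q m" m] by (simp add: \<Delta>_def split_def)
    qed
    have "(\<Sum>(t, K)\<in>p. measure lebesgue K * f b t) - (LINT x:{0..1}|lebesgue. f b x) = (\<Sum>i\<in>p. \<Delta> i)"
      unfolding integral_free_partition[OF p(1) int[OF b]] by (simp add: \<Delta>_def sum_subtractf split_def)
    also have "\<dots> = (\<Sum>m\<in>M. \<Sum>i\<in>q m. \<Delta> i)"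
      unfolding q_def by (rule sum.group[symmetric]) (use fin \<open>finite M\<close> in \<open>auto simp: M_def\<close>)
    also have "\<bar>\<dots>\<bar> \<le> (\<Sum>m\<in>M. (e/4) * (1/2) ^ m)"
      by (rule order_trans[OF sum_abs sum_mono]) (rule q_est)
    also have "\<dots> = (e/4) * (\<Sum>m\<in>M. (1/2) ^ m)"
      by (simp add: sum_distrib_left)
    also have "\<dots> \<le> (e/4) * (\<Sum>m. (1/2) ^ m)"
      using \<open>finite M\<close> \<open>0 < e\<close> by (intro mult_left_mono sum_le_suminf) (auto simp: summable_geometric)
    also have "\<dots> < e"
      using \<open>0 < e\<close> by (simp add: suminf_geometric)
    finally show "\<bar>(\<Sum>(t, K)\<in>p. measure lebesgue K * f b t) - (LINT x:{0..1}|lebesgue. f b x)\<bar> < e" .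
  qed
qed

section \<open>McShane integrable multifunctions\<close>

text \<open>The selector \<open>c\<close> decides for each pair which of the two tags its
  intersection inherits; fineness holds either way, as the intersection lies in both cells. Empty
  intersections are not cells and return as zero terms of the double sum.\<close>

lemma common_refinement_free_partition:
  fixes c :: "real \<times> real set \<Rightarrow> real \<times> real set \<Rightarrow> bool" and f :: "real \<Rightarrow> real"
  assumes p: "free_partition p" "tag_fine \<delta> p" and q: "free_partition q" "tag_fine \<delta> q"
  defines "r \<equiv> (\<lambda>(i, j). (if c i j then fst i else fst j, snd i \<inter> snd j)) `
    {(i, j). i \<in> p \<and> j \<in> q \<and> snd i \<inter> snd j \<noteq> {}}"
  shows "free_partition r" "tag_fine \<delta> r"
    "(\<Sum>(t, K)\<in>r. measure lebesgue K * f t) =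
      (\<Sum>i\<in>p. \<Sum>j\<in>q. measure lebesgue (snd i \<inter> snd j) * f (if c i j then fst i else fst j))"
proof -
  let ?P = "{(i, j). i \<in> p \<and> j \<in> q \<and> snd i \<inter> snd j \<noteq> {}}"
  let ?h = "\<lambda>(i, j). (if c i j then fst i else fst j, snd i \<inter> snd j)"
  note pp = free_imp_partial_free[OF p(1)] and qq = free_imp_partial_free[OF q(1)]
  have fin: "finite p" "finite q"
    using pp qq by (auto simp: partial_free_partition_def)
  have P_sub: "?P \<subseteq> p \<times> q"
    by auto
  then have finP: "finite ?P"
    by (rule finite_subset) (use fin in simp)
  have cell: "fst i \<in> {0..1} \<and> fst j \<in> {0..1} \<and> snd i \<inter> snd j \<subseteq> {0..1} \<and> (\<exists>a b. a \<le> b \<and> snd i \<inter> snd j = {a..b})"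
    if ij: "(i, j) \<in> ?P" for i j
  proof -
    have i: "i \<in> p" and j: "j \<in> q" and ne: "snd i \<inter> snd j \<noteq> {}"
      using ij by auto
    obtain a b where ab: "snd i = {a..b}" "snd i \<subseteq> {0..1}"
      by (rule partial_free_interval[OF pp i])
    obtain c d where cd: "snd j = {c..d}"
      by (rule partial_free_interval[OF qq j])
    have "snd i \<inter> snd j = {max a c..min b d}"
      by (simp add: ab cd)
    moreover have "max a c \<le> min b d"
      using ne unfolding calculation by simp
    moreover have "fst i \<in> {0..1}" "fst j \<in> {0..1}"
      using partial_free_tag[OF pp i] partial_free_tag[OF qq j] .
    ultimately show ?thesis
      using ab(2) by blast
  qed
  have overlap: "finite (snd (?h u) \<inter> snd (?h v))"
    and disj: "interior (snd (?h u)) \<inter> interior (snd (?h v)) = {}"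
    if uv: "u \<in> ?P" "v \<in> ?P" "u \<noteq> v" for u v
  proof -
    obtain i j i' j' where [simp]: "u = (i, j)" "v = (i', j')"
      by (cases u, cases v)
    have ij: "i \<in> p" "j \<in> q" "i' \<in> p" "j' \<in> q" "i \<noteq> i' \<or> j \<noteq> j'"
      using uv by auto
    have "finite (snd i \<inter> snd i') \<or> finite (snd j \<inter> snd j')"
      using ij partial_free_Int_null[OF pp] partial_free_Int_null[OF qq] by blast
    then show "finite (snd (?h u) \<inter> snd (?h v))"
      by (auto elim!: finite_subset[rotated])
    have "interior (snd i) \<inter> interior (snd i') = {} \<or> interior (snd j) \<inter> interior (snd j') = {}"
      using ij partial_free_interior_disjoint[OF pp] partial_free_interior_disjoint[OF qq] by blast
    then show "interior (snd (?h u)) \<inter> interior (snd (?h v)) = {}"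
      by auto
  qed
  show "free_partition r"
    unfolding free_partition_def
  proof (intro conjI allI impI)
    show "finite r"
      using finP by (simp add: r_def)
    fix t K assume "(t, K) \<in> r"
    then obtain u where u: "(t, K) = ?h u" "u \<in> ?P"
      unfolding r_def by (rule imageE)
    obtain i j where "u = (i, j)"
      by (cases u)
    with u have ij: "(i, j) \<in> ?P" "t = (if c i j then fst i else fst j)" "K = snd i \<inter> snd j"
      by simp_all
    show "t \<in> {0..1}" "K \<subseteq> {0..1}" "\<exists>a b. a \<le> b \<and> K = {a..b}"
      using cell[OF ij(1)] unfolding ij(2,3) by (simp_all split: if_splits)
  next
    fix t1 K1 t2 K2 assume *: "(t1, K1) \<in> r \<and> (t2, K2) \<in> r \<and> (t1, K1) \<noteq> (t2, K2)"
    obtain u where u: "(t1, K1) = ?h u" "u \<in> ?P"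
      using conjunct1[OF *] unfolding r_def by (rule imageE)
    obtain v where v: "(t2, K2) = ?h v" "v \<in> ?P"
      using conjunct1[OF conjunct2[OF *]] unfolding r_def by (rule imageE)
    have "u \<noteq> v"
      using * u(1) v(1) by metis
    then show "interior K1 \<inter> interior K2 = {}"
      using disj[OF u(2) v(2)] u(1) v(1) by (metis snd_conv)
  next
    have "(\<Union>i\<in>r. snd i) = (\<Union>u\<in>?P. snd (?h u))"
      by (simp only: r_def image_image)
    moreover have "(\<Union>u\<in>?P. snd (?h u)) = {0..1}"
    proof
      show "(\<Union>u\<in>?P. snd (?h u)) \<subseteq> {0..1}"
      proof (rule UN_least)
        fix u assume u: "u \<in> ?P"
        obtain i j where "u = (i, j)"
          by (cases u)
        then show "snd (?h u) \<subseteq> {0..1}"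
          using cell[of i j] u by simp
      qed
      show "{0..1} \<subseteq> (\<Union>u\<in>?P. snd (?h u))"
      proof
        fix x :: real assume "x \<in> {0..1}"
        then have "x \<in> (\<Union>i\<in>p. snd i)" "x \<in> (\<Union>j\<in>q. snd j)"
          using free_partition_Union[OF p(1)] free_partition_Union[OF q(1)] by simp_all
        then obtain i j where "i \<in> p" "j \<in> q" "x \<in> snd i" "x \<in> snd j"
          by blast
        then have "(i, j) \<in> ?P" "x \<in> snd (?h (i, j))"
          by auto
        then show "x \<in> (\<Union>u\<in>?P. snd (?h u))"
          by (rule UN_I)
      qed
    qed
    ultimately show "\<Union>{K. \<exists>t. (t, K) \<in> r} = {0..1}"
      unfolding Union_cells by simp
  qed
  show "tag_fine \<delta> r"
  proof (rule fineI)
    fix t K assume "(t, K) \<in> r"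
    then obtain u where u: "(t, K) = ?h u" "u \<in> ?P"
      unfolding r_def by (rule imageE)
    obtain i j where "u = (i, j)"
      by (cases u)
    with u have ij: "(i, j) \<in> ?P" "t = (if c i j then fst i else fst j)" "K = snd i \<inter> snd j"
      by simp_all
    then have ij: "i \<in> p" "j \<in> q" "t = fst i \<or> t = fst j" "K = snd i \<inter> snd j"
      by simp_all
    have "snd i \<subseteq> {fst i - \<delta> (fst i)<..<fst i + \<delta> (fst i)}" "snd j \<subseteq> {fst j - \<delta> (fst j)<..<fst j + \<delta> (fst j)}"
      using fineD[OF p(2), of "fst i" "snd i"] fineD[OF q(2), of "fst j" "snd j"] ij by auto
    then show "K \<subseteq> {t - \<delta> t<..<t + \<delta> t}"
      using ij(3,4) by auto
  qed
  have "(\<Sum>(t, K)\<in>r. measure lebesgue K * f t) = (\<Sum>u\<in>?P. (\<lambda>(t, K). measure lebesgue K * f t) (?h u))"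
    unfolding r_def
  \<comment> \<open>Different pairs may yield the same tagged cell, but then this cell is the
    overlap of two distinct intersections, hence finite and of measure 0.\<close>
  proof (rule sum.reindex_nontrivial[OF finP, unfolded comp_def])
    fix u v assume uv: "u \<in> ?P" "v \<in> ?P" "u \<noteq> v" "?h u = ?h v"
    then have "finite (snd (?h u))"
      using overlap[of u v] by simp
    then have "measure lebesgue (snd (?h u)) = 0"
      by (intro negligible_imp_measure0 negligible_finite)
    then show "(case ?h u of (t, K) \<Rightarrow> measure lebesgue K * f t) = 0"
      by (simp add: split_def)
  qed
  also have "\<dots> = (\<Sum>(i, j)\<in>?P. measure lebesgue (snd i \<inter> snd j) * f (if c i j then fst i else fst j))"
    by (intro sum.cong) auto
  also have "\<dots> = (\<Sum>(i, j)\<in>p \<times> q. measure lebesgue (snd i \<inter> snd j) * f (if c i j then fst i else fst j))"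
    using fin P_sub by (intro sum.mono_neutral_left) auto
  also have "\<dots> = (\<Sum>i\<in>p. \<Sum>j\<in>q. measure lebesgue (snd i \<inter> snd j) * f (if c i j then fst i else fst j))"
    by (rule sum.cartesian_product[symmetric])
  finally show "(\<Sum>(t, K)\<in>r. measure lebesgue K * f t) =
      (\<Sum>i\<in>p. \<Sum>j\<in>q. measure lebesgue (snd i \<inter> snd j) * f (if c i j then fst i else fst j))" .
qed

text \<open>
  Since tags are free, the cells of a common refinement may carry the tag of either partition, chosen
  independently.
\<close>

lemma free_partition_tag_exchange:
  assumes I: "\<And>p. free_partition p \<Longrightarrow> tag_fine \<delta> p \<Longrightarrow> \<bar>(\<Sum>(t, K)\<in>p. measure lebesgue K * f t) - I\<bar> < e"
    and p: "free_partition p" "tag_fine \<delta> p" and q: "free_partition q" "tag_fine \<delta> q"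
  shows "\<bar>\<Sum>i\<in>p. \<Sum>j\<in>q. if c i j then measure lebesgue (snd i \<inter> snd j) * (f (fst i) - f (fst j)) else 0\<bar> \<le> 2 * e"
proof -
  let ?S = "\<lambda>c. \<Sum>i\<in>p. \<Sum>j\<in>q. measure lebesgue (snd i \<inter> snd j) * f (if c i j then fst i else fst j)"
  have "\<bar>?S c - I\<bar> < e" for c
    using I[OF common_refinement_free_partition(1,2)[OF p q, where c=c]]
    unfolding common_refinement_free_partition(3)[OF p q, where c=c and f=f] .
  from this[of c] this[of "\<lambda>i j. False"] have "\<bar>?S c - ?S (\<lambda>i j. False)\<bar> \<le> 2 * e"
    by linarith
  also have "?S c - ?S (\<lambda>i j. False) =
      (\<Sum>i\<in>p. \<Sum>j\<in>q. if c i j then measure lebesgue (snd i \<inter> snd j) * (f (fst i) - f (fst j)) else 0)"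
    unfolding sum_subtractf[symmetric] by (intro sum.cong) (auto simp: algebra_simps)
  finally show ?thesis .
qed

section \<open>Double sums over common refinements\<close>

lemma measure_Int_free_partition:
  assumes p: "free_partition p" and X: "X \<in> sets lebesgue" "X \<subseteq> {0..1}"
  shows "(\<Sum>i\<in>p. measure lebesgue (X \<inter> snd i)) = measure lebesgue X"
proof -
  note pp = free_imp_partial_free[OF p]
  have "(\<Union>i\<in>p. X \<inter> snd i) = X"
    using X(2) free_partition_Union[OF p] by blast
  moreover have "snd i \<in> sets lebesgue" if "i \<in> p" for i
    by (rule partial_free_interval[OF pp that]) simp
  ultimately show ?thesis
    using measure_partial_free_Union[OF pp, of "\<lambda>i. X \<inter> snd i"] X(1) by auto
qed

lemma free_partition_cell:
  assumes "free_partition p" "i \<in> p"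
  shows "snd i \<in> sets lebesgue" "snd i \<subseteq> {0..1}" "fst i \<in> {0..1}"
proof -
  note pp = free_imp_partial_free[OF assms(1)]
  obtain a b where "snd i = {a..b}" "snd i \<subseteq> {0..1}"
    by (rule partial_free_interval[OF pp assms(2)])
  then show "snd i \<in> sets lebesgue" "snd i \<subseteq> {0..1}"
    by auto
  show "fst i \<in> {0..1}"
    using pp assms(2) by (rule partial_free_tag)
qed

lemma double_sum_left:
  assumes "free_partition p" "free_partition q"
  shows "(\<Sum>i\<in>p. \<Sum>j\<in>q. measure lebesgue (snd i \<inter> snd j) * g i) = (\<Sum>i\<in>p. measure lebesgue (snd i) * g i)"
  using measure_Int_free_partition[OF assms(2)] free_partition_cell[OF assms(1)]
  by (intro sum.cong) (auto simp: sum_distrib_right[symmetric])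

lemma double_sum_right:
  assumes "free_partition p" "free_partition q"
  shows "(\<Sum>i\<in>p. \<Sum>j\<in>q. measure lebesgue (snd i \<inter> snd j) * g j) = (\<Sum>j\<in>q. measure lebesgue (snd j) * g j)"
  using double_sum_left[OF assms(2,1), of g] by (subst sum.swap) (simp add: Int_commute)

text \<open>Exchanging tags only on the pairs with \<open>f (fst j) \<le> f (fst i)\<close>, and
  then only on the others, bounds the positive and the negative part of the differences by
  \<open>2 * e\<close> each. The reverse triangle inequality passes to absolute values.\<close>

lemma free_partition_abs_difference:
  assumes I: "\<And>p. free_partition p \<Longrightarrow> tag_fine \<delta> p \<Longrightarrow> \<bar>(\<Sum>(t, K)\<in>p. measure lebesgue K * f t) - I\<bar> < e"
    and p: "free_partition p" "tag_fine \<delta> p" and q: "free_partition q" "tag_fine \<delta> q"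
  shows "\<bar>(\<Sum>(t, K)\<in>p. measure lebesgue K * \<bar>f t\<bar>) - (\<Sum>(t, K)\<in>q. measure lebesgue K * \<bar>f t\<bar>)\<bar> \<le> 4 * e"
proof -
  let ?m = "\<lambda>i j. measure lebesgue (snd i \<inter> snd j)"
  have "(\<Sum>i\<in>p. \<Sum>j\<in>q. ?m i j * \<bar>f (fst i) - f (fst j)\<bar>) =
      (\<Sum>i\<in>p. \<Sum>j\<in>q. (if f (fst j) \<le> f (fst i) then ?m i j * (f (fst i) - f (fst j)) else 0) -
        (if \<not> f (fst j) \<le> f (fst i) then ?m i j * (f (fst i) - f (fst j)) else 0))"
    by (intro sum.cong) (auto simp: abs_if algebra_simps)
  also have "\<dots> \<le> 4 * e"
    using free_partition_tag_exchange[where f=f and I=I and e=e and \<delta>=\<delta>, OF I p q, of "\<lambda>i j. f (fst j) \<le> f (fst i)"]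
      free_partition_tag_exchange[where f=f and I=I and e=e and \<delta>=\<delta>, OF I p q, of "\<lambda>i j. \<not> f (fst j) \<le> f (fst i)"]
    unfolding sum_subtractf by linarith
  finally have le: "(\<Sum>i\<in>p. \<Sum>j\<in>q. ?m i j * \<bar>f (fst i) - f (fst j)\<bar>) \<le> 4 * e" .
  have "(\<Sum>(t, K)\<in>p. measure lebesgue K * \<bar>f t\<bar>) - (\<Sum>(t, K)\<in>q. measure lebesgue K * \<bar>f t\<bar>) =
      (\<Sum>i\<in>p. \<Sum>j\<in>q. ?m i j * (\<bar>f (fst i)\<bar> - \<bar>f (fst j)\<bar>))"
    using double_sum_left[OF p(1) q(1), of "\<lambda>i. \<bar>f (fst i)\<bar>"] double_sum_right[OF p(1) q(1), of "\<lambda>i. \<bar>f (fst i)\<bar>"]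
    by (simp add: split_def right_diff_distrib sum_subtractf)
  also have "\<bar>\<dots>\<bar> \<le> (\<Sum>i\<in>p. \<Sum>j\<in>q. ?m i j * \<bar>f (fst i) - f (fst j)\<bar>)"
  proof (rule order_trans[OF sum_abs sum_mono])
    fix i
    show "\<bar>\<Sum>j\<in>q. ?m i j * (\<bar>f (fst i)\<bar> - \<bar>f (fst j)\<bar>)\<bar> \<le> (\<Sum>j\<in>q. ?m i j * \<bar>f (fst i) - f (fst j)\<bar>)"
      by (intro order_trans[OF sum_abs] sum_mono) (auto simp: abs_mult intro!: mult_left_mono)
  qed
  finally show ?thesis
    using le by linarith
qed

text \<open>Perron partitions are free, so the Cauchy criterion of the Henstock-Kurzweil integral is
  available for both \<open>f b\<close> and its absolute value; together these give Lebesgue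
  integrability.\<close>

lemma uniformly_mcshane_absolutely_integrable:
  assumes int: "uniformly_gauge_integrable gauges free_partition B f I" and b: "b \<in> B"
  shows "set_integrable lebesgue {0..1} (f b)"
proof -
  have \<delta>: "\<exists>\<delta>\<in>gauges. \<forall>p. free_partition p \<longrightarrow> tag_fine \<delta> p \<longrightarrow> \<bar>(\<Sum>(t, K)\<in>p. measure lebesgue K * f b t) - I b\<bar> < e"
    if "0 < e" for e
    using int that b unfolding uniformly_gauge_integrable_def by meson
  \<comment> \<open>Stated for any \<open>g\<close> controlled by the sums of \<open>f b\<close>
    with factor 4, so that \<open>g\<close> may be \<open>f b\<close> or its absolute value.\<close>
  have cauchy: "g integrable_on {0..1}"
    if g: "\<And>e \<delta> p q. 0 < e \<Longrightarrow>
        (\<And>p. free_partition p \<Longrightarrow> tag_fine \<delta> p \<Longrightarrow> \<bar>(\<Sum>(t, K)\<in>p. measure lebesgue K * f b t) - I b\<bar> < e) \<Longrightarrow>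
        free_partition p \<Longrightarrow> tag_fine \<delta> p \<Longrightarrow> free_partition q \<Longrightarrow> tag_fine \<delta> q \<Longrightarrow>
        \<bar>(\<Sum>(t, K)\<in>p. measure lebesgue K * g t) - (\<Sum>(t, K)\<in>q. measure lebesgue K * g t)\<bar> \<le> 4 * e"
    for g :: "real \<Rightarrow> real"
  proof -
    have "g integrable_on cbox 0 1"
      unfolding integrable_Cauchy
    proof (intro allI impI)
      fix e :: real assume "0 < e"
      then obtain \<delta> where "\<delta> \<in> gauges"
        and D: "\<And>p. free_partition p \<Longrightarrow> tag_fine \<delta> p \<Longrightarrow> \<bar>(\<Sum>(t, K)\<in>p. measure lebesgue K * f b t) - I b\<bar> < e/8"
        using \<delta>[of "e/8"] by auto
      show "\<exists>\<gamma>. gauge \<gamma> \<and> (\<forall>p q. p tagged_division_of cbox 0 1 \<and> \<gamma> fine p \<and>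
            q tagged_division_of cbox 0 1 \<and> \<gamma> fine q \<longrightarrow>
            norm ((\<Sum>(x, K)\<in>p. measure lborel K *\<^sub>R g x) - (\<Sum>(x, K)\<in>q. measure lborel K *\<^sub>R g x)) < e)"
      proof (intro exI conjI allI impI)
        show "gauge (tag_gauge \<delta>)"
          using \<open>\<delta> \<in> gauges\<close> by (rule gauge_tag_gauge)
        fix p q assume "p tagged_division_of cbox 0 (1::real) \<and> tag_gauge \<delta> fine p \<and>
            q tagged_division_of cbox 0 (1::real) \<and> tag_gauge \<delta> fine q"
        then have pq: "p tagged_division_of {0..1}" "tag_gauge \<delta> fine p" "q tagged_division_of {0..1}" "tag_gauge \<delta> fine q"
          by auto
        have "\<bar>(\<Sum>(t, K)\<in>p. measure lebesgue K * g t) - (\<Sum>(t, K)\<in>q. measure lebesgue K * g t)\<bar> \<le> 4 * (e/8)"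
          using \<open>0 < e\<close> by (intro g[of "e/8" \<delta>] D tag_gauge_fine(1,3)[OF pq(1,2)] tag_gauge_fine(1,3)[OF pq(3,4)]) auto
        then show "norm ((\<Sum>(x, K)\<in>p. measure lborel K *\<^sub>R g x) - (\<Sum>(x, K)\<in>q. measure lborel K *\<^sub>R g x)) < e"
          using \<open>0 < e\<close> by (simp only: sum_lborel_eq_lebesgue[OF pq(1)] sum_lborel_eq_lebesgue[OF pq(3)] real_norm_def)
      qed
    qed
    then show ?thesis
      by simp
  qed
  have "f b integrable_on {0..1}"
  proof (rule cauchy)
    fix e \<delta> p q
    assume "0 < e" and I: "\<And>p. free_partition p \<Longrightarrow> tag_fine \<delta> p \<Longrightarrow> \<bar>(\<Sum>(t, K)\<in>p. measure lebesgue K * f b t) - I b\<bar> < e"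
      and "free_partition p" "tag_fine \<delta> p" "free_partition q" "tag_fine \<delta> q"
    then show "\<bar>(\<Sum>(t, K)\<in>p. measure lebesgue K * f b t) - (\<Sum>(t, K)\<in>q. measure lebesgue K * f b t)\<bar> \<le> 4 * e"
      using I[of p] I[of q] by linarith
  qed
  moreover have "(\<lambda>t. norm (f b t)) integrable_on {0..1}"
    unfolding real_norm_def by (rule cauchy) (rule free_partition_abs_difference)
  ultimately show ?thesis
    by (rule absolutely_integrable_onI)
qed

text \<open>An auxiliary Perron partition \<open>q\<close> decides membership in \<open>A\<close> by
  its tags. Keeping the tags of \<open>p\<close> (\<open>S1\<close>) or of \<open>q\<close>
  (\<open>S2\<close>) on the selected pairs costs \<open>2 * e\<close> by tag exchange.
  \<open>S2\<close> is an ordinary Riemann sum of \<open>f\<close> cut off to \<open>A\<close>, with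
  error \<open>e\<close>, and replacing the weights in \<open>S1\<close> by
  \<open>measure lebesgue (A \<inter> K)\<close> costs another \<open>2 * e\<close>.\<close>

lemma Riemann_sum_over_measurable_set:
  fixes f :: "real \<Rightarrow> real"
  assumes f: "set_integrable lebesgue {0..1} f" and "\<delta> \<in> gauges" "0 < e"
    and I: "\<And>p. free_partition p \<Longrightarrow> tag_fine \<delta> p \<Longrightarrow> \<bar>(\<Sum>(t, K)\<in>p. measure lebesgue K * f t) - I\<bar> < e"
    and p: "free_partition p" "tag_fine \<delta> p"
    and A: "A \<in> sets lebesgue" "A \<subseteq> {0..1}"
  shows "\<bar>(\<Sum>(t, K)\<in>p. measure lebesgue (A \<inter> K) * f t) - (LINT x:A|lebesgue. f x)\<bar> \<le> 5 * e"
proof -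
  let ?A = "indicat_real A"
  have Am: "A \<in> lmeasurable"
    using A by (rule lmeasurable_subset_unit)
  \<comment> \<open>The partition \<open>p\<close> is fixed before \<open>q\<close> is chosen, so
    the accuracy \<zeta> required of \<open>q\<close> may depend on the values of \<open>f\<close>
    at the tags of \<open>p\<close>.\<close>
  define N where "N = (\<Sum>i\<in>p. \<bar>f (fst i)\<bar>)"
  have "0 \<le> N"
    by (simp add: N_def sum_nonneg)
  define \<zeta> where "\<zeta> = e / (N + 1)"
  have "0 < \<zeta>"
    using \<open>0 < e\<close> \<open>0 \<le> N\<close> by (simp add: \<zeta>_def)
  have fA: "set_integrable lebesgue A f"
    using set_integrable_subset[OF f A] .
  have fA_eq: "(\<lambda>x. indicator {0..1} x *\<^sub>R (?A x * f x)) = (\<lambda>x. ?A x *\<^sub>R f x)"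
    using A(2) by (auto simp: fun_eq_iff split: split_indicator)
  have int1: "set_integrable lebesgue {0..1} (\<lambda>x. ?A x * f x)"
    using fA unfolding set_integrable_def fA_eq .
  have "integral {0..1} (\<lambda>x. ?A x * f x) = (LINT x:{0..1}|lebesgue. ?A x * f x)"
    using set_lebesgue_integral_eq_integral(2)[OF int1] by simp
  also have "\<dots> = (LINT x:A|lebesgue. f x)"
    unfolding set_lebesgue_integral_def fA_eq ..
  finally have "((\<lambda>x. ?A x * f x) has_integral (LINT x:A|lebesgue. f x)) (cbox 0 1)"
    using set_lebesgue_integral_eq_integral(1)[OF int1] by (simp add: has_integral_integrable_integral)
  then obtain \<gamma>1 where \<gamma>1: "gauge \<gamma>1" "\<And>q. q tagged_division_of cbox 0 1 \<Longrightarrow> \<gamma>1 fine q \<Longrightarrow>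
      norm ((\<Sum>(x, K)\<in>q. measure lborel K *\<^sub>R (?A x * f x)) - (LINT x:A|lebesgue. f x)) < e"
    unfolding has_integral using \<open>0 < e\<close> by meson
  have iA: "?A integrable_on cbox 0 1"
    using Am by (simp add: integrable_on_indicator A(2) Int_absorb2)
  then obtain \<gamma>2 where \<gamma>2: "gauge \<gamma>2" "\<And>q. q tagged_division_of cbox 0 1 \<Longrightarrow> \<gamma>2 fine q \<Longrightarrow>
      norm ((\<Sum>(x, K)\<in>q. measure lborel K *\<^sub>R ?A x) - integral (cbox 0 1) ?A) < \<zeta>"
    using integrable_integral[OF iA] \<open>0 < \<zeta>\<close> unfolding has_integral by meson
  have "gauge (\<lambda>t. tag_gauge \<delta> t \<inter> (\<gamma>1 t \<inter> \<gamma>2 t))"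
    using gauge_tag_gauge[OF \<open>\<delta> \<in> gauges\<close>] \<gamma>1(1) \<gamma>2(1) by (intro gauge_Int)
  then obtain q where q0: "q tagged_division_of cbox 0 1" "(\<lambda>t. tag_gauge \<delta> t \<inter> (\<gamma>1 t \<inter> \<gamma>2 t)) fine q"
    using fine_division_exists by blast
  then have q: "q tagged_division_of {0..1}" "tag_gauge \<delta> fine q" "\<gamma>1 fine q" "\<gamma>2 fine q"
    by (auto simp: fine_Int)
  note qf = tag_gauge_fine[OF q(1,2)]
  let ?m = "\<lambda>i j. measure lebesgue (snd i \<inter> snd j)"
  have cellp: "snd i \<in> sets lebesgue" "snd i \<subseteq> {0..1}" if "i \<in> p" for i
    using free_partition_cell[OF p(1) that] by blast+
  have cellq: "snd j \<in> sets lebesgue" "snd j \<subseteq> {0..1}" "snd j \<in> lmeasurable" if "j \<in> q" for j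
    using free_partition_cell[OF qf(1) that] lmeasurable_subset_unit by blast+
  have hen: "(\<Sum>j\<in>q. \<bar>measure lebesgue (snd j) * ?A (fst j) - measure lebesgue (A \<inter> snd j)\<bar>) \<le> 2 * \<zeta>"
  proof -
    have "(\<Sum>(x, K)\<in>q. norm (measure lborel K *\<^sub>R ?A x - integral K ?A)) \<le> 2 * real DIM(real) * \<zeta>"
    proof (rule Henstock_lemma_part2[OF iA \<open>0 < \<zeta>\<close> \<gamma>2(1) \<gamma>2(2)])
      show "q tagged_partial_division_of cbox 0 1"
        using q0(1) by (simp add: tagged_division_of_def)
    qed (use q in auto)
    moreover have "measure lebesgue (snd j) * ?A (fst j) - measure lebesgue (A \<inter> snd j) =
        measure lborel (snd j) *\<^sub>R ?A (fst j) - integral (snd j) ?A" if "j \<in> q" for j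
    proof -
      obtain a b where "snd j = cbox a b"
        using tagged_division_ofD(4)[OF q(1), of "fst j" "snd j"] \<open>j \<in> q\<close> by auto
      then have "measure lebesgue (snd j) = measure lborel (snd j)"
        by simp
      moreover have "integral (snd j) ?A = measure lebesgue (A \<inter> snd j)"
        using cellq(1)[OF that] Am by (intro integral_indicator) (auto intro: fmeasurable_Int_fmeasurable)
      ultimately show ?thesis
        by simp
    qed
    ultimately show ?thesis
      by (simp add: split_def)
  qed
  define S1 where "S1 = (\<Sum>i\<in>p. \<Sum>j\<in>q. ?m i j * ?A (fst j) * f (fst i))"
  define S2 where "S2 = (\<Sum>i\<in>p. \<Sum>j\<in>q. ?m i j * (?A (fst j) * f (fst j)))"
  have "S1 - S2 = (\<Sum>i\<in>p. \<Sum>j\<in>q. if fst j \<in> A then ?m i j * (f (fst i) - f (fst j)) else 0)"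
    unfolding S1_def S2_def sum_subtractf[symmetric] by (intro sum.cong) (auto simp: algebra_simps)
  also have "\<bar>\<dots>\<bar> \<le> 2 * e"
    using free_partition_tag_exchange[where f=f and I=I and e=e and \<delta>=\<delta>, OF I p qf(1,3), of "\<lambda>i j. fst j \<in> A"] .
  finally have "\<bar>S1 - S2\<bar> \<le> 2 * e" .
  moreover have "\<bar>S2 - (LINT x:A|lebesgue. f x)\<bar> < e"
  proof -
    have "S2 = (\<Sum>(t, K)\<in>q. measure lebesgue K * (?A t * f t))"
      unfolding S2_def using double_sum_right[OF p(1) qf(1), of "\<lambda>j. ?A (fst j) * f (fst j)"]
      by (simp add: split_def)
    then show ?thesis
      using \<gamma>1(2)[OF q0(1) q(3)] by (simp only: sum_lborel_eq_lebesgue[OF q(1)] real_norm_def)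
  qed
  moreover have "\<bar>S1 - (\<Sum>(t, K)\<in>p. measure lebesgue (A \<inter> K) * f t)\<bar> \<le> 2 * e"
  proof -
    \<comment> \<open>Cutting a cell of \<open>q\<close> down to its part in a cell of
      \<open>p\<close> can only decrease its error: the error is the measure outside
      \<open>A\<close> or inside \<open>A\<close>, according to the tag. Thus one bound for the
      total error of \<open>q\<close> serves every cell of \<open>p\<close>.\<close>
    have row: "\<bar>(\<Sum>j\<in>q. ?m i j * ?A (fst j)) - measure lebesgue (A \<inter> snd i)\<bar> \<le> 2 * \<zeta>" if i: "i \<in> p" for i
    proof -
      have "measure lebesgue (A \<inter> snd i) = (\<Sum>j\<in>q. measure lebesgue (A \<inter> snd i \<inter> snd j))"
        using A cellp[OF i] by (intro measure_Int_free_partition[OF qf(1), symmetric]) auto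
      then have "\<bar>(\<Sum>j\<in>q. ?m i j * ?A (fst j)) - measure lebesgue (A \<inter> snd i)\<bar> \<le>
          (\<Sum>j\<in>q. \<bar>?m i j * ?A (fst j) - measure lebesgue (A \<inter> snd i \<inter> snd j)\<bar>)"
        by (simp add: sum_subtractf[symmetric])
      also have "\<dots> \<le> (\<Sum>j\<in>q. \<bar>measure lebesgue (snd j) * ?A (fst j) - measure lebesgue (A \<inter> snd j)\<bar>)"
      proof (rule sum_mono)
        fix j assume j: "j \<in> q"
        show "\<bar>?m i j * ?A (fst j) - measure lebesgue (A \<inter> snd i \<inter> snd j)\<bar> \<le>
            \<bar>measure lebesgue (snd j) * ?A (fst j) - measure lebesgue (A \<inter> snd j)\<bar>"
        proof (cases "fst j \<in> A")
          case True
          have split: "measure lebesgue X = measure lebesgue (A \<inter> X) + measure lebesgue (X - A)"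
            if X: "X \<in> lmeasurable" for X
          proof -
            have "A \<inter> X \<in> sets lebesgue"
              using A(1) fmeasurableD[OF X] by simp
            moreover have "X - A \<inter> X = X - A"
              by blast
            ultimately show ?thesis
              using measurable_measure_Diff[OF X, of "A \<inter> X"] by simp
          qed
          have ij: "snd i \<inter> snd j \<in> lmeasurable"
            using fmeasurable_Int_fmeasurable[OF cellq(3)[OF j] cellp(1)[OF i]] by (simp add: Int_commute)
          have "measure lebesgue (snd i \<inter> snd j - A) \<le> measure lebesgue (snd j - A)"
            using cellp(1)[OF i] cellq[OF j] A(1) by (intro measure_mono_fmeasurable) (auto intro: fmeasurable_Diff)
          then show ?thesis
            using True split[OF ij] split[OF cellq(3)[OF j]] measure_nonneg[of lebesgue "snd i \<inter> snd j - A"]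
            by (simp add: inf_assoc)
        next
          case False
          have "measure lebesgue (A \<inter> snd i \<inter> snd j) \<le> measure lebesgue (A \<inter> snd j)"
            using cellp(1)[OF i] cellq[OF j] A(1) Am
            by (intro measure_mono_fmeasurable) (auto intro: fmeasurable_Int_fmeasurable)
          then show ?thesis
            using False by simp
        qed
      qed
      finally show ?thesis
        using hen by linarith
    qed
    have "S1 - (\<Sum>(t, K)\<in>p. measure lebesgue (A \<inter> K) * f t) =
        (\<Sum>i\<in>p. ((\<Sum>j\<in>q. ?m i j * ?A (fst j)) - measure lebesgue (A \<inter> snd i)) * f (fst i))"
      by (simp add: S1_def split_def sum_subtractf left_diff_distrib sum_distrib_right)
    also have "\<bar>\<dots>\<bar> \<le> (\<Sum>i\<in>p. 2 * \<zeta> * \<bar>f (fst i)\<bar>)"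
      using row by (intro order_trans[OF sum_abs] sum_mono) (auto simp: abs_mult intro!: mult_right_mono)
    also have "\<dots> = 2 * (\<zeta> * N)"
      by (simp add: N_def sum_distrib_left mult.assoc)
    also have "\<dots> \<le> 2 * e"
      using \<open>0 < e\<close> \<open>0 \<le> N\<close> by (simp add: \<zeta>_def divide_simps)
    finally show ?thesis .
  qed
  ultimately show ?thesis
    by linarith
qed

section \<open>Multifunctions with values in \<open>cb(X)\<close>\<close>

lemma uniformly_gauge_integrable_mono:
  assumes "uniformly_gauge_integrable G P B f I" "G \<subseteq> G'" "\<And>p. P' p \<Longrightarrow> P p"
  shows "uniformly_gauge_integrable G' P' B f I"
  using assms unfolding uniformly_gauge_integrable_def by (meson subsetD)

lemma uniformly_perron_has_integral:
  assumes int: "uniformly_gauge_integrable gauges perron_partition B f I" and "b \<in> B"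
  shows "(f b has_integral I b) {0..1}"
proof -
  have "(f b has_integral I b) (cbox 0 1)"
    unfolding has_integral
  proof (intro allI impI)
    fix e :: real assume "0 < e"
    then obtain \<delta> where \<delta>: "\<delta> \<in> gauges" and I: "\<And>p. perron_partition p \<Longrightarrow> tag_fine \<delta> p \<Longrightarrow>
        \<bar>(\<Sum>(t, K)\<in>p. measure lebesgue K * f b t) - I b\<bar> < e"
      using int \<open>b \<in> B\<close> unfolding uniformly_gauge_integrable_def by meson
    show "\<exists>\<gamma>. gauge \<gamma> \<and> (\<forall>p. p tagged_division_of cbox 0 1 \<and> \<gamma> fine p \<longrightarrow>
        norm ((\<Sum>(x, K)\<in>p. measure lborel K *\<^sub>R f b x) - I b) < e)"
    proof (intro exI conjI allI impI)
      show "gauge (tag_gauge \<delta>)"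
        using \<delta> by (rule gauge_tag_gauge)
      fix p assume "p tagged_division_of cbox 0 (1::real) \<and> tag_gauge \<delta> fine p"
      then have p: "p tagged_division_of {0..1}" "tag_gauge \<delta> fine p"
        by auto
      show "norm ((\<Sum>(x, K)\<in>p. measure lborel K *\<^sub>R f b x) - I b) < e"
        using I[OF tag_gauge_fine(2,3)[OF p]] by (simp only: sum_lborel_eq_lebesgue[OF p(1)] real_norm_def)
    qed
  qed
  then show ?thesis
    by simp
qed

abbreviation dual_ball :: "('a::real_normed_vector \<Rightarrow>\<^sub>L real) set" where
  "dual_ball \<equiv> {x'. norm x' \<le> 1}"

abbreviation support_functions :: "(real \<Rightarrow> 'a::real_normed_vector set) \<Rightarrow> ('a \<Rightarrow>\<^sub>L real) \<Rightarrow> real \<Rightarrow> real" where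
  "support_functions \<Gamma> \<equiv> \<lambda>x' t. support x' (\<Gamma> t)"

lemma riemann_sum_support:
  fixes \<Gamma> :: "real \<Rightarrow> 'a::real_normed_vector set"
  assumes \<Gamma>: "\<And>t. t \<in> {0..1} \<Longrightarrow> \<Gamma> t \<in> cb" and p: "free_partition p"
  shows "riemann_sum \<Gamma> p \<noteq> {}" "bounded (riemann_sum \<Gamma> p)" "convex (riemann_sum \<Gamma> p)"
    "support x' (riemann_sum \<Gamma> p) = (\<Sum>(t, K)\<in>p. measure lebesgue K * support x' (\<Gamma> t))"
proof -
  have "\<Gamma> (fst i) \<in> cb" if "i \<in> p" for i
    using \<Gamma> free_partition_cell(3)[OF p that] .
  note s = support_weighted_sum[where C="\<lambda>i. \<Gamma> (fst i)" and w="\<lambda>i. measure lebesgue (snd i)", OF this measure_nonneg]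
  show "riemann_sum \<Gamma> p \<noteq> {}" "bounded (riemann_sum \<Gamma> p)" "convex (riemann_sum \<Gamma> p)"
    "support x' (riemann_sum \<Gamma> p) = (\<Sum>(t, K)\<in>p. measure lebesgue K * support x' (\<Gamma> t))"
    using s unfolding riemann_sum_def split_def by auto
qed

text \<open>Hausdorff distance is the supremum over the dual ball of differences of support
  functions, and these are additive on Riemann sums. The same gauge works in one direction; in the
  other \<open>e/2\<close> restores the strict inequality lost in the supremum.\<close>

lemma gauge_integrable_cb_iff:
  fixes \<Gamma> :: "real \<Rightarrow> 'a::real_normed_vector set"
  assumes \<Gamma>: "\<And>t. t \<in> {0..1} \<Longrightarrow> \<Gamma> t \<in> cb" and P: "\<And>p. P p \<Longrightarrow> free_partition p"
  shows "gauge_integrable_cb G P \<Gamma> \<longleftrightarrow>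
    (\<exists>\<Phi>\<in>cb. uniformly_gauge_integrable G P dual_ball (support_functions \<Gamma>) (\<lambda>x'. support x' \<Phi>))"
  unfolding gauge_integrable_cb_def
proof (intro bex_cong refl iffI)
  fix \<Phi> :: "'a set" assume "\<Phi> \<in> cb"
  then have \<Phi>: "\<Phi> \<noteq> {}" "bounded \<Phi>" "convex \<Phi>"
    by (auto simp: cb_def)
  have R: "riemann_sum \<Gamma> p \<noteq> {}" "bounded (riemann_sum \<Gamma> p)" "convex (riemann_sum \<Gamma> p)"
    "\<And>x'. support x' (riemann_sum \<Gamma> p) = (\<Sum>(t, K)\<in>p. measure lebesgue K * support x' (\<Gamma> t))" if "P p" for p
    using riemann_sum_support[where \<Gamma>=\<Gamma> and p=p] \<Gamma> P[OF that] by blast+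
  {
    assume *: "\<forall>e>0. \<exists>\<delta>\<in>G. \<forall>p. P p \<and> tag_fine \<delta> p \<longrightarrow> hausdorff_dist \<Phi> (riemann_sum \<Gamma> p) < e"
    show "uniformly_gauge_integrable G P dual_ball (support_functions \<Gamma>) (\<lambda>x'. support x' \<Phi>)"
      unfolding uniformly_gauge_integrable_def
    proof (intro allI impI)
      fix e :: real assume "0 < e"
      then obtain \<delta> where \<delta>: "\<delta> \<in> G" "\<And>p. P p \<Longrightarrow> tag_fine \<delta> p \<Longrightarrow> hausdorff_dist \<Phi> (riemann_sum \<Gamma> p) < e"
        using * by meson
      have "\<bar>(\<Sum>(t, K)\<in>p. measure lebesgue K * support x' (\<Gamma> t)) - support x' \<Phi>\<bar> < e"
        if x': "x' \<in> dual_ball" and p: "P p" "tag_fine \<delta> p" for x' p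
        using support_diff_le_hausdorff_dist[OF \<Phi>(1,2) R(1,2)[OF p(1)], where x'=x'] x' \<delta>(2)[OF p]
        unfolding R(4)[OF p(1)] by (simp add: abs_minus_commute)
      then show "\<exists>\<delta>\<in>G. \<forall>x'\<in>dual_ball. \<forall>p. P p \<longrightarrow> tag_fine \<delta> p \<longrightarrow>
          \<bar>(\<Sum>(t, K)\<in>p. measure lebesgue K * support x' (\<Gamma> t)) - support x' \<Phi>\<bar> < e"
        using \<delta>(1) by blast
    qed
  next
    assume *: "uniformly_gauge_integrable G P dual_ball (support_functions \<Gamma>) (\<lambda>x'. support x' \<Phi>)"
    show "\<forall>e>0. \<exists>\<delta>\<in>G. \<forall>p. P p \<and> tag_fine \<delta> p \<longrightarrow> hausdorff_dist \<Phi> (riemann_sum \<Gamma> p) < e"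
    proof (intro allI impI)
      fix e :: real assume "0 < e"
      then obtain \<delta> where \<delta>: "\<delta> \<in> G" "\<And>x' p. x' \<in> dual_ball \<Longrightarrow> P p \<Longrightarrow> tag_fine \<delta> p \<Longrightarrow>
          \<bar>(\<Sum>(t, K)\<in>p. measure lebesgue K * support x' (\<Gamma> t)) - support x' \<Phi>\<bar> < e/2"
        using *[unfolded uniformly_gauge_integrable_def, rule_format, of "e/2"] by auto
      have "hausdorff_dist \<Phi> (riemann_sum \<Gamma> p) < e" if p: "P p" "tag_fine \<delta> p" for p
      proof -
        have "hausdorff_dist \<Phi> (riemann_sum \<Gamma> p) \<le> e/2"
        proof (rule hausdorff_dist_le[OF \<Phi>(1,3,2) R(1,3,2)[OF p(1)]])
          fix x' :: "'a \<Rightarrow>\<^sub>L real" assume "norm x' \<le> 1"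
          then show "\<bar>support x' \<Phi> - support x' (riemann_sum \<Gamma> p)\<bar> \<le> e/2"
            using \<delta>(2)[OF _ p, of x'] unfolding R(4)[OF p(1)] by (simp add: abs_minus_commute less_imp_le)
        qed
        then show ?thesis
          using \<open>0 < e\<close> by linarith
      qed
      then show "\<exists>\<delta>\<in>G. \<forall>p. P p \<and> tag_fine \<delta> p \<longrightarrow> hausdorff_dist \<Phi> (riemann_sum \<Gamma> p) < e"
        using \<delta>(1) by blast
    qed
  }
qed

text \<open>Support functions are positively homogeneous in the functional, so the dual ball
  determines everything.\<close>

lemma pettis_integrable_cbI:
  fixes \<Gamma> :: "real \<Rightarrow> 'a::real_normed_vector set"
  assumes \<Gamma>: "\<And>t. t \<in> {0..1} \<Longrightarrow> \<Gamma> t \<in> cb"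
    and int: "\<And>x'. x' \<in> dual_ball \<Longrightarrow> set_integrable lebesgue {0..1} (support_functions \<Gamma> x')"
    and M: "\<And>A. A \<in> sets lebesgue \<Longrightarrow> A \<subseteq> {0..1} \<Longrightarrow>
      \<exists>M\<in>cb. \<forall>x'\<in>dual_ball. support x' M = (LINT t:A|lebesgue. support x' (\<Gamma> t))"
  shows "pettis_integrable_cb \<Gamma>"
proof -
  have scale: "\<exists>u c. u \<in> dual_ball \<and> 0 \<le> c \<and> (\<forall>C\<in>cb. support x' C = c * support u C)" for x' :: "'a \<Rightarrow>\<^sub>L real"
  proof (intro exI conjI ballI)
    \<comment> \<open>For \<open>x' = 0\<close> the convention \<open>1 / 0 = 0\<close> makes
      \<open>?u\<close> the zero functional and the factor \<open>norm x'\<close> zero, so the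
      identity persists.\<close>
    let ?u = "(1 / norm x') *\<^sub>R x'"
    show "?u \<in> dual_ball"
      by simp
    fix C :: "'a set" assume "C \<in> cb"
    then have "support (norm x' *\<^sub>R ?u) C = norm x' * support ?u C"
      by (intro support_scaleR_left) (auto simp: cb_def)
    then show "support x' C = norm x' * support ?u C"
      by (cases "x' = 0") auto
  qed simp
  show ?thesis
    unfolding pettis_integrable_cb_def
  proof (intro conjI allI impI)
    fix x' :: "'a \<Rightarrow>\<^sub>L real"
    obtain u c where u: "u \<in> dual_ball" "\<And>C. C \<in> cb \<Longrightarrow> support x' C = c * support u C"
      using scale by blast
    have "set_integrable lebesgue {0..1} (\<lambda>t. c * support u (\<Gamma> t))"
      using int[OF u(1)] by simp
    then show "set_integrable lebesgue {0..1} (\<lambda>t. support x' (\<Gamma> t))"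
      using u(2)[OF \<Gamma>] by (subst set_integrable_cong[OF refl refl]) auto
  next
    fix A :: "real set" assume A: "A \<in> sets lebesgue \<and> A \<subseteq> {0..1}"
    then obtain N where N: "N \<in> cb" "\<And>x'. x' \<in> dual_ball \<Longrightarrow> support x' N = (LINT t:A|lebesgue. support x' (\<Gamma> t))"
      using M by meson
    have "support x' N = (LINT t:A|lebesgue. support x' (\<Gamma> t))" for x'
    proof -
      obtain u c where u: "u \<in> dual_ball" "\<And>C. C \<in> cb \<Longrightarrow> support x' C = c * support u C"
        using scale by blast
      have "(LINT t:A|lebesgue. support x' (\<Gamma> t)) = (LINT t:A|lebesgue. c * support u (\<Gamma> t))"
        using A u(2) \<Gamma> by (intro set_lebesgue_integral_cong) auto
      then show ?thesis
        using u(2)[OF N(1)] N(2)[OF u(1)] by simp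
    qed
    then show "\<exists>M\<in>cb. \<forall>x'. support x' M = (LINT t:A|lebesgue. support x' (\<Gamma> t))"
      using N(1) by blast
  qed
qed

theorem mcshane_imp_pettis:
  fixes \<Gamma> :: "real \<Rightarrow> 'a::banach set"
  assumes \<Gamma>: "\<And>t. t \<in> {0..1} \<Longrightarrow> \<Gamma> t \<in> cb" and mcshane: "mcshane_integrable_cb \<Gamma>"
  shows "pettis_integrable_cb \<Gamma>"
proof -
  obtain \<Phi> where \<Phi>: "uniformly_gauge_integrable gauges free_partition dual_ball (support_functions \<Gamma>) (\<lambda>x'. support x' \<Phi>)"
    using mcshane gauge_integrable_cb_iff[where \<Gamma>=\<Gamma> and P=free_partition and G=gauges, OF \<Gamma>]
    unfolding mcshane_integrable_cb_def by blast
  have int: "set_integrable lebesgue {0..1} (\<lambda>t. support x' (\<Gamma> t))" if "x' \<in> dual_ball" for x'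
    using uniformly_mcshane_absolutely_integrable[OF \<Phi> that] .
  show ?thesis
  proof (rule pettis_integrable_cbI[OF \<Gamma> int])
    fix A :: "real set" assume A: "A \<in> sets lebesgue" "A \<subseteq> {0..1}"
    have "\<exists>C. C \<noteq> {} \<and> bounded C \<and> convex C \<and>
        (\<forall>x'\<in>dual_ball. \<bar>support x' C - (LINT t:A|lebesgue. support x' (\<Gamma> t))\<bar> \<le> (1/2) ^ n)" for n
    proof -
      \<comment> \<open>Division by 5 cancels the factor in the estimate of Riemann sums over
        \<open>A\<close>, which leaves the rate needed for the limit of the sets.\<close>
      define e where "e = (1/2 :: real) ^ n / 5"
      have "0 < e"
        by (simp add: e_def)
      then obtain \<delta> where \<delta>: "\<delta> \<in> gauges" and I: "\<And>x' p. x' \<in> dual_ball \<Longrightarrow> free_partition p \<Longrightarrow> tag_fine \<delta> p \<Longrightarrow>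
          \<bar>(\<Sum>(t, K)\<in>p. measure lebesgue K * support x' (\<Gamma> t)) - support x' \<Phi>\<bar> < e"
        using \<Phi> unfolding uniformly_gauge_integrable_def by meson
      obtain p where "p tagged_division_of cbox 0 (1::real)" "tag_gauge \<delta> fine p"
        using fine_division_exists gauge_tag_gauge[OF \<delta>] by blast
      then have p: "free_partition p" "tag_fine \<delta> p"
        using tag_gauge_fine by auto
      define C where "C = (\<Sum>i\<in>p. (\<lambda>x. measure lebesgue (A \<inter> snd i) *\<^sub>R x) ` \<Gamma> (fst i))"
      have \<Gamma>p: "\<Gamma> (fst i) \<in> cb" if "i \<in> p" for i
        using \<Gamma> free_partition_cell(3)[OF p(1) that] .
      have C: "C \<noteq> {}" "bounded C" "convex C"
        unfolding C_def by (rule support_weighted_sum; simp add: \<Gamma>p)+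
      have suppC: "support x' C = (\<Sum>i\<in>p. measure lebesgue (A \<inter> snd i) * support x' (\<Gamma> (fst i)))" for x'
        unfolding C_def by (rule support_weighted_sum(4)) (simp_all add: \<Gamma>p)
      have "\<bar>support x' C - (LINT t:A|lebesgue. support x' (\<Gamma> t))\<bar> \<le> (1/2) ^ n" if "x' \<in> dual_ball" for x'
        using Riemann_sum_over_measurable_set[OF int[OF that] \<delta> \<open>0 < e\<close> I[OF that] p A]
        by (simp add: suppC split_def e_def)
      with C show ?thesis
        by blast
    qed
    then have "\<exists>C. \<forall>n. C n \<noteq> {} \<and> bounded (C n) \<and> convex (C n) \<and>
        (\<forall>x'\<in>dual_ball. \<bar>support x' (C n) - (LINT t:A|lebesgue. support x' (\<Gamma> t))\<bar> \<le> (1/2) ^ n)"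
      by (intro choice allI)
    then obtain C where C: "\<And>n. C n \<noteq> {}" "\<And>n. bounded (C n)" "\<And>n. convex (C n)"
      and conv: "\<And>n x'. norm x' \<le> 1 \<Longrightarrow> \<bar>support x' (C n) - (LINT t:A|lebesgue. support x' (\<Gamma> t))\<bar> \<le> (1/2) ^ n"
      by auto
    show "\<exists>M\<in>cb. \<forall>x'\<in>dual_ball. support x' M = (LINT t:A|lebesgue. support x' (\<Gamma> t))"
      using support_limit_in_cb[of C "\<lambda>x'. LINT t:A|lebesgue. support x' (\<Gamma> t)", OF C conv]
      by (metis mem_Collect_eq)
  qed
qed

theorem pettis_perron_imp_free_integrable:
  fixes \<Gamma> :: "real \<Rightarrow> 'a::banach set"
  assumes no_c0: "\<not> contains_copy_of_c0 TYPE('a)" and \<Gamma>: "\<And>t. t \<in> {0..1} \<Longrightarrow> \<Gamma> t \<in> cb"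
    and G: "G = gauges \<or> G = measurable_gauges"
    and pettis: "pettis_integrable_cb \<Gamma>" and perron: "gauge_integrable_cb G perron_partition \<Gamma>"
  shows "gauge_integrable_cb G free_partition \<Gamma>"
proof -
  obtain \<Phi> where "\<Phi> \<in> cb"
    and \<Phi>: "uniformly_gauge_integrable G perron_partition dual_ball (support_functions \<Gamma>) (\<lambda>x'. support x' \<Phi>)"
    using perron gauge_integrable_cb_iff[where \<Gamma>=\<Gamma> and P=perron_partition and G=G, OF \<Gamma> perron_imp_free] by blast
  have int: "set_integrable lebesgue {0..1} (\<lambda>t. support x' (\<Gamma> t))" for x'
    using pettis by (simp add: pettis_integrable_cb_def)
  have "G \<subseteq> gauges"
    using G by (auto simp: measurable_gauges_def)
  then have "uniformly_gauge_integrable gauges perron_partition dual_ball (support_functions \<Gamma>) (\<lambda>x'. support x' \<Phi>)"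
    using uniformly_gauge_integrable_mono[OF \<Phi>] by blast
  note has_int = uniformly_perron_has_integral[OF this]
  \<comment> \<open>The Henstock-Kurzweil and Lebesgue integrals of a Lebesgue integrable function
    agree. So the same \<open>\<Phi>\<close> that is the limit over Perron partitions can serve as
    the limit over free ones.\<close>
  have eq: "support x' \<Phi> = (LINT t:{0..1}|lebesgue. support x' (\<Gamma> t))" if "x' \<in> dual_ball" for x'
    using integral_unique[OF has_int[OF that]] set_lebesgue_integral_eq_integral(2)[OF int[of x']] by simp
  have swap: "uniformly_gauge_integrable G P dual_ball (support_functions \<Gamma>) (\<lambda>x'. support x' \<Phi>) \<longleftrightarrow>
      uniformly_gauge_integrable G P dual_ball (support_functions \<Gamma>) (\<lambda>x'. LINT t:{0..1}|lebesgue. support x' (\<Gamma> t))" for P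
    unfolding uniformly_gauge_integrable_def using eq by (simp cong: ball_cong)
  have "uniformly_absolutely_continuous dual_ball (support_functions \<Gamma>)"
    unfolding uniformly_absolutely_continuous_def
    using pettis_uniformly_absolutely_continuous[OF no_c0 pettis] by simp
  then have "uniformly_gauge_integrable G free_partition dual_ball (support_functions \<Gamma>) (\<lambda>x'. support x' \<Phi>)"
    using uniformly_henstock_imp_mcshane[where B=dual_ball and f="support_functions \<Gamma>", OF G int] \<Phi>
    unfolding swap by blast
  then show ?thesis
    using \<open>\<Phi> \<in> cb\<close> gauge_integrable_cb_iff[where \<Gamma>=\<Gamma> and P=free_partition and G=G, OF \<Gamma>] by blast
qed

lemma gauge_integrable_cb_mono:
  assumes "gauge_integrable_cb G P \<Gamma>" "G \<subseteq> G'" "\<And>p. P' p \<Longrightarrow> P p"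
  shows "gauge_integrable_cb G' P' \<Gamma>"
  using assms unfolding gauge_integrable_cb_def by (meson subsetD)

theorem theorem4p4:
  fixes \<Gamma> :: "real \<Rightarrow> 'a::banach set"
  assumes "\<not> contains_copy_of_c0 TYPE('a)"
    and "\<And>t. t \<in> {0..1} \<Longrightarrow> \<Gamma> t \<in> cb"
  shows "(mcshane_integrable_cb \<Gamma> \<longleftrightarrow>
            pettis_integrable_cb \<Gamma> \<and> henstock_integrable_cb \<Gamma>) \<and>
         (birkhoff_integrable_cb \<Gamma> \<longleftrightarrow>
            pettis_integrable_cb \<Gamma> \<and> H_integrable_cb \<Gamma>)"
proof -
  have "measurable_gauges \<subseteq> gauges"
    by (simp add: measurable_gauges_def)
  \<comment> \<open>Measurable gauges are gauges, so the passage to Pettis integrability is required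
    for the McShane integral only.\<close>
  then have "mcshane_integrable_cb \<Gamma>" if "birkhoff_integrable_cb \<Gamma>"
    using that gauge_integrable_cb_mono unfolding mcshane_integrable_cb_def birkhoff_integrable_cb_def by blast
  then have "pettis_integrable_cb \<Gamma>" if "mcshane_integrable_cb \<Gamma> \<or> birkhoff_integrable_cb \<Gamma>"
    using that mcshane_imp_pettis[where \<Gamma>=\<Gamma>, OF assms(2)] by blast
  moreover have "gauge_integrable_cb G perron_partition \<Gamma>" if "gauge_integrable_cb G free_partition \<Gamma>" for G
    using that by (rule gauge_integrable_cb_mono) (auto intro: perron_imp_free)
  ultimately show ?thesis
    using pettis_perron_imp_free_integrable[where \<Gamma>=\<Gamma>, OF assms]
    unfolding mcshane_integrable_cb_def birkhoff_integrable_cb_def henstock_integrable_cb_def H_integrable_cb_def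
    by blast
qed

end
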